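(* Let $m\neq 0$ be a finite real constant and let $(M^n,g)$ be a compact Einstein manifold. Then $(M,g)$ is non-trivially $m$-quasi Einstein (that is, there exist a constant $A\in\mathbb{R}$ and a smooth vector field $X$ on $M$, not identically zero, with $\mathrm{Ric}_X^m=Ag$) if and only if $M$ is the circle $S^1$.
   Context: Manifolds are connected, smooth and without boundary. For a smooth vector field $X$ on a Riemannian manifold $(M,g)$ and a constant $m\ne 0$, the $m$-Bakry–Émery Ricci tensor is $\mathrm{Ric}_X^m=\mathrm{Ric}+\frac12\mathcal{L}_Xg-\frac1m X^*\otimes X^*$, where $X^*(Y)=g(X,Y)$ and $\mathcal{L}_Xg$ is the Lie derivative. The manifold is $m$-quasi Einstein if $\mathrm{Ric}_X^m=Ag$ for some constant $A$; the solution is called trivial if $X=0$. Einstein means $\mathrm{Ric}=\rho g$ for a constant $\rho$ (a one-dimensional manifold has $\mathrm{Ric}=0$ and counts as Einstein). *)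

theory Defs
  imports "HOL-Analysis.Analysis"
begin

section \<open>Smooth functions on open sets\<close>

text \<open>
  Meant for open \<open>S\<close>. Differentiability of every order along all constant directions, together
  with continuity of the resulting derivatives, is membership in \<open>C\<^sup>k(S)\<close>.
\<close>

primrec Ck_on :: "nat \<Rightarrow> ('v::euclidean_space \<Rightarrow> 'w::real_normed_vector) \<Rightarrow> 'v set \<Rightarrow> bool" where
  "Ck_on 0 f S \<longleftrightarrow> continuous_on S f"
| "Ck_on (Suc k) f S \<longleftrightarrow>
     (\<forall>x\<in>S. f differentiable (at x)) \<and> (\<forall>v. Ck_on k (\<lambda>x. frechet_derivative f (at x) v) S)"

definition smooth_on :: "('v::euclidean_space \<Rightarrow> 'w::real_normed_vector) \<Rightarrow> 'v set \<Rightarrow> bool" where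
  "smooth_on f S \<longleftrightarrow> (\<forall>k. Ck_on k f S)"


section \<open>Smooth manifolds\<close>

text \<open>
  The map of a chart is a total function, but only its values on the domain of the chart matter.
  The dimension is \<open>CARD('n)\<close>.
\<close>

datatype ('a, 'n::finite) chart = Chart (cdom: "'a set") (cmap: "'a \<Rightarrow> real^'n")

definition cimg :: "('a, 'n::finite) chart \<Rightarrow> (real^'n) set" where
  "cimg c = cmap c ` cdom c"

definition cinv :: "('a, 'n::finite) chart \<Rightarrow> real^'n \<Rightarrow> 'a" where
  "cinv c = inv_into (cdom c) (cmap c)"

definition transition :: "('a, 'n::finite) chart \<Rightarrow> ('a, 'n) chart \<Rightarrow> real^'n \<Rightarrow> real^'n" where
  "transition c d = cmap d \<circ> cinv c"

definition is_chart :: "'a topology \<Rightarrow> ('a, 'n::finite) chart \<Rightarrow> bool" where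
  "is_chart T c \<longleftrightarrow> openin T (cdom c) \<and> open (cimg c) \<and>
     homeomorphic_map (subtopology T (cdom c)) (top_of_set (cimg c)) (cmap c)"

text \<open>
  Manifolds are connected and nonempty, smooth and without boundary. The smooth structure is
  given by an atlas, which need not be maximal; all notions below are insensitive to enlarging it
  by compatible charts.
\<close>

locale smooth_manifold =
  fixes T :: "'a topology" and \<A> :: "('a, 'n::finite) chart set"
  assumes Hausdorff: "Hausdorff_space T"
    and second_countable: "second_countable T"
    and connected: "connected_space T"
    and nonempty: "topspace T \<noteq> {}"
    and covering: "(\<Union>c\<in>\<A>. cdom c) = topspace T"
    and charts: "\<And>c. c \<in> \<A> \<Longrightarrow> is_chart T c"
    and compatible: "\<And>c d. c \<in> \<A> \<Longrightarrow> d \<in> \<A> \<Longrightarrow>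
          smooth_on (transition c d) (cmap c ` (cdom c \<inter> cdom d))"

definition smooth_map ::
  "'a topology \<Rightarrow> ('a, 'n::finite) chart set \<Rightarrow> 'b topology \<Rightarrow> ('b, 'k::finite) chart set
    \<Rightarrow> ('a \<Rightarrow> 'b) \<Rightarrow> bool" where
  "smooth_map T \<A> T' \<A>' F \<longleftrightarrow> continuous_map T T' F \<and>
     (\<forall>c\<in>\<A>. \<forall>d\<in>\<A>'. smooth_on (cmap d \<circ> F \<circ> cinv c) (cmap c ` (cdom c \<inter> F -` cdom d)))"

definition diffeomorphic ::
  "'a topology \<Rightarrow> ('a, 'n::finite) chart set \<Rightarrow> 'b topology \<Rightarrow> ('b, 'k::finite) chart set \<Rightarrow> bool" where
  "diffeomorphic T \<A> T' \<A>' \<longleftrightarrow>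
     (\<exists>F G. smooth_map T \<A> T' \<A>' F \<and> smooth_map T' \<A>' T \<A> G \<and>
        (\<forall>p\<in>topspace T. G (F p) = p) \<and> (\<forall>q\<in>topspace T'. F (G q) = q))"


section \<open>The circle\<close>

abbreviation circle :: "complex topology" where
  "circle \<equiv> top_of_set (sphere 0 1)"

text \<open>The angle measured from \<open>a\<close>, defined away from the antipode of \<open>a\<close>, with values in \<open>(-\<pi>, \<pi>)\<close>.\<close>

definition angle_chart :: "complex \<Rightarrow> (complex, 1) chart" where
  "angle_chart a = Chart (sphere 0 1 - {-a}) (\<lambda>z. vec (Arg (z / a)))"

definition circle_atlas :: "(complex, 1) chart set" where
  "circle_atlas = {angle_chart 1, angle_chart (-1)}"


section \<open>Tensor fields and curvature in coordinates\<close>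

text \<open>
  A tensor field is given by its components in each chart \<open>c\<close> of the atlas, as functions of the
  coordinates in \<open>cimg c\<close>, subject to the transformation law on overlaps.
\<close>

type_synonym ('a, 'n) vfield = "('a, 'n) chart \<Rightarrow> real^'n \<Rightarrow> real^'n"

type_synonym ('a, 'n) form2 = "('a, 'n) chart \<Rightarrow> real^'n \<Rightarrow> real^'n^'n"

definition jacobian :: "('a, 'n::finite) chart \<Rightarrow> ('a, 'n) chart \<Rightarrow> real^'n \<Rightarrow> real^'n^'n" where
  "jacobian c d x = matrix (frechet_derivative (transition c d) (at x))"

definition smooth_vector_field :: "('a, 'n::finite) chart set \<Rightarrow> ('a, 'n) vfield \<Rightarrow> bool" where
  "smooth_vector_field \<A> X \<longleftrightarrow>
     (\<forall>c\<in>\<A>. smooth_on (X c) (cimg c)) \<and>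
     (\<forall>c\<in>\<A>. \<forall>d\<in>\<A>. \<forall>x \<in> cmap c ` (cdom c \<inter> cdom d).
        X d (transition c d x) = jacobian c d x *v X c x)"

definition riemannian_metric :: "('a, 'n::finite) chart set \<Rightarrow> ('a, 'n) form2 \<Rightarrow> bool" where
  "riemannian_metric \<A> g \<longleftrightarrow>
     (\<forall>c\<in>\<A>. smooth_on (g c) (cimg c)) \<and>
     (\<forall>c\<in>\<A>. \<forall>x\<in>cimg c. transpose (g c x) = g c x \<and> (\<forall>v. v \<noteq> 0 \<longrightarrow> v \<bullet> (g c x *v v) > 0)) \<and>
     (\<forall>c\<in>\<A>. \<forall>d\<in>\<A>. \<forall>x \<in> cmap c ` (cdom c \<inter> cdom d).
        g c x = transpose (jacobian c d x) ** g d (transition c d x) ** jacobian c d x)"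

locale riemannian_manifold = smooth_manifold T \<A>
  for T :: "'a topology" and \<A> :: "('a, 'n::finite) chart set" +
  fixes g :: "('a, 'n) form2"
  assumes metric: "riemannian_metric \<A> g"

text \<open>
  From here to the Bakry--Emery tensor, \<open>G\<close> and \<open>X\<close> are the components of the metric and of the
  vector field in one chart. \<open>pd i\<close> is \<open>\<partial>\<^sub>i\<close>.
\<close>

definition pd :: "'n \<Rightarrow> (real^'n \<Rightarrow> real) \<Rightarrow> real^'n \<Rightarrow> real" where
  "pd i f x = frechet_derivative f (at x) (axis i 1)"

text \<open>\<open>christoffel G k i j\<close> is \<open>\<Gamma>\<^sup>k\<^sub>i\<^sub>j\<close>, the Levi-Civita connection being \<open>\<nabla>\<^sub>i \<partial>\<^sub>j = \<Gamma>\<^sup>k\<^sub>i\<^sub>j \<partial>\<^sub>k\<close>.\<close>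

definition christoffel :: "(real^'n \<Rightarrow> real^'n^'n) \<Rightarrow> 'n \<Rightarrow> 'n \<Rightarrow> 'n \<Rightarrow> real^'n \<Rightarrow> real" where
  "christoffel G k i j x = (1/2) * (\<Sum>l\<in>UNIV. matrix_inv (G x) $ k $ l *
     (pd i (\<lambda>y. G y $ j $ l) x + pd j (\<lambda>y. G y $ i $ l) x - pd l (\<lambda>y. G y $ i $ j) x))"

text \<open>
  \<open>riemann G l k i j\<close> is the \<open>\<partial>\<^sub>l\<close>-component of \<open>R(\<partial>\<^sub>i, \<partial>\<^sub>j) \<partial>\<^sub>k = \<nabla>\<^sub>i \<nabla>\<^sub>j \<partial>\<^sub>k - \<nabla>\<^sub>j \<nabla>\<^sub>i \<partial>\<^sub>k\<close>, and
  \<open>Ric(Y, Z)\<close> is the trace of \<open>W \<mapsto> R(W, Y) Z\<close> (positive on round spheres).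
\<close>

definition riemann :: "(real^'n \<Rightarrow> real^'n^'n) \<Rightarrow> 'n \<Rightarrow> 'n \<Rightarrow> 'n \<Rightarrow> 'n \<Rightarrow> real^'n \<Rightarrow> real" where
  "riemann G l k i j x =
     pd i (christoffel G l j k) x - pd j (christoffel G l i k) x
     + (\<Sum>p\<in>UNIV. christoffel G l i p x * christoffel G p j k x
                 - christoffel G l j p x * christoffel G p i k x)"

definition ricci :: "(real^'n \<Rightarrow> real^'n^'n) \<Rightarrow> real^'n \<Rightarrow> real^'n^'n" where
  "ricci G x = (\<chi> j k. \<Sum>i\<in>UNIV. riemann G i k i j x)"

text \<open>
  \<open>(L\<^sub>X g)(\<partial>\<^sub>i, \<partial>\<^sub>j) = X (g(\<partial>\<^sub>i, \<partial>\<^sub>j)) - g([X, \<partial>\<^sub>i], \<partial>\<^sub>j) - g(\<partial>\<^sub>i, [X, \<partial>\<^sub>j])\<close> with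
  \<open>[X, \<partial>\<^sub>i] = - (\<partial>\<^sub>i X\<^sup>k) \<partial>\<^sub>k\<close>.
\<close>

definition lie_derivative ::
  "(real^'n \<Rightarrow> real^'n) \<Rightarrow> (real^'n \<Rightarrow> real^'n^'n) \<Rightarrow> real^'n \<Rightarrow> real^'n^'n" where
  "lie_derivative X G x = (\<chi> i j. \<Sum>k\<in>UNIV.
       X x $ k * pd k (\<lambda>y. G y $ i $ j) x
     + pd i (\<lambda>y. X y $ k) x * G x $ k $ j
     + pd j (\<lambda>y. X y $ k) x * G x $ i $ k)"

definition flat :: "(real^'n \<Rightarrow> real^'n^'n) \<Rightarrow> (real^'n \<Rightarrow> real^'n) \<Rightarrow> real^'n \<Rightarrow> real^'n" where
  "flat G X x = G x *v X x"

definition tensor_square :: "real^'n \<Rightarrow> real^'n^'n" where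
  "tensor_square \<alpha> = (\<chi> i j. \<alpha> $ i * \<alpha> $ j)"

definition bakry_emery_ricci ::
  "real \<Rightarrow> (real^'n \<Rightarrow> real^'n) \<Rightarrow> (real^'n \<Rightarrow> real^'n^'n) \<Rightarrow> real^'n \<Rightarrow> real^'n^'n" where
  "bakry_emery_ricci m X G x =
     ricci G x + (1/2) *\<^sub>R lie_derivative X G x - (1/m) *\<^sub>R tensor_square (flat G X x)"


section \<open>Einstein and quasi Einstein metrics\<close>

definition einstein :: "('a, 'n::finite) chart set \<Rightarrow> ('a, 'n) form2 \<Rightarrow> bool" where
  "einstein \<A> g \<longleftrightarrow> (\<exists>\<rho>. \<forall>c\<in>\<A>. \<forall>x\<in>cimg c. ricci (g c) x = \<rho> *\<^sub>R g c x)"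

definition quasi_einstein ::
  "('a, 'n::finite) chart set \<Rightarrow> ('a, 'n) form2 \<Rightarrow> real \<Rightarrow> ('a, 'n) vfield \<Rightarrow> bool" where
  "quasi_einstein \<A> g m X \<longleftrightarrow>
     (\<exists>A. \<forall>c\<in>\<A>. \<forall>x\<in>cimg c. bakry_emery_ricci m (X c) (g c) x = A *\<^sub>R g c x)"

definition trivial_field :: "('a, 'n::finite) chart set \<Rightarrow> ('a, 'n) vfield \<Rightarrow> bool" where
  "trivial_field \<A> X \<longleftrightarrow> (\<forall>c\<in>\<A>. \<forall>x\<in>cimg c. X c x = 0)"

definition nontrivially_quasi_einstein ::
  "('a, 'n::finite) chart set \<Rightarrow> ('a, 'n) form2 \<Rightarrow> real \<Rightarrow> bool" where
  "nontrivially_quasi_einstein \<A> g m \<longleftrightarrow>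
     (\<exists>X. smooth_vector_field \<A> X \<and> \<not> trivial_field \<A> X \<and> quasi_einstein \<A> g m X)"


section \<open>The circle is a manifold, and one-dimensional metrics are Einstein\<close>

lemma smooth_on_translation:
  assumes "open S" and D: "\<And>x. x \<in> S \<Longrightarrow> (f has_derivative (\<lambda>h. h)) (at x)"
  shows "smooth_on f S"
proof -
  have const: "Ck_on k h S" if "\<And>x. x \<in> S \<Longrightarrow> h x = w" for h :: "'a \<Rightarrow> 'a" and w k
    using that
  proof (induction k arbitrary: h w)
    case 0
    then show ?case by (simp add: continuous_on_eq[OF continuous_on_const])
  next
    case (Suc k)
    have d: "(h has_derivative (\<lambda>_. 0)) (at x)" if "x \<in> S" for x
      by (rule has_derivative_transform_within_open[OF has_derivative_const \<open>open S\<close> that])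
         (simp add: Suc.prems)
    then have "frechet_derivative h (at x) = (\<lambda>_. 0)" if "x \<in> S" for x
      using that frechet_derivative_at by metis
    with d show ?case by (auto simp: differentiable_def intro!: Suc.IH)
  qed
  have "frechet_derivative f (at x) = (\<lambda>h. h)" if "x \<in> S" for x
    using D[OF that] frechet_derivative_at by metis
  then have "Ck_on k f S" for k
    using D by (cases k)
      (auto simp: differentiable_def intro!: const
        intro: continuous_at_imp_continuous_on has_derivative_continuous)
  then show ?thesis by (simp add: smooth_on_def)
qed

lemma nonpos_Reals_unit:
  fixes z :: complex
  assumes "norm z = 1" "z \<in> \<real>\<^sub>\<le>\<^sub>0"
  shows "z = -1"
proof -
  obtain r where "z = of_real r" "r \<le> 0" using assms(2) by (rule nonpos_Reals_cases)
  with assms(1) have "r = -1" by simp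
  with \<open>z = of_real r\<close> show ?thesis by simp
qed

lemma cdom_angle: "cdom (angle_chart a) = sphere 0 1 - {-a}"
  and cmap_angle: "cmap (angle_chart a) z = vec (Arg (z / a))"
  by (simp_all add: angle_chart_def)

lemma cdom_angleD:
  assumes "norm a = 1" "z \<in> cdom (angle_chart a)"
  shows "z / a \<notin> \<real>\<^sub>\<le>\<^sub>0"
proof
  assume "z / a \<in> \<real>\<^sub>\<le>\<^sub>0"
  moreover have "norm (z / a) = 1" using assms by (simp add: cdom_angle norm_divide)
  ultimately have "z / a = -1" by (rule nonpos_Reals_unit[rotated])
  moreover have "a \<noteq> 0" using assms by auto
  ultimately have "z = - a" by (simp add: field_simps)
  with assms show False by (simp add: cdom_angle)
qed

lemma angle_left:
  assumes "norm a = 1" "z \<in> cdom (angle_chart a)"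
  shows "a * cis (cmap (angle_chart a) z $ 1) = z"
proof -
  have "a \<noteq> 0" "z \<noteq> 0" "norm (z / a) = 1" using assms by (auto simp: cdom_angle norm_divide)
  then show ?thesis using cis_Arg[of "z / a"] by (simp add: cmap_angle sgn_div_norm)
qed

lemma angle_right:
  assumes a: "norm a = 1" and x: "-pi < x $ 1" "x $ 1 < pi"
  shows "a * cis (x $ 1) \<in> cdom (angle_chart a)"
    and "cmap (angle_chart a) (a * cis (x $ 1)) = x"
proof -
  have a0: "a \<noteq> 0" using a by auto
  have A: "Arg (cis (x $ 1)) = x $ 1" using x by (intro cis_Arg_unique) auto
  then have "cis (x $ 1) \<noteq> -1" using x Arg_of_real[of "-1"] by (metis less_irrefl of_real_1 of_real_minus neg_less_0_iff_less zero_less_one)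
  then show "a * cis (x $ 1) \<in> cdom (angle_chart a)"
    using a a0 by (auto simp: cdom_angle norm_mult) (metis mult_cancel_left mult_minus1_right)
  show "cmap (angle_chart a) (a * cis (x $ 1)) = x"
    using a0 A by (simp add: cmap_angle vec_eq_iff)
qed

lemma cimg_angle:
  assumes a: "norm a = 1"
  shows "cimg (angle_chart a) = {x. -pi < x $ 1 \<and> x $ 1 < pi}"
proof -
  have "-pi < cmap (angle_chart a) z $ 1 \<and> cmap (angle_chart a) z $ 1 < pi"
    if "z \<in> cdom (angle_chart a)" for z
    using cdom_angleD[OF a that] mpi_less_Arg Arg_le_pi[of "z / a"] Arg_eq_pi[of "z / a"]
    by (auto simp: cmap_angle less_le complex_nonpos_Reals_iff)
  then show ?thesis
    using angle_right[OF a] by (force simp: cimg_def image_iff)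
qed

lemma inj_angle: "norm a = 1 \<Longrightarrow> inj_on (cmap (angle_chart a)) (cdom (angle_chart a))"
  by (metis angle_left inj_onI)

lemma cinv_angle:
  assumes "norm a = 1" "x \<in> cimg (angle_chart a)"
  shows "cinv (angle_chart a) x = a * cis (x $ 1)"
  using assms angle_right[OF assms(1), of x]
  by (auto simp: cimg_angle cinv_def intro: inv_into_f_eq[OF inj_angle])

lemma open_cimg_angle: "norm a = 1 \<Longrightarrow> open (cimg (angle_chart a))"
  by (simp add: cimg_angle) (intro open_Collect_conj open_Collect_less continuous_intros)

lemma is_chart_angle:
  assumes a: "norm a = 1"
  shows "is_chart circle (angle_chart a)"
proof -
  let ?c = "angle_chart a"
  have o: "openin circle (cdom ?c)"
    unfolding cdom_angle by (auto simp: openin_open intro!: exI[of _ "- {-a}"])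
  have cm: "continuous_on (cdom ?c) (cmap ?c)"
  proof -
    have "continuous_on (cdom ?c) (\<lambda>z. vec (Arg (z / a)) :: real^1)"
      unfolding vec_def using cdom_angleD[OF a] a
      by (intro continuous_on_vec_lambda continuous_intros) auto
    then show ?thesis by (simp add: cmap_angle)
  qed
  have ci: "continuous_on (cimg ?c) (\<lambda>x. a * cis (x $ 1))"
    by (intro continuous_intros)
  have sub: "subtopology circle (cdom ?c) = top_of_set (cdom ?c)"
    by (simp add: subtopology_subtopology cdom_angle Int_absorb1 Diff_subset)
  have "homeomorphic_maps (top_of_set (cdom ?c)) (top_of_set (cimg ?c)) (cmap ?c) (\<lambda>x. a * cis (x $ 1))"
    using cm ci angle_left[OF a] angle_right[OF a]
    by (auto simp: homeomorphic_maps_def cimg_def)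
  then show ?thesis
    using o open_cimg_angle[OF a] by (auto simp: is_chart_def sub homeomorphic_map_maps)
qed

lemma transition_angle:
  assumes a: "norm a = 1" and b: "norm b = 1"
  shows "smooth_on (transition (angle_chart a) (angle_chart b))
           (cmap (angle_chart a) ` (cdom (angle_chart a) \<inter> cdom (angle_chart b)))"
proof (rule smooth_on_translation)
  let ?c = "angle_chart a" and ?d = "angle_chart b"
  let ?S = "cmap ?c ` (cdom ?c \<inter> cdom ?d)"
  have S: "?S = cimg ?c \<inter> (\<lambda>x. a * cis (x $ 1)) -` (- {-b})"
  proof (intro set_eqI iffI)
    fix x assume "x \<in> ?S"
    then show "x \<in> cimg ?c \<inter> (\<lambda>x. a * cis (x $ 1)) -` (- {-b})"
      using angle_left[OF a] by (auto simp: cimg_def) (simp add: cdom_angle)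
  next
    fix x assume x: "x \<in> cimg ?c \<inter> (\<lambda>x. a * cis (x $ 1)) -` (- {-b})"
    then have "a * cis (x $ 1) \<in> cdom ?c" "cmap ?c (a * cis (x $ 1)) = x"
      using angle_right[OF a, of x] by (auto simp: cimg_angle[OF a])
    moreover have "a * cis (x $ 1) \<in> cdom ?d"
      using x a by (auto simp: cdom_angle norm_mult)
    ultimately show "x \<in> ?S" by (metis IntI image_eqI)
  qed
  show op: "open ?S"
    unfolding S by (intro open_Int open_cimg_angle[OF a] open_vimage continuous_intros)
  fix x assume x: "x \<in> ?S"
  then have w: "a * cis (x $ 1) / b \<notin> \<real>\<^sub>\<le>\<^sub>0"
    using cdom_angleD[OF b] angle_left[OF a] by auto
  let ?F = "\<lambda>t. a * cis t / b"
  have eq: "vec (Im (Ln (a * cis (y $ 1) / b))) = transition ?c ?d y" if "y \<in> ?S" for y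
  proof -
    have y: "y \<in> cimg ?c" using that S by auto
    have "a \<noteq> 0" "b \<noteq> 0" using a b by auto
    then show ?thesis
      by (simp add: transition_def cinv_angle[OF a y] cmap_angle Arg_eq_Im_Ln)
  qed
  have "((\<lambda>y::real^1. vec (Im (Ln (a * cis (y $ 1) / b))) :: real^1) has_derivative (\<lambda>h. h)) (at x)"
  proof -
    have "b \<noteq> 0" "a \<noteq> 0" using a b by auto
    have "((\<lambda>t. a * exp (\<i> * of_real t) / b) has_vector_derivative \<i> * (a * exp (\<i> * of_real (x $ 1)) / b)) (at (x $ 1))"
      using \<open>b \<noteq> 0\<close>
      by (auto intro!: derivative_eq_intros has_vector_derivative_real_field simp: field_simps)
    then have "(?F has_vector_derivative \<i> * ?F (x $ 1)) (at (x $ 1))"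
      by (simp add: cis_conv_exp)
    from field_vector_diff_chain_at[OF this has_field_derivative_Ln[OF w]]
    have "((\<lambda>t. Ln (?F t)) has_vector_derivative \<i>) (at (x $ 1))"
      using \<open>b \<noteq> 0\<close> \<open>a \<noteq> 0\<close> by (simp add: o_def)
    then have "((\<lambda>t. Im (Ln (?F t))) has_vector_derivative 1) (at (x $ 1))"
      using bounded_linear.has_vector_derivative[OF bounded_linear_Im] by fastforce
    then have 1: "((\<lambda>t. Im (Ln (?F t))) has_derivative (\<lambda>h. h)) (at (x $ 1))"
      by (simp add: has_vector_derivative_def)
    have 2: "((\<lambda>y::real^1. y $ 1) has_derivative (\<lambda>h. h $ 1)) (at x)"
      by (intro bounded_linear_imp_has_derivative bounded_linear_vec_nth)
    have "((\<lambda>y::real^1. Im (Ln (?F (y $ 1)))) has_derivative (\<lambda>h. h $ 1)) (at x)"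
      using has_derivative_compose[OF 2 1] .
    moreover have "bounded_linear (vec :: real \<Rightarrow> real^1)"
      by (intro linear_linear[THEN iffD2] linearI) (auto simp: vec_eq_iff)
    ultimately have "((\<lambda>y::real^1. vec (Im (Ln (?F (y $ 1)))) :: real^1) has_derivative (\<lambda>h. vec (h $ 1))) (at x)"
      by (rule bounded_linear.has_derivative[rotated])
    moreover have "(\<lambda>h::real^1. vec (h $ 1)) = (\<lambda>h. h)" by (auto simp: vec_eq_iff)
    ultimately show ?thesis by simp
  qed
  from has_derivative_transform_within_open[OF this op x eq]
  show "(transition ?c ?d has_derivative (\<lambda>h. h)) (at x)" .
qed

lemma circle_smooth_manifold: "smooth_manifold circle circle_atlas"
proof
  show "Hausdorff_space circle" by (simp add: Hausdorff_space_subtopology)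
  show "second_countable circle"
  proof (rule second_countable_subtopology)
    obtain B :: "complex set set" where "countable B" "topological_basis B"
      using ex_countable_basis by blast
    then show "second_countable (euclidean :: complex topology)"
      unfolding second_countable_def by (metis open_openin topological_basisE topological_basis_open)
  qed
  show "connected_space circle"
    by (simp add: connected_space_subtopology connected_sphere)
  show "topspace circle \<noteq> {}" by auto
  show "(\<Union>c\<in>circle_atlas. cdom c) = topspace circle"
    by (auto simp: circle_atlas_def cdom_angle)
qed (auto simp: circle_atlas_def intro!: is_chart_angle transition_angle)

lemma einstein_1:
  assumes "CARD('n::finite) = 1"
  shows "einstein (\<A> :: ('a, 'n) chart set) g"
proof -
  obtain i :: 'n where "(UNIV :: 'n set) = {i}" using assms card_1_singletonE by blast
  then have "j = k" for j k :: 'n by (metis UNIV_I singletonD)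
  then have eq: "j = i" for j :: 'n by blast
  have "ricci G x = 0" for G and x :: "real^'n"
  proof -
    have "riemann G l k p q x = 0" for l k p q
      unfolding riemann_def eq[of l] eq[of k] eq[of p] eq[of q] by simp
    then show ?thesis by (simp add: ricci_def vec_eq_iff)
  qed
  then show ?thesis by (auto simp: einstein_def intro: exI[of _ 0])
qed

end

theory Submission
  imports Defs
begin

text \<open>
  Let \<open>n\<close> be the dimension and \<open>f = |X|\<^sup>2\<close>. For an Einstein metric the quasi Einstein equation reads
  \<open>L\<^sub>X g / 2 - X\<^sup>* \<otimes> X\<^sup>* / m = B g\<close> for a constant \<open>B\<close>. Evaluated on \<open>(X, X)\<close> it gives
  \<open>X(f) = 2 f (f / m + B)\<close>, so that a nonzero maximum of \<open>f\<close> equals \<open>- m B\<close>; its trace is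
  \<open>div X = f / m + n B\<close>. Hence \<open>- m div X \<ge> (n - 1) (- m B) \<ge> 0\<close>, and since the divergence integrates
  to zero, \<open>n = 1\<close> and \<open>f = - m B > 0\<close> everywhere. A complete integral curve of the nowhere
  vanishing field \<open>X\<close> is onto and periodic, and therefore identifies the manifold with the circle.
  Conversely, a unit field on a circle is Killing, and satisfies the equation with \<open>A = \<rho> - 1 / m\<close>.
\<close>

section \<open>Calculus of \<open>C\<^sup>k\<close> functions\<close>

text \<open>All arguments run in the charts of the given atlas. The divergence theorem involves
  first derivatives only, so \<open>C^1\<close> cutoffs suffice; integration is against the density
  \<open>sqrt (det g)\<close>, whose logarithmic derivative is half the trace of the derivative of
  the metric, taken with the inverse metric. This is what turns half the trace of the Lie derivative
  of the metric into \<open>div X\<close>. The factor \<open>- m\<close> in front of the divergence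
  makes the estimate uniform in the sign of \<open>m\<close>. In dimension one the flow is found by
  quadrature: a primitive of \<open>1/X\<close> is a local time function. Its inverse is the
  integral curve, its injectivity gives uniqueness, and it supplies the smooth local inverses of the
  closed curve. In the converse direction the metric determines a unit field only up to sign. A sign
  that is coherent over all charts has to come from the given diffeomorphism, through which the
  standard orientation of the circle is pulled back.\<close>

lemma has_derivative_imp_frechet: "(f has_derivative f') (at x) \<Longrightarrow> frechet_derivative f (at x) = f'"
  using frechet_derivative_at by metis

lemma frechet_derivative_cong_open:
  assumes "open S" "x \<in> S" "\<And>y. y \<in> S \<Longrightarrow> f y = h y"
  shows "frechet_derivative f (at x) = frechet_derivative h (at x)"
proof -
  have "(f has_derivative D) (at x) \<longleftrightarrow> (h has_derivative D) (at x)" for D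
    using has_derivative_transform_within_open[OF _ assms(1,2)] assms(3) by metis
  then show ?thesis by (simp add: frechet_derivative_def)
qed

lemma differentiable_cong_open:
  assumes "open S" "x \<in> S" "\<And>y. y \<in> S \<Longrightarrow> f y = h y"
  shows "f differentiable (at x) \<longleftrightarrow> h differentiable (at x)"
  using has_derivative_transform_within_open[OF _ assms(1,2)] assms(3)
  unfolding differentiable_def by metis

text \<open>Derivatives are taken in the ambient space; openness of \<open>S\<close> makes them
  depend on the values on \<open>S\<close> only, at every order of the recursion.\<close>

lemma Ck_on_cong:
  assumes "open S" "\<And>x. x \<in> S \<Longrightarrow> f x = h x"
  shows "Ck_on k f S \<longleftrightarrow> Ck_on k h S"
  using assms(2)
proof (induction k arbitrary: f h)
  case 0
  then show ?case by (simp cong: continuous_on_cong)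
next
  case (Suc k)
  have "Ck_on k (\<lambda>x. frechet_derivative f (at x) v) S
    \<longleftrightarrow> Ck_on k (\<lambda>x. frechet_derivative h (at x) v) S" for v
    by (rule Suc.IH) (metis frechet_derivative_cong_open[OF \<open>open S\<close>] Suc.prems)
  moreover have "f differentiable (at x) \<longleftrightarrow> h differentiable (at x)" if "x \<in> S" for x
    using differentiable_cong_open[OF \<open>open S\<close> that] Suc.prems by metis
  ultimately show ?case by simp
qed

text \<open>The working form of the recursion: an explicit derivative found by the usual rules
  replaces \<open>frechet_derivative\<close>, and its regularity is then a problem of one order
  less.\<close>

lemma Ck_on_SucI:
  assumes "open S" "\<And>x. x \<in> S \<Longrightarrow> (f has_derivative f' x) (at x)"
    "\<And>v. Ck_on k (\<lambda>x. f' x v) S"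
  shows "Ck_on (Suc k) f S"
proof -
  have "Ck_on k (\<lambda>x. frechet_derivative f (at x) v) S" for v
    using assms has_derivative_imp_frechet[OF assms(2)]
    by (subst Ck_on_cong[where h = "\<lambda>x. f' x v"]) auto
  then show ?thesis using assms(2) by (auto simp: differentiable_def)
qed

lemma Ck_on_SucD:
  assumes "Ck_on (Suc k) f S"
  shows "x \<in> S \<Longrightarrow> (f has_derivative frechet_derivative f (at x)) (at x)"
    and "Ck_on k (\<lambda>x. frechet_derivative f (at x) v) S"
  using assms by (auto simp: frechet_derivative_works)

lemma Ck_on_lower: "Ck_on (Suc k) f S \<Longrightarrow> Ck_on k f S"
proof (induction k arbitrary: f)
  case 0
  then show ?case
    by (auto intro!: continuous_at_imp_continuous_on differentiable_imp_continuous_within)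
next
  case (Suc k)
  then show ?case by (metis Ck_on.simps(2))
qed

lemma Ck_on_continuous: "Ck_on k f S \<Longrightarrow> continuous_on S f"
  by (induction k) (use Ck_on_lower in \<open>auto intro!: continuous_at_imp_continuous_on differentiable_imp_continuous_within\<close>)

lemma Ck_on_subset: "Ck_on k f S \<Longrightarrow> S' \<subseteq> S \<Longrightarrow> Ck_on k f S'"
  by (induction k arbitrary: f) (auto intro: continuous_on_subset)

lemma Ck_on_const: "open S \<Longrightarrow> Ck_on k (\<lambda>_. c) S"
proof (induction k arbitrary: c)
  case (Suc k)
  show ?case by (rule Ck_on_SucI[OF Suc.prems, where f' = "\<lambda>_ _. 0"]) (auto intro: Suc)
qed simp

lemma Ck_on_bounded_linear_compose:
  assumes "open S" "bounded_linear l" "Ck_on k f S"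
  shows "Ck_on k (\<lambda>x. l (f x)) S"
  using assms(3)
proof (induction k arbitrary: f)
  case 0
  then show ?case using assms by (auto intro: bounded_linear.continuous_on)
next
  case (Suc k)
  show ?case
    by (rule Ck_on_SucI[OF \<open>open S\<close>, where f' = "\<lambda>x v. l (frechet_derivative f (at x) v)"])
       (use Suc Ck_on_SucD[OF Suc.prems] assms(2) in \<open>auto intro!: bounded_linear.has_derivative[OF assms(2)]\<close>)
qed

lemma Ck_on_add:
  assumes "open S" "Ck_on k f S" "Ck_on k h S"
  shows "Ck_on k (\<lambda>x. f x + h x) S"
  using assms(2,3)
proof (induction k arbitrary: f h)
  case 0
  then show ?case by (auto intro: continuous_intros)
next
  case (Suc k)
  show ?case
    by (rule Ck_on_SucI[OF \<open>open S\<close>, where f' = "\<lambda>x v. frechet_derivative f (at x) v + frechet_derivative h (at x) v"])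
       (use Suc Ck_on_SucD[OF Suc.prems(1)] Ck_on_SucD[OF Suc.prems(2)] in
        \<open>auto intro!: has_derivative_add Suc.IH\<close>)
qed

lemma Ck_on_sum:
  assumes "open S" "finite I" "\<And>i. i \<in> I \<Longrightarrow> Ck_on k (f i) S"
  shows "Ck_on k (\<lambda>x. \<Sum>i\<in>I. f i x) S"
  using assms(2,3) by (induction I) (auto intro: Ck_on_add[OF \<open>open S\<close>] Ck_on_const[OF \<open>open S\<close>])

text \<open>The product rule gives two products, each of one original factor and one derivative; the
  original factor is lowered by one order, so the induction has to run over both factors at
  once.\<close>

lemma Ck_on_bilinear:
  assumes "open S" "bounded_bilinear p" "Ck_on k f S" "Ck_on k h S"
  shows "Ck_on k (\<lambda>x. p (f x) (h x)) S"
  using assms(3,4)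
proof (induction k arbitrary: f h)
  case 0
  then show ?case using assms(2) by (auto intro: bounded_bilinear.continuous_on)
next
  case (Suc k)
  show ?case
    by (rule Ck_on_SucI[OF \<open>open S\<close>, where f' = "\<lambda>x v. p (f x) (frechet_derivative h (at x) v)
            + p (frechet_derivative f (at x) v) (h x)"])
       (use Suc Ck_on_SucD[OF Suc.prems(1)] Ck_on_SucD[OF Suc.prems(2)]
          Ck_on_lower[OF Suc.prems(1)] Ck_on_lower[OF Suc.prems(2)] in
        \<open>auto intro!: bounded_bilinear.FDERIV[OF assms(2)] Ck_on_add[OF \<open>open S\<close>] Suc.IH\<close>)
qed

lemmas Ck_on_mult = Ck_on_bilinear[OF _ bounded_bilinear_mult]
  and Ck_on_scaleR = Ck_on_bilinear[OF _ bounded_bilinear_scaleR]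

text \<open>In the chain rule \<open>Df (y x) (Dy x v)\<close> the direction fed into
  \<open>Df\<close> varies with \<open>x\<close>, whereas \<open>Ck_on\<close> controls derivatives
  in constant directions. Expanding the direction in the basis separates the two dependences into a
  sum of products, to which the induction hypothesis applies.\<close>

lemma Ck_on_compose:
  fixes y :: "'u::euclidean_space \<Rightarrow> 'v::euclidean_space"
  assumes "open S" "open U" "y ` S \<subseteq> U" "Ck_on k f U" "Ck_on k y S"
  shows "Ck_on k (\<lambda>x. f (y x)) S"
  using assms(4,5)
proof (induction k arbitrary: f)
  case 0
  then show ?case using assms(3) by (auto intro: continuous_on_compose2)
next
  case (Suc k)
  let ?Df = "\<lambda>x. frechet_derivative f (at x)" and ?Dy = "\<lambda>x. frechet_derivative y (at x)"
  have *: "?Df (y x) w = (\<Sum>b\<in>Basis. (w \<bullet> b) *\<^sub>R ?Df (y x) b)" if "x \<in> S" for x w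
  proof -
    have "linear (?Df (y x))"
      using Suc.prems(1) that assms(3) by (intro linear_frechet_derivative) auto
    then have "?Df (y x) (\<Sum>b\<in>Basis. (w \<bullet> b) *\<^sub>R b) = (\<Sum>b\<in>Basis. (w \<bullet> b) *\<^sub>R ?Df (y x) b)"
      by (simp only: linear_sum linear_scale)
    then show ?thesis by (simp only: euclidean_representation)
  qed
  show ?case
  proof (rule Ck_on_SucI[OF \<open>open S\<close>, where f' = "\<lambda>x v. ?Df (y x) (?Dy x v)"])
    show "((\<lambda>x. f (y x)) has_derivative (\<lambda>v. ?Df (y x) (?Dy x v))) (at x)" if "x \<in> S" for x
    proof -
      have "y x \<in> U" using that assms(3) by blast
      from has_derivative_compose[OF Ck_on_SucD(1)[OF Suc.prems(2) that] Ck_on_SucD(1)[OF Suc.prems(1) this]]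
      show ?thesis .
    qed
    fix v
    have "Ck_on k (\<lambda>x. \<Sum>b\<in>Basis. (?Dy x v \<bullet> b) *\<^sub>R ?Df (y x) b) S"
    proof (intro Ck_on_sum Ck_on_scaleR \<open>open S\<close> finite_Basis)
      fix b :: 'v
      show "Ck_on k (\<lambda>x. ?Dy x v \<bullet> b) S"
        by (rule Ck_on_bounded_linear_compose[OF \<open>open S\<close> bounded_linear_inner_left Ck_on_SucD(2)[OF Suc.prems(2)]])
      show "Ck_on k (\<lambda>x. ?Df (y x) b) S"
        by (rule Suc.IH[OF Ck_on_SucD(2)[OF Suc.prems(1)] Ck_on_lower[OF Suc.prems(2)]])
    qed
    then show "Ck_on k (\<lambda>x. ?Df (y x) (?Dy x v)) S"
      using Ck_on_cong[OF \<open>open S\<close>, of "\<lambda>x. ?Df (y x) (?Dy x v)"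
          "\<lambda>x. \<Sum>b\<in>Basis. (?Dy x v \<bullet> b) *\<^sub>R ?Df (y x) b" k] *[of _ "?Dy _ v"] by blast
  qed
qed

lemma Ck_on_local:
  assumes "\<And>x. x \<in> S \<Longrightarrow> \<exists>U. open U \<and> x \<in> U \<and> Ck_on k f U"
  shows "Ck_on k f S"
  using assms
proof (induction k arbitrary: f)
  case 0
  have "isCont f x" if "x \<in> S" for x
    using 0[OF that] by (auto simp: continuous_on_eq_continuous_at)
  then show ?case by (simp add: continuous_at_imp_continuous_on)
next
  case (Suc k)
  have "f differentiable (at x)" if "x \<in> S" for x
    using Suc.prems[OF that] by auto
  moreover have "Ck_on k (\<lambda>x. frechet_derivative f (at x) v) S" for v
  proof (rule Suc.IH)
    fix x assume "x \<in> S"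
    from Suc.prems[OF this] show "\<exists>U. open U \<and> x \<in> U \<and> Ck_on k (\<lambda>x. frechet_derivative f (at x) v) U"
      by auto
  qed
  ultimately show ?case by simp
qed

text \<open>Only the reciprocal needs an induction. Its derivative is a product of two reciprocals
  and \<open>Dh\<close>, so the reciprocal at order \<open>k\<close> yields the one at order
  \<open>k + 1\<close>.\<close>

lemma Ck_on_divide:
  fixes f h :: "'v::euclidean_space \<Rightarrow> real"
  assumes "open S" "\<And>x. x \<in> S \<Longrightarrow> h x \<noteq> 0" "Ck_on k f S" "Ck_on k h S"
  shows "Ck_on k (\<lambda>x. f x / h x) S"
proof -
  have "Ck_on k (\<lambda>x. inverse (h x)) S"
    using assms(4)
  proof (induction k)
    case 0
    then show ?case using assms(2) by (auto intro: continuous_intros)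
  next
    case (Suc k)
    have c: "Ck_on k (\<lambda>x. inverse (h x)) S" using Suc.IH Ck_on_lower[OF Suc.prems] by blast
    let ?D = "\<lambda>x. frechet_derivative h (at x)"
    show ?case
    proof (rule Ck_on_SucI[OF \<open>open S\<close>])
      show "((\<lambda>x. inverse (h x)) has_derivative (\<lambda>v. (-1) * (inverse (h x) * ?D x v * inverse (h x)))) (at x)"
        if "x \<in> S" for x
        using Deriv.has_derivative_inverse[OF assms(2)[OF that] Ck_on_SucD(1)[OF Suc.prems that]] by simp
      show "Ck_on k (\<lambda>x. (-1) * (inverse (h x) * ?D x v * inverse (h x))) S" for v
        by (rule Ck_on_mult[OF \<open>open S\<close> Ck_on_const[OF \<open>open S\<close>]
              Ck_on_mult[OF \<open>open S\<close> Ck_on_mult[OF \<open>open S\<close> c Ck_on_SucD(2)[OF Suc.prems]] c]])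
    qed
  qed
  from Ck_on_mult[OF \<open>open S\<close> assms(3) this] show ?thesis by (simp add: divide_inverse)
qed

lemma smooth_onD: "smooth_on f S \<Longrightarrow> Ck_on k f S"
  by (simp add: smooth_on_def)

lemma smooth_on_differentiable: "smooth_on f S \<Longrightarrow> x \<in> S \<Longrightarrow> f differentiable (at x)"
  using Ck_on.simps(2) by (metis smooth_on_def)

lemma smooth_on_has_derivative:
  "smooth_on f S \<Longrightarrow> x \<in> S \<Longrightarrow> (f has_derivative frechet_derivative f (at x)) (at x)"
  using smooth_on_differentiable frechet_derivative_works by blast

lemma smooth_on_continuous: "smooth_on f S \<Longrightarrow> continuous_on S f"
  using Ck_on_continuous smooth_onD by blast

section \<open>Integration\<close>

text \<open>
  The change of variables theorem of the library needs a well-ordered index type; \<open>'n wrap\<close> is a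
  copy of \<open>'n\<close> carrying an arbitrary well-order.
\<close>

datatype 'n wrap = Wrap (unwrap: 'n)

lemma unwrap_bij: "bij unwrap"
  by (metis bijI' wrap.exhaust wrap.sel wrap.expand)

instance wrap :: (finite) finite
proof
  show "finite (UNIV :: 'a wrap set)"
    using bij_betw_finite[OF unwrap_bij] finite by metis
qed

instantiation wrap :: (finite) wellorder
begin

definition less_eq_wrap :: "'a wrap \<Rightarrow> 'a wrap \<Rightarrow> bool" where
  "less_eq_wrap a b \<longleftrightarrow> to_nat (unwrap a) \<le> to_nat (unwrap b)"

definition less_wrap :: "'a wrap \<Rightarrow> 'a wrap \<Rightarrow> bool" where
  "less_wrap a b \<longleftrightarrow> to_nat (unwrap a) < to_nat (unwrap b)"

instance
proof
  fix P :: "'a wrap \<Rightarrow> bool" and a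
  assume step: "\<And>x. (\<And>y. y < x \<Longrightarrow> P y) \<Longrightarrow> P x"
  show "P a"
    by (induction a rule: measure_induct_rule[where f = "\<lambda>a. to_nat (unwrap a)"])
       (auto intro: step simp: less_wrap_def)
qed (auto simp: less_eq_wrap_def less_wrap_def wrap.expand)

end

definition rewrap :: "real^'n \<Rightarrow> real^'n wrap" where
  "rewrap x = (\<chi> i. x $ unwrap i)"

definition unrewrap :: "real^'n wrap \<Rightarrow> real^'n" where
  "unrewrap x = (\<chi> i. x $ Wrap i)"

lemma rewrap_inverse [simp]: "unrewrap (rewrap x) = x" "rewrap (unrewrap y) = y"
  by (simp_all add: rewrap_def unrewrap_def vec_eq_iff)

lemma bounded_linear_rewrap: "bounded_linear (rewrap :: real^'n::finite \<Rightarrow> _)"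
  and bounded_linear_unrewrap: "bounded_linear (unrewrap :: _ \<Rightarrow> real^'n::finite)"
  by (auto intro!: linear_linear[THEN iffD2] linearI simp: rewrap_def unrewrap_def vec_eq_iff)

text \<open>Relabelling coordinates carries boxes to boxes with the same side lengths, and Lebesgue
  measure is determined by its values on boxes.\<close>

lemma lborel_unrewrap: "distr lborel borel (unrewrap :: _ \<Rightarrow> real^'n::finite) = lborel"
proof (rule lborel_eqI[symmetric])
  have m: "(unrewrap :: _ \<Rightarrow> real^'n) \<in> borel_measurable borel"
    using bounded_linear_unrewrap
    by (intro borel_measurable_continuous_onI linear_continuous_on)
  have prodB: "(\<Prod>b\<in>Basis. x \<bullet> b) = (\<Prod>i\<in>UNIV. x $ i)" for x :: "real^'m::finite"
  proof -
    have "inj (\<lambda>i::'m. axis i (1::real))" by (simp add: inj_def axis_eq_axis)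
    then have "(\<Prod>i\<in>UNIV. x $ i) = (\<Prod>b\<in>(\<lambda>i::'m. axis i (1::real)) ` UNIV. x \<bullet> b)"
      by (subst prod.reindex) (auto simp: inner_axis)
    moreover have "(\<lambda>i::'m. axis i (1::real)) ` UNIV = Basis" by (auto simp: Basis_vec_def)
    ultimately show ?thesis by simp
  qed
  fix l u :: "real^'n"
  assume le: "\<And>b. b \<in> Basis \<Longrightarrow> l \<bullet> b \<le> u \<bullet> b"
  have le': "l $ i \<le> u $ i" for i
    using le[of "axis i 1"] by (auto simp: inner_axis)
  have "unrewrap -` box l u = box (rewrap l) (rewrap u)"
    by (auto simp: mem_box_cart rewrap_def unrewrap_def) (metis wrap.collapse wrap.sel)+
  then have "emeasure (distr lborel borel unrewrap) (box l u) = emeasure lborel (box (rewrap l) (rewrap u))"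
    using m by (subst emeasure_distr) auto
  also have "\<dots> = (\<Prod>b\<in>Basis. (rewrap u - rewrap l) \<bullet> b)"
  proof (rule emeasure_lborel_box)
    fix b :: "real^'n wrap" assume "b \<in> Basis"
    then obtain i where "b = axis i 1" by (auto simp: Basis_vec_def)
    then show "rewrap l \<bullet> b \<le> rewrap u \<bullet> b" using le' by (simp add: inner_axis rewrap_def)
  qed
  also have "(\<Prod>b\<in>Basis. (rewrap u - rewrap l) \<bullet> b) = (\<Prod>i\<in>UNIV. (u - l) $ unwrap i)"
    unfolding prodB by (simp add: rewrap_def)
  also have "\<dots> = (\<Prod>i\<in>UNIV. (u - l) $ i)"
    by (rule prod.reindex_bij_betw[OF unwrap_bij])
  also have "\<dots> = (\<Prod>b\<in>Basis. (u - l) \<bullet> b)" by (simp only: prodB)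
  finally show "emeasure (distr lborel borel unrewrap) (box l u) = (\<Prod>b\<in>Basis. (u - l) \<bullet> b)" .
qed simp

text \<open>Conjugation by the relabelling is a bijection between the permutations of the two index
  types; it preserves signs and only reorders the factors of each Leibniz term.\<close>

lemma det_rewrap:
  fixes M :: "real^'n::finite^'n"
  shows "det (\<chi> i j. M $ unwrap i $ unwrap j) = det M"
proof -
  let ?f = "\<lambda>p. unwrap \<circ> p \<circ> (Wrap :: 'n \<Rightarrow> _)"
  have bw: "bij (Wrap :: 'n \<Rightarrow> _)" by (metis bijI' wrap.sel wrap.collapse)
  have "bij_betw ?f {p. p permutes UNIV} {p. p permutes (UNIV :: 'n set)}"
  proof (rule bij_betw_byWitness[where f' = "\<lambda>p. Wrap \<circ> p \<circ> unwrap"])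
    have *: "p permutes UNIV \<longleftrightarrow> bij p" for p :: "'k \<Rightarrow> 'k"
      by (metis bij_imp_permutes permutes_bij UNIV_I)
    show "?f ` {p. p permutes UNIV} \<subseteq> {p. p permutes UNIV}"
      unfolding * by (auto intro!: bij_comp bw unwrap_bij)
    show "(\<lambda>p. Wrap \<circ> p \<circ> unwrap) ` {p. p permutes (UNIV :: 'n set)} \<subseteq> {p. p permutes UNIV}"
      unfolding * by (auto intro!: bij_comp bw unwrap_bij)
  qed (auto simp: fun_eq_iff)
  moreover have "of_int (sign (?f p)) * (\<Prod>i\<in>UNIV. M $ i $ (?f p) i)
     = of_int (sign p) * (\<Prod>i\<in>UNIV. (\<chi> i j. M $ unwrap i $ unwrap j) $ i $ p i)"
    if "p permutes UNIV" for p
  proof -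
    have "inv unwrap = (Wrap :: 'n \<Rightarrow> _)"
      using bij_is_inj[OF unwrap_bij] by (metis inv_f_eq wrap.sel ext)
    then have "?f p = map_permutation UNIV unwrap p"
      by (simp add: map_permutation_def restrict_id_def fun_eq_iff bij_is_surj[OF unwrap_bij])
    then have "sign (?f p) = sign p"
      using sign_map_permutation[of unwrap UNIV p] that bij_is_inj[OF unwrap_bij] by simp
    moreover have "(\<Prod>i\<in>UNIV. M $ i $ (?f p) i) = (\<Prod>i\<in>UNIV. M $ unwrap i $ (?f p) (unwrap i))"
      by (rule prod.reindex_bij_betw[OF unwrap_bij, symmetric])
    ultimately show ?thesis by simp
  qed
  ultimately show ?thesis unfolding det_def
    by (subst sum.reindex_bij_betw[symmetric, where h = ?f]) auto
qed

section \<open>Change of variables and integrals of compactly supported functions\<close>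

text \<open>Continuity on an open set makes the integrand Borel measurable, so passing to the
  completed measure changes nothing. This links integrals over \<open>lborel\<close> with absolute
  integrability in the gauge sense.\<close>

lemma set_integrable_continuous_lborel_iff:
  fixes f :: "'a::euclidean_space \<Rightarrow> real"
  assumes "open S" "continuous_on S f"
  shows "set_integrable lborel S f \<longleftrightarrow> f absolutely_integrable_on S"
proof -
  have "(\<lambda>x. indicator S x *\<^sub>R f x) \<in> borel_measurable borel"
    using assms by (intro borel_measurable_continuous_on_indicator) auto
  then show ?thesis
    unfolding set_integrable_def by (subst integrable_completion) auto
qed

text \<open>The map \<open>h\<close> is conjugated by the relabelling of coordinates, which
  preserves both the measure and the Jacobian determinant. The continuity assumptions serve to move
  between Borel and Lebesgue integrability on the two sides.\<close>

lemma lborel_change_of_variables: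
  fixes f :: "real^'n::finite \<Rightarrow> real" and h :: "real^'n \<Rightarrow> real^'n"
  assumes "open S" "open (h ` S)" "inj_on h S"
    and h': "\<And>x. x \<in> S \<Longrightarrow> (h has_derivative h' x) (at x)"
    and contJ: "continuous_on S (\<lambda>x. det (matrix (h' x)))"
    and f: "continuous_on (h ` S) f" "set_integrable lborel (h ` S) f"
  shows "(LINT x:S|lborel. \<bar>det (matrix (h' x))\<bar> * f (h x)) = (LINT y:h ` S|lborel. f y)"
proof -
  let ?S = "unrewrap -` S" and ?h = "\<lambda>x. rewrap (h (unrewrap x))"
  let ?h' = "\<lambda>x v. rewrap (h' (unrewrap x) (unrewrap v))"
  let ?f = "\<lambda>x. f (unrewrap x)"
  let ?J = "\<lambda>x. \<bar>det (matrix (h' x))\<bar> * f (h x)"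
  have meas: "(unrewrap :: _ \<Rightarrow> real^'n) \<in> borel_measurable borel"
    and cont: "continuous_on A (unrewrap :: _ \<Rightarrow> real^'n)" for A
    using linear_continuous_on[OF bounded_linear_unrewrap] borel_measurable_continuous_onI by auto
  have opn: "open (unrewrap -` A)" if "open A" for A :: "(real^'n) set"
    using open_vimage[OF that cont] .
  have img: "?h ` ?S = unrewrap -` (h ` S)"
  proof (intro set_eqI iffI)
    fix x assume "x \<in> unrewrap -` (h ` S)"
    then obtain y where "y \<in> S" "unrewrap x = h y" by auto
    then have "x = rewrap (h y)" by (metis rewrap_inverse(2))
    then have "x = ?h (rewrap y)" "rewrap y \<in> ?S" using \<open>y \<in> S\<close> by simp_all
    then show "x \<in> ?h ` ?S" by blast
  qed auto
  have contJf: "continuous_on S ?J"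
  proof -
    have "continuous_on S h"
      by (rule has_derivative_continuous_on[OF has_derivative_at_withinI[OF h']])
    from continuous_on_mult[OF continuous_on_rabs[OF contJ] continuous_on_compose2[OF f(1) this]]
    show ?thesis by simp
  qed
  have transfer: "integrable lborel (\<lambda>x. indicator A x *\<^sub>R \<phi> x) \<longleftrightarrow>
      integrable lborel (\<lambda>x. indicator (unrewrap -` A) x *\<^sub>R \<phi> (unrewrap x))"
    "(LINT x:A|lborel. \<phi> x) = (LINT x:unrewrap -` A|lborel. \<phi> (unrewrap x))"
    if "open A" "continuous_on A \<phi>" for A and \<phi> :: "real^'n \<Rightarrow> real"
  proof -
    have m: "(\<lambda>x. indicator A x *\<^sub>R \<phi> x) \<in> borel_measurable borel"
      using that by (intro borel_measurable_continuous_on_indicator) auto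
    have i: "indicator A (unrewrap x) = (indicator (unrewrap -` A) x :: real)" for x
      by (simp add: indicator_def)
    show "integrable lborel (\<lambda>x. indicator A x *\<^sub>R \<phi> x) \<longleftrightarrow>
      integrable lborel (\<lambda>x. indicator (unrewrap -` A) x *\<^sub>R \<phi> (unrewrap x))"
      using integrable_distr_eq[of unrewrap lborel borel "\<lambda>x. indicator A x *\<^sub>R \<phi> x"] m meas
      by (simp add: lborel_unrewrap i)
    show "(LINT x:A|lborel. \<phi> x) = (LINT x:unrewrap -` A|lborel. \<phi> (unrewrap x))"
      using integral_distr[of unrewrap lborel borel "\<lambda>x. indicator A x *\<^sub>R \<phi> x"] m meas
      by (simp add: lborel_unrewrap i set_lebesgue_integral_def)
  qed
  have d: "(?h has_derivative ?h' x) (at x within ?S)" if "x \<in> ?S" for x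
  proof -
    have "(h has_derivative h' (unrewrap x)) (at (unrewrap x))" using h' that by simp
    note has_derivative_compose[OF bounded_linear_imp_has_derivative[OF bounded_linear_unrewrap] this]
    from has_derivative_at_withinI[OF bounded_linear.has_derivative[OF bounded_linear_rewrap this]]
    show ?thesis .
  qed
  have det: "det (matrix (?h' x)) = det (matrix (h' (unrewrap x)))" for x
  proof -
    have "unrewrap (axis j 1) = axis (unwrap j) (1::real)" for j :: "'n wrap"
      by (simp add: unrewrap_def axis_def vec_eq_iff) (metis wrap.collapse wrap.sel)
    then have "matrix (?h' x) = (\<chi> i j. matrix (h' (unrewrap x)) $ unwrap i $ unwrap j)"
      by (simp add: matrix_def rewrap_def)
    then show ?thesis by (simp add: det_rewrap)
  qed
  have fint: "?f absolutely_integrable_on ?h ` ?S"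
  proof -
    have "set_integrable lborel (unrewrap -` (h ` S)) ?f"
      using f transfer(1)[OF assms(2) f(1)] by (simp add: set_integrable_def)
    then show ?thesis unfolding img
      by (subst (asm) set_integrable_continuous_lborel_iff)
         (auto intro!: opn assms continuous_on_compose2[OF f(1)] cont)
  qed
  have key: "?f absolutely_integrable_on (?h ` ?S) \<and> integral (?h ` ?S) ?f = b \<longleftrightarrow>
      (\<lambda>x. \<bar>det (matrix (?h' x))\<bar> * ?f (?h x)) absolutely_integrable_on ?S \<and>
      integral ?S (\<lambda>x. \<bar>det (matrix (?h' x))\<bar> * ?f (?h x)) = b" for b
  proof -
    \<comment> \<open>The change of variables theorem speaks of vector-valued integrands, hence the
      detour through \<open>real^1\<close>.\<close>
    have "(\<lambda>x. \<bar>det (matrix (?h' x))\<bar> *\<^sub>R vec (?f (?h x)) :: real^1) absolutely_integrable_on ?S \<and>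
      integral ?S (\<lambda>x. \<bar>det (matrix (?h' x))\<bar> *\<^sub>R vec (?f (?h x))) = (vec b :: real^1) \<longleftrightarrow>
      (\<lambda>x. vec (?f x) :: real^1) absolutely_integrable_on (?h ` ?S) \<and>
      integral (?h ` ?S) (\<lambda>x. vec (?f x)) = (vec b :: real^1)"
    proof (rule has_absolute_integral_change_of_variables)
      show "?S \<in> sets lebesgue" using borel_open[OF opn[OF assms(1)]] by simp
      show "inj_on ?h ?S"
        using assms(3) by (auto simp: inj_on_def) (metis rewrap_inverse)
    qed (use d in auto)
    then show ?thesis
      by (simp add: absolutely_integrable_on_1_iff integral_on_1_eq)
  qed
  have Jint: "(\<lambda>x. \<bar>det (matrix (h' (unrewrap x)))\<bar> * f (h (unrewrap x))) absolutely_integrable_on ?S"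
    "integral ?S (\<lambda>x. \<bar>det (matrix (h' (unrewrap x)))\<bar> * f (h (unrewrap x))) = integral (?h ` ?S) ?f"
    using key[of "integral (?h ` ?S) ?f"] fint by (simp_all add: det)
  have 1: "set_integrable lborel ?S (\<lambda>x. ?J (unrewrap x))"
    using Jint(1) contJf
    by (subst set_integrable_continuous_lborel_iff)
       (auto intro!: opn assms continuous_on_compose2[OF contJf] cont)
  have 2: "set_integrable lborel (unrewrap -` (h ` S)) ?f"
    using f transfer(1)[OF assms(2) f(1)] by (simp add: set_integrable_def)
  show ?thesis
    using transfer(2)[OF assms(1) contJf] transfer(2)[OF assms(2) f(1)] Jint(2)
      set_borel_integral_eq_integral(2)[OF 1] set_borel_integral_eq_integral(2)[OF 2]
    by (simp add: img)
qed

lemma integrable_compact_support: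
  fixes F :: "'a::euclidean_space \<Rightarrow> real"
  assumes "compact K" "\<And>x. x \<notin> K \<Longrightarrow> F x = 0" "continuous_on K F"
  shows "integrable lborel F"
proof -
  have "integrable lborel (\<lambda>x. indicator K x *\<^sub>R F x)"
    by (rule borel_integrable_compact[OF assms(1,3)])
  moreover have "(\<lambda>x. indicator K x *\<^sub>R F x) = F"
    using assms(2) by (auto simp: fun_eq_iff indicator_def)
  ultimately show ?thesis by simp
qed

text \<open>The integral of the difference quotients vanishes by translation invariance.\<close>

lemma integral_directional_derivative_eq_0:
  fixes F :: "'a::euclidean_space \<Rightarrow> real"
  assumes K: "compact K" "\<And>x. x \<notin> K \<Longrightarrow> F x = 0"
    and F': "\<And>x. (F has_derivative F' x) (at x)"
    and cont: "continuous_on UNIV (\<lambda>x. F' x v)"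
  shows "integrable lborel (\<lambda>x. F' x v)" "(\<integral>x. F' x v \<partial>lborel) = 0"
proof -
  have F'0: "F' x v = 0" if "x \<notin> K" for x
  proof -
    have "((\<lambda>_. 0) has_derivative F' x) (at x)"
      by (rule has_derivative_transform_within_open[OF F', of "- K"])
         (use that K compact_imp_closed in auto)
    then have "F' x = (\<lambda>_. 0)"
      using has_derivative_const has_derivative_unique by blast
    then show ?thesis by simp
  qed
  show "integrable lborel (\<lambda>x. F' x v)"
    by (rule integrable_compact_support[OF K(1) F'0 continuous_on_subset[OF cont]]) auto
  have contF: "continuous_on A F" for A
    by (rule has_derivative_continuous_on[OF has_derivative_at_withinI[OF F']])
  have intF: "integrable lborel F"
    by (rule integrable_compact_support[OF K contF])
  obtain B where B: "\<And>x. \<bar>F' x v\<bar> \<le> B" "B \<ge> 0"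
  proof -
    have "compact ((\<lambda>x. F' x v) ` K)"
      by (intro compact_continuous_image continuous_on_subset[OF cont] K) auto
    then obtain B where "\<forall>y\<in>(\<lambda>x. F' x v) ` K. \<bar>y\<bar> \<le> B"
      by (auto dest!: compact_imp_bounded simp: bounded_real)
    then have "\<bar>F' x v\<bar> \<le> max B 0" for x using F'0[of x] by (cases "x \<in> K") auto
    then show ?thesis using that by (metis max.cobounded2)
  qed
  obtain R where R: "\<And>x. x \<in> K \<Longrightarrow> norm x \<le> R" "R \<ge> 0"
  proof -
    obtain R where "\<forall>x\<in>K. norm x \<le> R"
      using compact_imp_bounded[OF K(1)] by (auto simp: bounded_iff)
    then have "norm x \<le> max R 0" if "x \<in> K" for x using that by fastforce
    then show ?thesis using that by (metis max.cobounded2)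
  qed
  let ?t = "\<lambda>k::nat. 1 / real (Suc k)"
  let ?q = "\<lambda>k x. (F (x + ?t k *\<^sub>R v) - F x) / ?t k"
  \<comment> \<open>The steps \<open>?t k\<close> are at most 1, so all difference quotients vanish
    outside this ball; together with the mean value bound \<open>B\<close> it provides the
    dominating function.\<close>
  let ?C = "cball 0 (R + norm v) :: 'a set"
  have mv: "\<bar>F (x + t *\<^sub>R v) - F x\<bar> \<le> t * B" if "t > 0" for x t
  proof -
    have "((\<lambda>s. F (x + s *\<^sub>R v)) has_real_derivative F' (x + s *\<^sub>R v) v) (at s)" for s
    proof -
      have "((\<lambda>s. x + s *\<^sub>R v) has_derivative (\<lambda>s. s *\<^sub>R v)) (at s)"
        by (auto intro!: derivative_eq_intros)
      from has_derivative_compose[OF this F'] show ?thesis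
        using linear_scale[OF has_derivative_linear[OF F']]
        by (simp add: has_field_derivative_def mult_commute_abs)
    qed
    with MVT2[OF that, of "\<lambda>s. F (x + s *\<^sub>R v)" "\<lambda>s. F' (x + s *\<^sub>R v) v"]
    obtain z where "F (x + t *\<^sub>R v) - F x = t * F' (x + z *\<^sub>R v) v" by auto
    then show ?thesis using B that by (simp add: abs_mult)
  qed
  have "(\<lambda>k. \<integral>x. ?q k x \<partial>lborel) \<longlonglongrightarrow> (\<integral>x. F' x v \<partial>lborel)"
  proof (rule integral_dominated_convergence[where w = "\<lambda>x. B * indicator ?C x"])
    show "(\<lambda>x. F' x v) \<in> borel_measurable lborel"
      using borel_measurable_continuous_onI[OF cont] by simp
    show "?q k \<in> borel_measurable lborel" for k
    proof -
      have "continuous_on UNIV (?q k)"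
        by (intro continuous_intros continuous_on_compose2[OF contF[of UNIV]]) auto
      then show ?thesis using borel_measurable_continuous_onI by auto
    qed
    have "integrable lborel (\<lambda>x. indicator ?C x *\<^sub>R B)"
      by (rule borel_integrable_compact) auto
    then show "integrable lborel (\<lambda>x. B * indicator ?C x)" by (simp add: mult.commute)
    show "AE x in lborel. (\<lambda>k. ?q k x) \<longlonglongrightarrow> F' x v"
    proof (rule AE_I2)
      fix x
      have "((\<lambda>t. (F (x + t *\<^sub>R v) - F x) / t) \<longlongrightarrow> F' x v) (at 0)"
      proof -
        have "((\<lambda>t. x + t *\<^sub>R v) has_derivative (\<lambda>s. s *\<^sub>R v)) (at 0)"
          by (auto intro!: derivative_eq_intros)
        from has_derivative_compose[OF this F']
        have "((\<lambda>t. F (x + t *\<^sub>R v)) has_real_derivative F' x v) (at 0)"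
          using linear_scale[OF has_derivative_linear[OF F']]
          by (simp add: has_field_derivative_def mult_commute_abs)
        then show ?thesis by (simp add: has_field_derivative_iff)
      qed
      moreover have "filterlim ?t (at 0) sequentially"
        using LIMSEQ_inverse_real_of_nat
        by (auto simp: filterlim_at inverse_eq_divide)
      ultimately show "(\<lambda>k. ?q k x) \<longlonglongrightarrow> F' x v"
        by (rule filterlim_compose)
    qed
    show "AE x in lborel. norm (?q k x) \<le> B * indicator ?C x" for k
    proof (rule AE_I2)
      fix x
      show "norm (?q k x) \<le> B * indicator ?C x"
      proof (cases "x \<in> ?C")
        case True
        have "\<bar>?q k x\<bar> = \<bar>F (x + ?t k *\<^sub>R v) - F x\<bar> / ?t k" by (simp only: abs_divide)
        also have "\<dots> \<le> B" using mv[of "?t k" x] by (subst pos_divide_le_eq) (auto simp: mult.commute)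
        finally show ?thesis using True by simp
      next
        case False
        then have n: "norm x > R + norm v" by simp
        have "norm (?t k *\<^sub>R v) \<le> norm v"
          using mult_left_le_one_le[of "norm v" "?t k"] by (simp only: norm_scaleR) simp
        then have "norm (x + ?t k *\<^sub>R v) > R"
          using n norm_triangle_ineq4[of "x + ?t k *\<^sub>R v" "?t k *\<^sub>R v"] by simp
        then have "x + ?t k *\<^sub>R v \<notin> K" using R(1) linorder_not_le by blast
        moreover have "x \<notin> K" using R(1)[of x] n norm_ge_zero[of v] by linarith
        ultimately have "F (x + ?t k *\<^sub>R v) = 0" "F x = 0" using K(2) by blast+
        then show ?thesis using False by simp
      qed
    qed
  qed
  moreover have "(\<lambda>k. \<integral>x. ?q k x \<partial>lborel) = (\<lambda>k. 0)"
  proof (rule ext)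
    fix k
    show "(\<integral>x. ?q k x \<partial>lborel) = 0"
  proof -
    have m: "F \<in> borel_measurable borel" using borel_measurable_continuous_onI[OF contF] .
    have "integrable lborel (\<lambda>x. F (?t k *\<^sub>R v + x))"
      using integrable_distr_eq[of "(+) (?t k *\<^sub>R v)" lborel borel F] m intF
      by (simp add: lborel_distr_plus)
    moreover have "(\<integral>x. F (?t k *\<^sub>R v + x) \<partial>lborel) = (\<integral>x. F x \<partial>lborel)"
      using integral_distr[of "(+) (?t k *\<^sub>R v)" lborel borel F] m
      by (simp add: lborel_distr_plus)
    ultimately have "(\<integral>x. (F (x + ?t k *\<^sub>R v) - F x) \<partial>lborel) = 0"
      using intF by (subst Bochner_Integration.integral_diff) (simp_all only: add.commute diff_self)
    then show ?thesis by (simp only: integral_divide_zero div_0)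
  qed
  qed
  ultimately have "(\<lambda>k::nat. 0) \<longlonglongrightarrow> (\<integral>x. F' x v \<partial>lborel)" by (simp only:)
  from LIMSEQ_unique[OF this tendsto_const] show "(\<integral>x. F' x v \<partial>lborel) = 0" .
qed

section \<open>The derivative of the determinant\<close>

lemma matrix_inv_inverse:
  fixes A :: "real^'n::finite^'n"
  assumes "det A \<noteq> 0"
  shows "A ** matrix_inv A = mat 1" "matrix_inv A ** A = mat 1"
proof -
  have "\<exists>A'. A ** A' = mat 1 \<and> A' ** A = mat 1"
    using assms invertible_det_nz[of A] by (simp add: invertible_def)
  from someI_ex[OF this] show "A ** matrix_inv A = mat 1" "matrix_inv A ** A = mat 1"
    by (simp_all add: matrix_inv_def)
qed

lemma bounded_linear_matrix_component: "bounded_linear (\<lambda>A::real^'n::finite^'m::finite. A $ i $ j)"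
  using bounded_linear_compose[OF bounded_linear_vec_nth bounded_linear_vec_nth] .

text \<open>A permutation other than the identity moves at least two indices. Differentiating one
  factor of its Leibniz term leaves an off-diagonal entry of the identity matrix among the others,
  so only the identity permutation contributes, and it contributes the trace.\<close>

lemma has_derivative_det_1:
  "(det has_derivative trace) (at (mat 1 :: real^'n::finite^'n))"
proof -
  let ?I = "mat 1 :: real^'n^'n"
  let ?D = "\<lambda>p H. of_int (sign p) * (\<Sum>i\<in>UNIV. H $ i $ p i * (\<Prod>j\<in>UNIV - {i}. ?I $ j $ p j))"
  have d: "((\<lambda>A. of_int (sign p) * (\<Prod>i\<in>UNIV. A $ i $ p i)) has_derivative ?D p) (at ?I)" for p :: "'n \<Rightarrow> 'n"
  proof (intro has_derivative_mult_right has_derivative_prod)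
    show "((\<lambda>A. A $ i $ p i) has_derivative (\<lambda>H. H $ i $ p i)) (at ?I)" for i
      by (rule bounded_linear_imp_has_derivative[OF bounded_linear_matrix_component])
  qed
  have D0: "?D p H = 0" if p: "p permutes UNIV" and ne: "p \<noteq> id" for p H
  proof -
    have "(\<Prod>j\<in>UNIV - {i}. ?I $ j $ p j) = 0" for i
    proof -
      obtain a where a: "p a \<noteq> a" using ne by (auto simp: fun_eq_iff)
      then have "p (p a) \<noteq> p a" using permutes_inj[OF p] by (simp add: inj_eq)
      with a obtain j where "j \<noteq> i" "p j \<noteq> j" by metis
      then show ?thesis by (intro prod_zero) (auto simp: mat_def intro!: bexI[of _ j])
    qed
    then show ?thesis by (simp only: mult_zero_right sum.neutral_const)
  qed
  have D1: "?D id H = trace H" for H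
    by (simp add: mat_def trace_def)
  have "(det has_derivative (\<lambda>H. \<Sum>p | p permutes UNIV. ?D p H)) (at ?I)"
    unfolding det_def[abs_def] by (intro has_derivative_sum d)
  moreover have "(\<lambda>H. \<Sum>p | p permutes UNIV. ?D p H) = trace"
  proof (rule ext)
    fix H
    have "(\<Sum>p | p permutes UNIV. ?D p H) = (\<Sum>p\<in>{id}. ?D p H)"
    proof (rule sum.mono_neutral_right)
      show "finite {p. p permutes (UNIV :: 'n set)}" by (rule finite_permutations) simp
      show "\<forall>p\<in>{p. p permutes UNIV} - {id}. ?D p H = 0" using D0 by blast
    qed (simp add: permutes_id)
    then show "(\<Sum>p | p permutes UNIV. ?D p H) = trace H" by (simp only: D1 sum.insert sum.empty finite.emptyI empty_iff not_False_eq_True add_0_right)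
  qed
  ultimately show ?thesis by (simp only:)
qed

text \<open>Jacobi's formula. Multiplicativity reduces it to the identity matrix:
  \<open>det (G y)\<close> equals \<open>det (G x)\<close> times the determinant of
  \<open>matrix_inv (G x) ** G y\<close>, whose argument is the identity at
  \<open>y = x\<close>.\<close>

lemma has_derivative_det:
  fixes G :: "'a::real_normed_vector \<Rightarrow> real^'n::finite^'n"
  assumes G': "(G has_derivative G') (at x)" and "det (G x) \<noteq> 0"
  shows "((\<lambda>y. det (G y)) has_derivative (\<lambda>v. det (G x) * trace (matrix_inv (G x) ** G' v))) (at x)"
proof -
  let ?M = "matrix_inv (G x)"
  have bl: "bounded_linear (\<lambda>A. ?M ** A)"
    by (intro linear_linear[THEN iffD2] linearI)
      (simp_all add: matrix_matrix_mult_def vec_eq_iff sum.distrib algebra_simps sum_distrib_left)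
  have "det (G x) * (det ?M * det (G y)) = det (G y)" for y
    using matrix_inv_inverse(1)[OF assms(2)] det_mul[of "G x" ?M] by (simp flip: mult.assoc)
  then have eq: "(\<lambda>y. det (G y)) = (\<lambda>y. det (G x) * det (?M ** G y))"
    by (simp add: det_mul fun_eq_iff)
  have "(det has_derivative trace) (at (?M ** G x))"
    using has_derivative_det_1 matrix_inv_inverse(2)[OF assms(2)] by simp
  from has_derivative_compose[OF bounded_linear.has_derivative[OF bl G'] this]
  show ?thesis unfolding eq by (rule has_derivative_mult_right)
qed

lemma Ck_on_prod:
  fixes f :: "'i \<Rightarrow> 'v::euclidean_space \<Rightarrow> real"
  assumes "open S" "finite I" "\<And>i. i \<in> I \<Longrightarrow> Ck_on k (f i) S"
  shows "Ck_on k (\<lambda>x. \<Prod>i\<in>I. f i x) S"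
  using assms(2,3) by (induction I) (auto intro: Ck_on_mult[OF \<open>open S\<close>] Ck_on_const[OF \<open>open S\<close>])

lemma Ck_on_matrix_component:
  assumes "open S" "Ck_on k (G :: 'v::euclidean_space \<Rightarrow> real^'n::finite^'m::finite) S"
  shows "Ck_on k (\<lambda>x. G x $ i $ j) S"
  using Ck_on_bounded_linear_compose[OF assms(1) bounded_linear_matrix_component assms(2)] .

lemma Ck_on_vec_component:
  assumes "open S" "Ck_on k (X :: 'v::euclidean_space \<Rightarrow> real^'n::finite) S"
  shows "Ck_on k (\<lambda>x. X x $ i) S"
  using Ck_on_bounded_linear_compose[OF assms(1) bounded_linear_vec_nth assms(2)] .

lemma Ck_on_det:
  fixes G :: "'v::euclidean_space \<Rightarrow> real^'n::finite^'n"
  assumes "open S" "Ck_on k G S"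
  shows "Ck_on k (\<lambda>x. det (G x)) S"
  unfolding det_def
proof (intro Ck_on_sum[OF assms(1)])
  show "Ck_on k (\<lambda>x. of_int (sign p) * (\<Prod>i\<in>UNIV. G x $ i $ p i)) S" for p
    by (rule Ck_on_mult[OF assms(1) Ck_on_const[OF assms(1)] Ck_on_prod[OF assms(1)]])
       (simp_all add: Ck_on_matrix_component[OF assms])
qed (simp add: finite_permutations)

lemma Ck_on_sqrt:
  fixes f :: "'v::euclidean_space \<Rightarrow> real"
  assumes "open S" "\<And>x. x \<in> S \<Longrightarrow> f x > 0" "Ck_on k f S"
  shows "Ck_on k (\<lambda>x. sqrt (f x)) S"
  using assms(3)
proof (induction k)
  case 0
  then show ?case by (auto intro: continuous_intros)
next
  case (Suc k)
  let ?D = "\<lambda>x. frechet_derivative f (at x)"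
  have c: "Ck_on k (\<lambda>x. sqrt (f x)) S" using Suc.IH Ck_on_lower[OF Suc.prems] by blast
  show ?case
  proof (rule Ck_on_SucI[OF \<open>open S\<close>])
    show "((\<lambda>x. sqrt (f x)) has_derivative (\<lambda>v. ?D x v / (2 * sqrt (f x)))) (at x)"
      if "x \<in> S" for x
      using has_derivative_real_sqrt[OF assms(2)[OF that] Ck_on_SucD(1)[OF Suc.prems that]]
      by (simp add: field_simps)
    have "2 * sqrt (f x) \<noteq> 0" if "x \<in> S" for x using assms(2)[OF that] by simp
    from Ck_on_divide[OF \<open>open S\<close> this Ck_on_SucD(2)[OF Suc.prems]
        Ck_on_mult[OF \<open>open S\<close> Ck_on_const[OF \<open>open S\<close>] c]]
    show "Ck_on k (\<lambda>x. ?D x v / (2 * sqrt (f x))) S" for v .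
  qed
qed

section \<open>Charts\<close>

context smooth_manifold
begin

definition overlap :: "('a, 'n) chart \<Rightarrow> ('a, 'n) chart \<Rightarrow> (real^'n) set" where
  "overlap c d = cmap c ` (cdom c \<inter> cdom d)"

lemma chart_at:
  assumes "p \<in> topspace T"
  obtains c where "c \<in> \<A>" "p \<in> cdom c"
  using assms by (auto simp flip: covering)

context
  fixes c assumes c: "c \<in> \<A>"
begin

lemma openin_cdom: "openin T (cdom c)" and open_cimg: "open (cimg c)"
  and homeo_cmap: "homeomorphic_map (subtopology T (cdom c)) (top_of_set (cimg c)) (cmap c)"
  using charts[OF c] by (auto simp: is_chart_def)

lemma cdom_subset: "cdom c \<subseteq> topspace T"
  using openin_cdom openin_subset by blast

lemma topspace_cdom: "topspace (subtopology T (cdom c)) = cdom c"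
  using cdom_subset by (simp add: Int_absorb1)

lemma inj_cmap: "inj_on (cmap c) (cdom c)"
  using homeomorphic_imp_injective_map[OF homeo_cmap] by (simp only: topspace_cdom)

lemma cinv_cmap [simp]: "p \<in> cdom c \<Longrightarrow> cinv c (cmap c p) = p"
  by (simp add: cinv_def inj_cmap)

lemma cmap_cinv [simp]: "x \<in> cimg c \<Longrightarrow> cmap c (cinv c x) = x"
  and cinv_cdom [simp]: "x \<in> cimg c \<Longrightarrow> cinv c x \<in> cdom c"
  and cmap_cimg [simp]: "p \<in> cdom c \<Longrightarrow> cmap c p \<in> cimg c"
  by (auto simp: cimg_def cinv_def f_inv_into_f inv_into_into)

lemma cinv_topspace: "x \<in> cimg c \<Longrightarrow> cinv c x \<in> topspace T"
  using cinv_cdom cdom_subset by blast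

lemma open_cmap_image:
  assumes "openin T U" "U \<subseteq> cdom c"
  shows "open (cmap c ` U)"
proof -
  have "openin (subtopology T (cdom c)) U"
    using assms by (metis openin_cdom openin_open_subtopology)
  then have "openin (top_of_set (cimg c)) (cmap c ` U)"
    using homeomorphic_map_openness[OF homeo_cmap] assms(2) topspace_cdom by auto
  then show ?thesis using open_cimg openin_open_eq by blast
qed

lemma openin_cinv_image:
  assumes "open V" "V \<subseteq> cimg c"
  shows "openin T (cinv c ` V)"
proof -
  have V: "cmap c ` (cinv c ` V) = V" using assms(2) by (force simp: image_image)
  have sub: "cinv c ` V \<subseteq> cdom c" using assms(2) by (metis cinv_cdom image_subsetI subsetD)
  have "openin (top_of_set (cimg c)) V" using assms open_cimg openin_open_eq by blast
  then have "openin (subtopology T (cdom c)) (cinv c ` V)"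
    using homeomorphic_map_openness[OF homeo_cmap, of "cinv c ` V", unfolded topspace_cdom V] sub
    by blast
  then show ?thesis using openin_cdom openin_open_subtopology by blast
qed

lemma continuous_map_cinv: "continuous_map (top_of_set (cimg c)) T (cinv c)"
proof -
  have "{x \<in> cimg c. cinv c x \<in> U} = cmap c ` (U \<inter> cdom c)" for U
    by force
  moreover have "open (cmap c ` (U \<inter> cdom c))" if "openin T U" for U
    by (rule open_cmap_image) (use that openin_cdom in auto)
  ultimately show ?thesis
    using open_cimg cinv_topspace
    by (auto simp: continuous_map_def openin_open_eq image_iff)
qed

lemma compactin_cinv_image:
  assumes "compact K" "K \<subseteq> cimg c"
  shows "compactin T (cinv c ` K)"
  using image_compactin[OF _ continuous_map_cinv, of K] assms
  by (simp add: compactin_subtopology)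

text \<open>The place where Hausdorffness enters the cutoff construction: the complement of the
  support is open, so extension by zero keeps regularity.\<close>

lemma closedin_cinv_image:
  assumes "compact K" "K \<subseteq> cimg c"
  shows "closedin T (cinv c ` K)"
  using compactin_imp_closedin[OF Hausdorff compactin_cinv_image[OF assms]] .

end

context
  fixes c d assumes c: "c \<in> \<A>" and d: "d \<in> \<A>"
begin

lemma mem_overlap: "x \<in> overlap c d \<longleftrightarrow> x \<in> cimg c \<and> cinv c x \<in> cdom d"
  using c by (force simp: overlap_def)

lemma open_overlap: "open (overlap c d)"
  unfolding overlap_def
  by (rule open_cmap_image[OF c]) (use openin_cdom[OF c] openin_cdom[OF d] in auto)

lemma transition_eq: "transition c d x = cmap d (cinv c x)"
  by (simp add: transition_def)

lemma cinv_transition: "x \<in> overlap c d \<Longrightarrow> cinv d (transition c d x) = cinv c x"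
  using d by (simp add: mem_overlap transition_eq)

lemma transition_smooth: "smooth_on (transition c d) (overlap c d)"
  using compatible[OF c d] by (simp add: overlap_def)

lemma transition_derivative:
  assumes "x \<in> overlap c d"
  shows "(transition c d has_derivative (\<lambda>v. jacobian c d x *v v)) (at x)"
proof -
  have D: "(transition c d has_derivative frechet_derivative (transition c d) (at x)) (at x)"
    by (rule smooth_on_has_derivative[OF transition_smooth assms])
  have "(\<lambda>v. jacobian c d x *v v) = frechet_derivative (transition c d) (at x)"
    unfolding jacobian_def by (rule matrix_vector_mul(2)[OF has_derivative_linear[OF D]])
  then show ?thesis using D by simp
qed

lemma continuous_det_jacobian: "continuous_on (overlap c d) (\<lambda>x. det (jacobian c d x))"
proof -
  have "continuous_on (overlap c d) (\<lambda>x. jacobian c d x $ i $ j)" for i j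
  proof -
    have "Ck_on 1 (transition c d) (overlap c d)"
      by (rule smooth_onD[OF transition_smooth])
    then have "continuous_on (overlap c d) (\<lambda>x. frechet_derivative (transition c d) (at x) (axis j 1))"
      by simp
    then show ?thesis
      by (auto simp: jacobian_def matrix_def intro: continuous_intros)
  qed
  then show ?thesis unfolding det_def
    by (intro continuous_on_sum continuous_on_mult continuous_on_const continuous_on_prod) auto
qed

end

lemma transition_overlap:
  assumes "c \<in> \<A>" "d \<in> \<A>" "x \<in> overlap c d"
  shows "transition c d x \<in> overlap d c" "transition d c (transition c d x) = x"
  using assms by (auto simp: mem_overlap transition_eq)

lemma transition_image:
  assumes "c \<in> \<A>" "d \<in> \<A>"
  shows "transition c d ` overlap c d = overlap d c" "inj_on (transition c d) (overlap c d)"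
proof -
  show "transition c d ` overlap c d = overlap d c"
    using transition_overlap[OF assms] transition_overlap[OF assms(2,1)] by (metis (no_types, lifting) image_eqI subsetI image_subset_iff subset_antisym)
  show "inj_on (transition c d) (overlap c d)"
    using transition_overlap(2)[OF assms] by (metis inj_onI)
qed

text \<open>Chain rule for the identity \<open>transition d c \<circ> transition c d = id\<close> on
  the overlap.\<close>

lemma jacobian_inverse:
  assumes "c \<in> \<A>" "d \<in> \<A>" "x \<in> overlap c d"
  shows "jacobian d c (transition c d x) ** jacobian c d x = mat 1"
proof -
  let ?J = "jacobian c d x" and ?J' = "jacobian d c (transition c d x)"
  have "((\<lambda>y. transition d c (transition c d y)) has_derivative (\<lambda>v. ?J' *v (?J *v v))) (at x)"
    using has_derivative_compose[OF transition_derivative[OF assms]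
        transition_derivative[OF assms(2,1) transition_overlap(1)[OF assms]]] .
  moreover have "((\<lambda>y. transition d c (transition c d y)) has_derivative (\<lambda>v. v)) (at x)"
    by (rule has_derivative_transform_within_open[OF has_derivative_ident open_overlap[OF assms(1,2)] assms(3)])
       (simp add: transition_overlap(2)[OF assms(1,2)])
  ultimately have "(\<lambda>v. ?J' *v (?J *v v)) = (\<lambda>v. v)" by (rule has_derivative_unique)
  then show ?thesis
    by (simp add: matrix_eq matrix_vector_mul_assoc fun_eq_iff)
qed

lemma continuous_map_charts:
  assumes u: "\<And>c. c \<in> \<A> \<Longrightarrow> continuous_map (top_of_set (cimg c)) T' (\<lambda>x. u (cinv c x))"
  shows "continuous_map T T' u"
  unfolding continuous_map_def
proof (intro conjI allI impI)
  show "u \<in> topspace T \<rightarrow> topspace T'"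
  proof
    fix p assume "p \<in> topspace T"
    then obtain c where c: "c \<in> \<A>" "p \<in> cdom c" by (rule chart_at)
    have "(\<lambda>x. u (cinv c x)) (cmap c p) \<in> topspace T'"
      using continuous_map_image_subset_topspace[OF u[OF c(1)]] cmap_cimg[OF c]
      by (auto simp only: image_subset_iff topspace_euclidean_subtopology)
    with c show "u p \<in> topspace T'" by simp
  qed
  fix U assume U: "openin T' U"
  let ?V = "\<lambda>c. {x \<in> cimg c. u (cinv c x) \<in> U}"
  have "open (?V c)" if "c \<in> \<A>" for c
  proof -
    have "openin (top_of_set (cimg c)) (?V c)"
      using openin_continuous_map_preimage[OF u[OF that] U] by simp
    then show ?thesis using open_cimg[OF that] openin_open_eq by blast
  qed
  then have "openin T (cinv c ` ?V c)" if "c \<in> \<A>" for c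
    using openin_cinv_image[OF that] that by blast
  then have "openin T (\<Union>c\<in>\<A>. cinv c ` ?V c)" by blast
  moreover have "{p \<in> topspace T. u p \<in> U} = (\<Union>c\<in>\<A>. cinv c ` ?V c)"
  proof (intro set_eqI iffI)
    fix p assume p: "p \<in> {p \<in> topspace T. u p \<in> U}"
    then obtain c where c: "c \<in> \<A>" "p \<in> cdom c" using chart_at by blast
    then have "cmap c p \<in> ?V c" "p = cinv c (cmap c p)" using p by auto
    with c show "p \<in> (\<Union>c\<in>\<A>. cinv c ` ?V c)" by blast
  qed (use cinv_topspace in auto)
  ultimately show "openin T {p \<in> topspace T. u p \<in> U}" by simp
qed

end

section \<open>Partitions of unity\<close>

text \<open>The squared positive part is a simple cutoff profile of class \<open>C^1\<close>: its
  derivative \<open>2 * max 0 t\<close> is continuous across 0. No higher regularity is used in the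
  divergence theorem.\<close>

lemma Ck_on_pos_part_square: "Ck_on 1 (\<lambda>t::real. (max 0 t)\<^sup>2) UNIV"
proof -
  have D: "((\<lambda>t::real. (max 0 t)\<^sup>2) has_real_derivative 2 * max 0 t) (at t)" for t
  proof -
    consider "t > 0" | "t < 0" | "t = 0" by linarith
    then show ?thesis
    proof cases
      case 1
      have "((\<lambda>t::real. t\<^sup>2) has_real_derivative 2 * max 0 t) (at t)"
        using 1 by (auto intro!: derivative_eq_intros)
      then show ?thesis
        by (rule has_field_derivative_transform_within_open[of _ _ _ "{0<..}"]) (use 1 in auto)
    next
      case 2
      have "((\<lambda>t::real. 0) has_real_derivative 2 * max 0 t) (at t)"
        using 2 by (auto intro!: derivative_eq_intros)
      then show ?thesis
        by (rule has_field_derivative_transform_within_open[of _ _ _ "{..<0}"]) (use 2 in auto)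
    next
      case 3
      have "((\<lambda>h::real. (max 0 h)\<^sup>2 / h) \<longlongrightarrow> 0) (at 0)"
      proof (rule Lim_null_comparison[of _ "\<lambda>h. \<bar>h\<bar>"])
        show "\<forall>\<^sub>F h in at 0. norm ((max 0 h)\<^sup>2 / h) \<le> \<bar>h\<bar>"
          by (rule always_eventually) (auto simp: max_def power2_eq_square)
        show "((\<lambda>h::real. \<bar>h\<bar>) \<longlongrightarrow> 0) (at 0)"
          by (intro tendsto_eq_intros refl) auto
      qed
      then show ?thesis using 3 by (simp add: has_field_derivative_iff)
    qed
  qed
  show ?thesis unfolding One_nat_def
    by (rule Ck_on_SucI[OF open_UNIV D[unfolded has_field_derivative_def]])
       (auto intro!: continuous_intros)
qed

lemma Ck_on_radial_bump:
  fixes a :: "'v::euclidean_space"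
  shows "Ck_on 1 (\<lambda>y. (max 0 (r\<^sup>2 - (dist y a)\<^sup>2))\<^sup>2) UNIV"
proof (rule Ck_on_compose[OF open_UNIV open_UNIV _ Ck_on_pos_part_square])
  have "Ck_on 1 (\<lambda>y. r\<^sup>2 - (y - a) \<bullet> (y - a)) UNIV" unfolding One_nat_def
    by (rule Ck_on_SucI[OF open_UNIV, where f' = "\<lambda>y v. - (2 * (v \<bullet> (y - a)))"])
       (auto intro!: derivative_eq_intros continuous_intros simp: inner_commute)
  then show "Ck_on 1 (\<lambda>y. r\<^sup>2 - (dist y a)\<^sup>2) UNIV"
    by (simp add: dist_norm power2_norm_eq_inner)
qed auto

context smooth_manifold
begin

text \<open>The value 0 off the chart is a \<open>C^1\<close> extension when \<open>r > 0\<close>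
  and \<open>cball a r\<close> lies inside the chart image; the function is then positive exactly
  over the open ball.\<close>

definition bump :: "('a, 'n) chart \<Rightarrow> real^'n \<Rightarrow> real \<Rightarrow> 'a \<Rightarrow> real" where
  "bump c a r p = (if p \<in> cdom c then (max 0 (r\<^sup>2 - (dist (cmap c p) a)\<^sup>2))\<^sup>2 else 0)"

lemma bump_nonneg: "bump c a r p \<ge> 0"
  by (simp add: bump_def)

lemma bump_support:
  assumes "c \<in> \<A>" "r > 0" "p \<notin> cinv c ` cball a r"
  shows "bump c a r p = 0"
proof (cases "p \<in> cdom c")
  case True
  have "dist (cmap c p) a > r"
  proof (rule ccontr)
    assume "\<not> dist (cmap c p) a > r"
    then have "cmap c p \<in> cball a r" by (simp add: dist_commute)
    then show False using assms(1,3) True by (metis cinv_cmap imageI)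
  qed
  then have "(dist (cmap c p) a)\<^sup>2 > r\<^sup>2" using assms(2) by (intro power_strict_mono) auto
  then show ?thesis by (simp add: bump_def)
qed (simp add: bump_def)

lemma bump_pos:
  assumes "c \<in> \<A>" "cball a r \<subseteq> cimg c" "p \<in> cinv c ` ball a r"
  shows "bump c a r p > 0"
proof -
  obtain x where x: "dist a x < r" "p = cinv c x" using assms(3) by auto
  then have "x \<in> cimg c" using assms(2) by auto
  moreover have "(dist x a)\<^sup>2 < r\<^sup>2" using x by (intro power_strict_mono) (auto simp: dist_commute)
  ultimately show ?thesis using x assms(1) by (simp add: bump_def)
qed

lemma Ck_on_locally_supported:
  assumes "c \<in> \<A>" "d \<in> \<A>" "compact K" "K \<subseteq> cimg c"
    and 0: "\<And>p. p \<in> topspace T \<Longrightarrow> p \<notin> cinv c ` K \<Longrightarrow> u p = 0"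
    and u: "Ck_on k (\<lambda>x. u (cinv c x)) (cimg c)"
  shows "Ck_on k (\<lambda>y. u (cinv d y)) (cimg d)"
proof (rule Ck_on_local)
  fix y assume y: "y \<in> cimg d"
  show "\<exists>U. open U \<and> y \<in> U \<and> Ck_on k (\<lambda>y. u (cinv d y)) U"
  proof (cases "y \<in> overlap d c")
    case True
    have "Ck_on k (\<lambda>y. u (cinv c (transition d c y))) (overlap d c)"
      by (rule Ck_on_compose[OF open_overlap[OF assms(2,1)] open_cimg[OF assms(1)] _ u
            smooth_onD[OF transition_smooth[OF assms(2,1)]]])
         (use transition_overlap(1)[OF assms(2,1)] assms(1,2) in \<open>auto simp: mem_overlap\<close>)
    then have "Ck_on k (\<lambda>y. u (cinv d y)) (overlap d c)"
      using Ck_on_cong[OF open_overlap[OF assms(2,1)], of "\<lambda>y. u (cinv d y)"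
          "\<lambda>y. u (cinv c (transition d c y))" k] cinv_transition[OF assms(2,1)] by simp
    then show ?thesis using True open_overlap[OF assms(2,1)] by blast
  next
    case False
    let ?U = "cmap d ` (cdom d - cinv c ` K)"
    have "closedin T (cinv c ` K)" by (rule closedin_cinv_image[OF assms(1,3,4)])
    then have "openin T (cdom d - cinv c ` K)"
      using openin_cdom[OF assms(2)] by blast
    then have op: "open ?U" by (rule open_cmap_image[OF assms(2)]) auto
    have "cinv d y \<notin> cdom c" using False y assms(1,2) by (simp add: mem_overlap)
    then have "cinv d y \<notin> cinv c ` K" using assms(1,4) by auto
    then have "y \<in> ?U" using y assms(2) by (metis DiffI cinv_cdom cmap_cinv imageI)
    moreover have "u (cinv d z) = 0" if z: "z \<in> ?U" for z
    proof -
      obtain p where p: "z = cmap d p" "p \<in> cdom d" "p \<notin> cinv c ` K" using z by blast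
      then show ?thesis using 0[of p] cdom_subset[OF assms(2)] assms(2) by auto
    qed
    then have "Ck_on k (\<lambda>y. u (cinv d y)) ?U"
      using Ck_on_cong[OF op, of "\<lambda>y. u (cinv d y)" "\<lambda>_. 0" k] Ck_on_const[OF op] by simp
    ultimately show ?thesis using op by blast
  qed
qed

lemma Ck_on_bump:
  assumes "c \<in> \<A>" "d \<in> \<A>" "r > 0" "cball a r \<subseteq> cimg c"
  shows "Ck_on 1 (\<lambda>y. bump c a r (cinv d y)) (cimg d)"
proof (rule Ck_on_locally_supported[OF assms(1,2) compact_cball assms(4)])
  have "Ck_on 1 (\<lambda>y. (max 0 (r\<^sup>2 - (dist y a)\<^sup>2))\<^sup>2) (cimg c)"
    by (rule Ck_on_subset[OF Ck_on_radial_bump]) simp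
  then show "Ck_on 1 (\<lambda>y. bump c a r (cinv c y)) (cimg c)"
    using Ck_on_cong[OF open_cimg[OF assms(1)], of "\<lambda>y. bump c a r (cinv c y)"
        "\<lambda>y. (max 0 (r\<^sup>2 - (dist y a)\<^sup>2))\<^sup>2" 1] assms(1) by (simp add: bump_def)
qed (rule bump_support[OF assms(1,3)])

text \<open>The indices are points of the manifold, each carrying a chart and a closed ball around
  its coordinates. Compactness leaves finitely many whose open balls cover, so the sum of their
  bumps is positive everywhere and can be divided out.\<close>

lemma partition_of_unity:
  assumes "compact_space T"
  obtains F :: "'a set" and \<kappa> K \<eta>
  where "finite F"
    "\<And>i. i \<in> F \<Longrightarrow> \<kappa> i \<in> \<A>" "\<And>i. i \<in> F \<Longrightarrow> compact (K i)" "\<And>i. i \<in> F \<Longrightarrow> K i \<subseteq> cimg (\<kappa> i)"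
    "\<And>i p. i \<in> F \<Longrightarrow> p \<in> topspace T \<Longrightarrow> \<eta> i p \<ge> 0"
    "\<And>i p. i \<in> F \<Longrightarrow> p \<in> topspace T \<Longrightarrow> p \<notin> cinv (\<kappa> i) ` K i \<Longrightarrow> \<eta> i p = (0::real)"
    "\<And>i d. i \<in> F \<Longrightarrow> d \<in> \<A> \<Longrightarrow> Ck_on 1 (\<lambda>y. \<eta> i (cinv d y)) (cimg d)"
    "\<And>p. p \<in> topspace T \<Longrightarrow> (\<Sum>i\<in>F. \<eta> i p) = 1"
proof -
  have "\<exists>c r. c \<in> \<A> \<and> p \<in> cdom c \<and> r > 0 \<and> cball (cmap c p) r \<subseteq> cimg c" if "p \<in> topspace T" for p
  proof -
    obtain c where c: "c \<in> \<A>" "p \<in> cdom c" by (rule chart_at[OF \<open>p \<in> topspace T\<close>])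
    then obtain r where "r > 0" "cball (cmap c p) r \<subseteq> cimg c"
      using open_cimg open_contains_cball cmap_cimg by metis
    with c show ?thesis by blast
  qed
  then obtain \<kappa> r where \<kappa>: "\<And>p. p \<in> topspace T \<Longrightarrow> \<kappa> p \<in> \<A>" "\<And>p. p \<in> topspace T \<Longrightarrow> p \<in> cdom (\<kappa> p)"
    "\<And>p. p \<in> topspace T \<Longrightarrow> r p > 0" "\<And>p. p \<in> topspace T \<Longrightarrow> cball (cmap (\<kappa> p) p) (r p) \<subseteq> cimg (\<kappa> p)"
    by metis
  let ?a = "\<lambda>p. cmap (\<kappa> p) p"
  let ?U = "\<lambda>p. cinv (\<kappa> p) ` ball (?a p) (r p)"
  have "openin T (?U p)" if "p \<in> topspace T" for p
    using that \<kappa> by (intro openin_cinv_image) (auto simp: subset_iff)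
  then have 1: "\<forall>V\<in>?U ` topspace T. openin T V" by blast
  have "p \<in> ?U p" if "p \<in> topspace T" for p
    using that \<kappa> by (intro image_eqI[of _ _ "?a p"]) auto
  then have 2: "topspace T \<subseteq> \<Union>(?U ` topspace T)" by blast
  obtain F' where F': "finite F'" "F' \<subseteq> ?U ` topspace T" "topspace T \<subseteq> \<Union>F'"
    using assms[unfolded compact_space_alt, rule_format, of "?U ` topspace T"] 1 2 by blast
  obtain F where F: "F \<subseteq> topspace T" "finite F" "F' = ?U ` F"
    using finite_subset_image[OF F'(1,2)] by blast
  let ?b = "\<lambda>i. bump (\<kappa> i) (?a i) (r i)"
  let ?s = "\<lambda>p. \<Sum>i\<in>F. ?b i p"
  have s: "?s p > 0" if p: "p \<in> topspace T" for p
  proof -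
    obtain i where i: "i \<in> F" "p \<in> ?U i" using F F' p by blast
    then have "i \<in> topspace T" using F by blast
    then have "?b i p > 0" using i \<kappa> by (intro bump_pos) blast+
    then show ?thesis using sum_pos2[OF F(2) i(1), of "\<lambda>i. ?b i p"] bump_nonneg by blast
  qed
  have bC: "Ck_on 1 (\<lambda>y. ?b i (cinv d y)) (cimg d)" if "i \<in> F" "d \<in> \<A>" for i d
  proof -
    have "i \<in> topspace T" using that F by blast
    then show ?thesis using that(2) \<kappa> by (intro Ck_on_bump) blast+
  qed
  show ?thesis
  proof (rule that[of F \<kappa> "\<lambda>i. cball (?a i) (r i)" "\<lambda>i p. ?b i p / ?s p"])
    show "Ck_on 1 (\<lambda>y. ?b i (cinv d y) / ?s (cinv d y)) (cimg d)" if "i \<in> F" "d \<in> \<A>" for i d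
    proof (rule Ck_on_divide[OF open_cimg[OF that(2)] _ bC[OF that] Ck_on_sum[OF open_cimg[OF that(2)] F(2) bC[OF _ that(2)]]])
      show "?s (cinv d x) \<noteq> 0" if "x \<in> cimg d" for x
        using s[of "cinv d x"] cinv_topspace[OF \<open>d \<in> \<A>\<close> that] by simp
    qed auto
    show "(\<Sum>i\<in>F. ?b i p / ?s p) = 1" if "p \<in> topspace T" for p
      using s[OF that] by (simp flip: sum_divide_distrib)
    show "?b i p / ?s p = 0" if "i \<in> F" "p \<notin> cinv (\<kappa> i) ` cball (?a i) (r i)" for i p
      using that F \<kappa> bump_support[of "\<kappa> i" "r i" p "?a i"] by auto
    show "?b i p / ?s p \<ge> 0" if "p \<in> topspace T" for i p
      using s[OF that] bump_nonneg by (simp add: less_imp_le)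
  qed (use F \<kappa> compact_cball in \<open>blast+\<close>)
qed

end

section \<open>The divergence theorem\<close>

text \<open>The set where \<open>f\<close> does not vanish is open and a null set, hence
  empty.\<close>

lemma integral_nonneg_continuous_eq_0:
  fixes f :: "'a::euclidean_space \<Rightarrow> real"
  assumes "open S" "continuous_on S f" "\<And>x. x \<in> S \<Longrightarrow> f x \<ge> 0"
    and "set_integrable lborel S f" "(LINT x:S|lborel. f x) = 0" "x \<in> S"
  shows "f x = 0"
proof -
  have "AE x in lborel. indicator S x *\<^sub>R f x = 0"
    using integral_nonneg_eq_0_iff_AE[of lborel "\<lambda>x. indicator S x *\<^sub>R f x"] assms
    by (auto simp: set_integrable_def set_lebesgue_integral_def indicator_def)
  moreover have "{x \<in> S. f x \<noteq> 0} = {x. \<not> indicator S x *\<^sub>R f x = 0}"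
    by (auto simp: indicator_def)
  moreover have op: "open {x \<in> S. f x \<noteq> 0}"
  proof -
    have "open (- {0::real})" by (intro open_Compl closed_singleton)
    then show ?thesis
      using continuous_open_preimage[OF assms(2,1), of "- {0}"] by (simp add: vimage_def Int_def)
  qed
  ultimately have "{x \<in> S. f x \<noteq> 0} \<in> null_sets lborel"
    using AE_iff_null_sets[of "{x \<in> S. f x \<noteq> 0}" lborel] by auto
  then have "negligible {x \<in> S. f x \<noteq> 0}"
    using negligible_iff_null_sets null_sets_completionI by blast
  then have "{x \<in> S. f x \<noteq> 0} = {}" using open_not_negligible[OF op] by blast
  with assms(6) show ?thesis by blast
qed

lemma frechet_derivative_axis_sum:
  fixes f :: "real^'n::finite \<Rightarrow> real"
  assumes "f differentiable (at x)"
  shows "frechet_derivative f (at x) v = (\<Sum>i\<in>UNIV. v $ i * pd i f x)"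
proof -
  have lin: "linear (frechet_derivative f (at x))" using assms by (rule linear_frechet_derivative)
  have "frechet_derivative f (at x) (\<Sum>i\<in>UNIV. (v $ i) *\<^sub>R axis i 1)
      = (\<Sum>i\<in>UNIV. v $ i * pd i f x)"
    by (simp only: linear_sum[OF lin] linear_scale[OF lin] pd_def real_scaleR_def)
  moreover have "(\<Sum>i\<in>UNIV. (v $ i) *\<^sub>R axis i 1) = v"
    using basis_expansion[of v] by (simp add: scalar_mult_eq_scaleR)
  ultimately show ?thesis by simp
qed

lemma pd_mult:
  fixes f h :: "real^'n::finite \<Rightarrow> real"
  assumes "f differentiable (at x)" "h differentiable (at x)"
  shows "pd i (\<lambda>y. f y * h y) x = f x * pd i h x + pd i f x * h x"
proof -
  have "((\<lambda>y. f y * h y) has_derivative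
     (\<lambda>v. f x * frechet_derivative h (at x) v + frechet_derivative f (at x) v * h x)) (at x)"
    using assms by (intro has_derivative_mult) (simp_all add: frechet_derivative_works)
  from has_derivative_imp_frechet[OF this] show ?thesis by (simp add: pd_def)
qed

text \<open>The integrand is the divergence of \<open>u * Y\<close>. Each component of this product,
  extended by zero, is a compactly supported \<open>C^1\<close> function on the whole space, and the
  integral of each of its partial derivatives vanishes.\<close>

lemma integral_divergence_compact_support:
  fixes Y :: "real^'n::finite \<Rightarrow> real^'n" and u :: "real^'n \<Rightarrow> real"
  assumes "open S" "compact K" "K \<subseteq> S"
    and u: "Ck_on 1 u S" "\<And>x. x \<in> S - K \<Longrightarrow> u x = 0"
    and Y: "Ck_on 1 Y S"
  shows "(LINT x:S|lborel. u x * (\<Sum>i\<in>UNIV. pd i (\<lambda>y. Y y $ i) x) + frechet_derivative u (at x) (Y x)) = 0"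
proof -
  define F where "F i x = (if x \<in> S then u x * Y x $ i else 0)" for i x
  have F0: "F i x = 0" if "x \<notin> K" for i x using that u(2) by (auto simp: F_def)
  have Yi: "Ck_on 1 (\<lambda>x. Y x $ i) S" for i by (rule Ck_on_vec_component[OF assms(1) Y])
  have FS: "Ck_on 1 (F i) S" for i
    using Ck_on_mult[OF assms(1) u(1) Yi] Ck_on_cong[OF assms(1), of "F i" "\<lambda>x. u x * Y x $ i" 1]
    by (simp add: F_def)
  have opK: "open (- K)" using assms(2) compact_imp_closed by blast
  have FK: "Ck_on 1 (F i) (- K)" for i
    using Ck_on_cong[OF opK, of "F i" "\<lambda>_. 0" 1] Ck_on_const[OF opK] F0 by simp
  \<comment> \<open>The open sets \<open>S\<close> and \<open>- K\<close> cover the space, and on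
    the second one the extension is zero.\<close>
  have FC: "Ck_on 1 (F i) UNIV" for i
  proof (rule Ck_on_local)
    fix x show "\<exists>U. open U \<and> x \<in> U \<and> Ck_on 1 (F i) U"
      using FS FK opK assms(1,3) by (cases "x \<in> S") blast+
  qed
  let ?D = "\<lambda>i x. frechet_derivative (F i) (at x) (axis i 1)"
  have D: "integrable lborel (?D i)" "(\<integral>x. ?D i x \<partial>lborel) = 0" for i
  proof -
    have 1: "(F i has_derivative frechet_derivative (F i) (at x)) (at x)" for x
      using FC[of i] by (simp add: frechet_derivative_works)
    have 2: "continuous_on UNIV (?D i)" using FC[of i] by simp
    show "integrable lborel (?D i)" "(\<integral>x. ?D i x \<partial>lborel) = 0"
      by (rule integral_directional_derivative_eq_0[OF assms(2) F0 1 2], assumption)+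
  qed
  have eq: "indicator S x *\<^sub>R (u x * (\<Sum>i\<in>UNIV. pd i (\<lambda>y. Y y $ i) x) + frechet_derivative u (at x) (Y x))
      = (\<Sum>i\<in>UNIV. ?D i x)" for x
  proof (cases "x \<in> S")
    case True
    have ud: "u differentiable (at x)" and Yd: "(\<lambda>y. Y y $ i) differentiable (at x)" for i
      using u(1) Yi[of i] True by auto
    have "?D i x = u x * pd i (\<lambda>y. Y y $ i) x + pd i u x * Y x $ i" for i
    proof -
      have "?D i x = pd i (\<lambda>y. u y * Y y $ i) x"
        unfolding pd_def
        using frechet_derivative_cong_open[OF assms(1) True, of "F i" "\<lambda>y. u y * Y y $ i"]
        by (simp add: F_def)
      then show ?thesis using pd_mult[OF ud Yd] by simp
    qed
    then show ?thesis
      using True frechet_derivative_axis_sum[OF ud, of "Y x"]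
      by (simp add: sum.distrib sum_distrib_left mult.commute)
  next
    case False
    then have "x \<in> - K" using assms(3) by blast
    have "?D i x = 0" for i
      using frechet_derivative_cong_open[OF opK \<open>x \<in> - K\<close>, of "F i" "\<lambda>_. 0"] F0
      by simp
    then show ?thesis using False by simp
  qed
  show ?thesis
    unfolding set_lebesgue_integral_def eq using D by (subst Bochner_Integration.integral_sum) auto
qed

lemma vector_field_smooth:
  "smooth_vector_field \<A> X \<Longrightarrow> c \<in> \<A> \<Longrightarrow> smooth_on (X c) (cimg c)"
  by (simp add: smooth_vector_field_def)

context smooth_manifold
begin

lemma vector_field_transition:
  "smooth_vector_field \<A> X \<Longrightarrow> c \<in> \<A> \<Longrightarrow> d \<in> \<A> \<Longrightarrow> x \<in> overlap c d \<Longrightarrow>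
     X d (transition c d x) = jacobian c d x *v X c x"
  by (auto simp: smooth_vector_field_def overlap_def)

text \<open>Turns expressions in charts into a function on the manifold. The arbitrary choice of a
  chart at each point is harmless when the expressions agree on overlaps, which is the condition of
  \<open>glue_chart\<close>.\<close>

definition glue :: "(('a, 'n) chart \<Rightarrow> real^'n \<Rightarrow> real) \<Rightarrow> 'a \<Rightarrow> real" where
  "glue \<phi> p = (let c = SOME c. c \<in> \<A> \<and> p \<in> cdom c in \<phi> c (cmap c p))"

lemma glue_chart:
  assumes c: "c \<in> \<A>" and x: "x \<in> cimg c"
    and \<phi>: "\<And>d. d \<in> \<A> \<Longrightarrow> x \<in> overlap c d \<Longrightarrow> \<phi> c x = \<phi> d (transition c d x)"
  shows "glue \<phi> (cinv c x) = \<phi> c x"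
proof -
  define d where "d = (SOME d. d \<in> \<A> \<and> cinv c x \<in> cdom d)"
  have "\<exists>d. d \<in> \<A> \<and> cinv c x \<in> cdom d" using c x cinv_cdom by blast
  from someI_ex[OF this] have d: "d \<in> \<A>" "cinv c x \<in> cdom d" by (simp_all add: d_def)
  then have xo: "x \<in> overlap c d" using c x by (simp add: mem_overlap)
  show ?thesis
    using \<phi>[OF d(1) xo] by (simp add: glue_def d_def[symmetric] transition_eq[OF c d(1)])
qed

text \<open>The function usually written \<open>X(u)\<close>, the derivative of \<open>u\<close>
  along the field \<open>X\<close>.\<close>

definition along :: "(('a, 'n) chart \<Rightarrow> real^'n \<Rightarrow> real^'n) \<Rightarrow> ('a \<Rightarrow> real) \<Rightarrow> 'a \<Rightarrow> real" where
  "along X u = glue (\<lambda>c x. frechet_derivative (\<lambda>y. u (cinv c y)) (at x) (X c x))"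

text \<open>By the chain rule the differential of \<open>u\<close> absorbs the Jacobian on the
  right, and the transformation law of \<open>X\<close> produces the same Jacobian; so the choice
  hidden in \<open>glue\<close> does not matter.\<close>

lemma along_chart:
  assumes X: "smooth_vector_field \<A> X" and c: "c \<in> \<A>" and x: "x \<in> cimg c"
    and u: "\<And>d. d \<in> \<A> \<Longrightarrow> Ck_on 1 (\<lambda>y. u (cinv d y)) (cimg d)"
  shows "along X u (cinv c x) = frechet_derivative (\<lambda>y. u (cinv c y)) (at x) (X c x)"
  unfolding along_def
proof (rule glue_chart[OF c x])
  fix d assume d: "d \<in> \<A>" and xo: "x \<in> overlap c d"
  let ?t = "transition c d"
  have "?t x \<in> cimg d"
    using transition_overlap(1)[OF c d xo] c d by (simp add: mem_overlap)
  then have "((\<lambda>y. u (cinv d y)) has_derivative frechet_derivative (\<lambda>y. u (cinv d y)) (at (?t x))) (at (?t x))"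
    using u[OF d] by (simp add: frechet_derivative_works)
  from has_derivative_compose[OF transition_derivative[OF c d xo] this]
  have "((\<lambda>y. u (cinv d (?t y))) has_derivative
     (\<lambda>v. frechet_derivative (\<lambda>y. u (cinv d y)) (at (?t x)) (jacobian c d x *v v))) (at x)" .
  then have "((\<lambda>y. u (cinv c y)) has_derivative
     (\<lambda>v. frechet_derivative (\<lambda>y. u (cinv d y)) (at (?t x)) (jacobian c d x *v v))) (at x)"
    by (rule has_derivative_transform_within_open[OF _ open_overlap[OF c d] xo])
       (simp add: cinv_transition[OF c d])
  from has_derivative_imp_frechet[OF this]
  have "frechet_derivative (\<lambda>y. u (cinv c y)) (at x) (X c x)
     = frechet_derivative (\<lambda>y. u (cinv d y)) (at (?t x)) (jacobian c d x *v X c x)" by simp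
  also have "jacobian c d x *v X c x = X d (?t x)"
    using vector_field_transition[OF X c d xo] by simp
  finally show "frechet_derivative (\<lambda>y. u (cinv c y)) (at x) (X c x)
     = frechet_derivative (\<lambda>y. u (cinv d y)) (at (?t x)) (X d (?t x))" .
qed

lemma continuous_along:
  assumes X: "smooth_vector_field \<A> X" and c: "c \<in> \<A>"
    and u: "\<And>d. d \<in> \<A> \<Longrightarrow> Ck_on 1 (\<lambda>y. u (cinv d y)) (cimg d)"
  shows "continuous_on (cimg c) (\<lambda>x. along X u (cinv c x))"
proof -
  have "continuous_on (cimg c) (X c)"
    by (rule smooth_on_continuous[OF vector_field_smooth[OF X c]])
  then have "continuous_on (cimg c) (\<lambda>x. \<Sum>i\<in>UNIV. X c x $ i * pd i (\<lambda>y. u (cinv c y)) x)"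
    using u[OF c] unfolding pd_def by (intro continuous_intros) auto
  then show ?thesis
    by (rule continuous_on_eq)
       (use u[OF c] along_chart[OF X c _ u] in \<open>simp add: frechet_derivative_axis_sum\<close>)
qed

text \<open>A positive density of class \<open>C^1\<close>. The absolute value of the Jacobian
  determinant makes \<open>w c x dx\<close> a measure that does not depend on the chart, without any
  orientation.\<close>

definition is_density :: "(('a, 'n) chart \<Rightarrow> real^'n \<Rightarrow> real) \<Rightarrow> bool" where
  "is_density w \<longleftrightarrow>
     (\<forall>c\<in>\<A>. Ck_on 1 (w c) (cimg c) \<and> (\<forall>x\<in>cimg c. w c x > 0)) \<and>
     (\<forall>c\<in>\<A>. \<forall>d\<in>\<A>. \<forall>x\<in>overlap c d. w c x = \<bar>det (jacobian c d x)\<bar> * w d (transition c d x))"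

section \<open>Integration against a density\<close>

context
  fixes w assumes w: "is_density w"
begin

lemma density_pos: "c \<in> \<A> \<Longrightarrow> x \<in> cimg c \<Longrightarrow> w c x > 0"
  and density_Ck: "c \<in> \<A> \<Longrightarrow> Ck_on 1 (w c) (cimg c)"
  and density_transition: "c \<in> \<A> \<Longrightarrow> d \<in> \<A> \<Longrightarrow> x \<in> overlap c d \<Longrightarrow>
     w c x = \<bar>det (jacobian c d x)\<bar> * w d (transition c d x)"
  using w by (auto simp: is_density_def)

definition chart_integral :: "('a, 'n) chart \<Rightarrow> ('a \<Rightarrow> real) \<Rightarrow> real" where
  "chart_integral c u = (LINT x:cimg c|lborel. w c x * u (cinv c x))"

lemma chart_integrable:
  assumes c: "c \<in> \<A>" and K: "compact K" "K \<subseteq> cimg c"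
    and u: "continuous_on (cimg c) (\<lambda>x. u (cinv c x))"
    and 0: "\<And>x. x \<in> cimg c - K \<Longrightarrow> u (cinv c x) = 0"
  shows "set_integrable lborel (cimg c) (\<lambda>x. w c x * u (cinv c x))"
  unfolding set_integrable_def
proof (rule integrable_compact_support[OF K(1)])
  show "indicator (cimg c) x *\<^sub>R (w c x * u (cinv c x)) = 0" if "x \<notin> K" for x
    using that 0 by (cases "x \<in> cimg c") auto
  have "continuous_on K (\<lambda>x. w c x * u (cinv c x))"
    using Ck_on_continuous[OF density_Ck[OF c]] u K(2)
    by (intro continuous_on_mult) (auto intro: continuous_on_subset)
  then show "continuous_on K (\<lambda>x. indicator (cimg c) x *\<^sub>R (w c x * u (cinv c x)))"
    by (rule continuous_on_eq) (use K(2) in auto)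
qed

text \<open>As \<open>u\<close> vanishes off the common domain, both integrals live on the overlaps.
  There the change of variables produces a Jacobian factor which the transformation law of the
  density absorbs.\<close>

lemma chart_integral_swap:
  assumes c: "c \<in> \<A>" and d: "d \<in> \<A>"
    and u: "continuous_on (cimg d) (\<lambda>x. u (cinv d x))"
    and 0: "\<And>p. p \<in> topspace T \<Longrightarrow> p \<notin> cdom c \<inter> cdom d \<Longrightarrow> u p = 0"
    and int: "set_integrable lborel (cimg d) (\<lambda>x. w d x * u (cinv d x))"
  shows "chart_integral c u = chart_integral d u"
proof -
  have restr: "chart_integral a u = (LINT x:overlap a b|lborel. w a x * u (cinv a x))"
    if "a \<in> \<A>" "b \<in> \<A>" "{a, b} = {c, d}" for a b
    unfolding chart_integral_def set_lebesgue_integral_def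
  proof (rule arg_cong[where f = "integral\<^sup>L lborel"], rule ext)
    fix x
    show "indicator (cimg a) x *\<^sub>R (w a x * u (cinv a x)) = indicator (overlap a b) x *\<^sub>R (w a x * u (cinv a x))"
    proof (cases "x \<in> cimg a \<and> x \<notin> overlap a b")
      case True
      then have "cinv a x \<notin> cdom b" using that by (simp add: mem_overlap)
      then have "u (cinv a x) = 0" using 0[of "cinv a x"] cinv_topspace[OF that(1)] True that(3) by (auto simp: doubleton_eq_iff)
      then show ?thesis by simp
    next
      case False
      then show ?thesis using that by (auto simp: mem_overlap indicator_def)
    qed
  qed
  let ?f = "\<lambda>y. w d y * u (cinv d y)"
  have sub: "overlap d c \<subseteq> cimg d" using c d by (auto simp: mem_overlap)
  have "(LINT x:overlap c d|lborel. \<bar>det (matrix (\<lambda>v. jacobian c d x *v v))\<bar> * ?f (transition c d x))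
      = (LINT y:transition c d ` overlap c d|lborel. ?f y)"
  proof (rule lborel_change_of_variables[OF open_overlap[OF c d]])
    show "open (transition c d ` overlap c d)" "inj_on (transition c d) (overlap c d)"
      using transition_image[OF c d] open_overlap[OF d c] by simp_all
    show "(transition c d has_derivative (*v) (jacobian c d x)) (at x)" if "x \<in> overlap c d" for x
      using transition_derivative[OF c d that] .
    show "continuous_on (overlap c d) (\<lambda>x. det (matrix ((*v) (jacobian c d x))))"
      using continuous_det_jacobian[OF c d] by simp
    show "continuous_on (transition c d ` overlap c d) ?f"
      using Ck_on_continuous[OF density_Ck[OF d]] u sub transition_image(1)[OF c d]
      by (intro continuous_on_mult) (auto intro: continuous_on_subset)
    show "set_integrable lborel (transition c d ` overlap c d) ?f"
      by (rule set_integrable_subset[OF int])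
        (use sub transition_image(1)[OF c d] open_overlap[OF d c] in auto)
  qed
  moreover have "indicator (overlap c d) x *\<^sub>R (\<bar>det (matrix (\<lambda>v. jacobian c d x *v v))\<bar> * ?f (transition c d x))
    = indicator (overlap c d) x *\<^sub>R (w c x * u (cinv c x))" for x
    using density_transition[OF c d, of x] cinv_transition[OF c d, of x]
    by (cases "x \<in> overlap c d") auto
  ultimately have "(LINT x:overlap c d|lborel. w c x * u (cinv c x)) = (LINT y:overlap d c|lborel. ?f y)"
    using transition_image(1)[OF c d] by (simp only: set_lebesgue_integral_def)
  then show ?thesis using restr[of c d] restr[of d c] c d by (auto simp: insert_commute)
qed

text \<open>The hypothesis \<open>div\<close> says that \<open>h\<close> is the divergence of
  \<open>X\<close> for the density \<open>w\<close>. With a partition of unity, the divergence of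
  \<open>\<eta> i * X\<close> integrates to zero in the chart \<open>\<kappa> i\<close>, and these
  divergences add up to \<open>h\<close>. To add integrals that live in different charts, each is
  split once more by the partition and the \<open>j\<close>-th piece is moved to the chart
  \<open>\<kappa> j\<close>. The outcome is that the integrals of \<open>h * \<eta> j\<close> add up
  to zero; since they are nonnegative, each of them vanishes, and with it the integrand.\<close>

lemma divergence_nonneg_imp_zero:
  assumes comp: "compact_space T" and X: "smooth_vector_field \<A> X"
    and h: "\<And>c. c \<in> \<A> \<Longrightarrow> continuous_on (cimg c) (\<lambda>x. h (cinv c x))"
      "\<And>p. p \<in> topspace T \<Longrightarrow> h p \<ge> 0"
    and div: "\<And>c x. c \<in> \<A> \<Longrightarrow> x \<in> cimg c \<Longrightarrow>
       (\<Sum>i\<in>UNIV. pd i (\<lambda>y. w c y * X c y $ i) x) = w c x * h (cinv c x)"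
    and p: "p \<in> topspace T"
  shows "h p = 0"
proof -
  obtain F :: "'a set" and \<kappa> K \<eta> where F: "finite F"
    and \<kappa>: "\<And>i. i \<in> F \<Longrightarrow> \<kappa> i \<in> \<A>" and K: "\<And>i. i \<in> F \<Longrightarrow> compact (K i)" "\<And>i. i \<in> F \<Longrightarrow> K i \<subseteq> cimg (\<kappa> i)"
    and \<eta>0: "\<And>i p. i \<in> F \<Longrightarrow> p \<in> topspace T \<Longrightarrow> \<eta> i p \<ge> 0"
    and supp: "\<And>i p. i \<in> F \<Longrightarrow> p \<in> topspace T \<Longrightarrow> p \<notin> cinv (\<kappa> i) ` K i \<Longrightarrow> \<eta> i p = (0::real)"
    and \<eta>C: "\<And>i d. i \<in> F \<Longrightarrow> d \<in> \<A> \<Longrightarrow> Ck_on 1 (\<lambda>y. \<eta> i (cinv d y)) (cimg d)"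
    and one: "\<And>p. p \<in> topspace T \<Longrightarrow> (\<Sum>i\<in>F. \<eta> i p) = 1"
    by (rule partition_of_unity[OF comp]) blast
  \<comment> \<open>\<open>u i\<close> is the divergence of \<open>\<eta> i * X\<close> with respect
    to the density.\<close>
  define u where "u i p = \<eta> i p * h p + along X (\<eta> i) p" for i p
  have \<eta>cont: "continuous_on (cimg c) (\<lambda>x. \<eta> i (cinv c x))" if "i \<in> F" "c \<in> \<A>" for i c
    by (rule Ck_on_continuous[OF \<eta>C[OF that]])
  have ucont: "continuous_on (cimg c) (\<lambda>x. u i (cinv c x))" if "i \<in> F" "c \<in> \<A>" for i c
    unfolding u_def using \<eta>C that
    by (intro continuous_on_add continuous_on_mult \<eta>cont h(1) continuous_along[OF X]) auto
  have outside: "cinv (\<kappa> i) x \<notin> cinv (\<kappa> i) ` K i" if i: "i \<in> F" and x: "x \<in> cimg (\<kappa> i) - K i" for i x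
  proof
    assume "cinv (\<kappa> i) x \<in> cinv (\<kappa> i) ` K i"
    then obtain y where y: "y \<in> K i" "cinv (\<kappa> i) x = cinv (\<kappa> i) y" by blast
    then have "x = y" using x K(2)[OF i] cmap_cinv[OF \<kappa>[OF i]] by (metis DiffD1 subsetD)
    then show False using x y by blast
  qed
  have KD: "cinv (\<kappa> i) ` K i \<subseteq> cdom (\<kappa> i)" if "i \<in> F" for i
    using K(2)[OF that] cinv_cdom[OF \<kappa>[OF that]] by (intro image_subsetI) blast
  have usupp: "u i q = 0" if i: "i \<in> F" and q: "q \<in> topspace T" "q \<notin> cinv (\<kappa> i) ` K i" for i q
  proof -
    obtain c where c: "c \<in> \<A>" "q \<in> cdom c" by (rule chart_at[OF q(1)])
    let ?U = "cmap c ` (cdom c - cinv (\<kappa> i) ` K i)"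
    have "closedin T (cinv (\<kappa> i) ` K i)" using closedin_cinv_image \<kappa> K i by blast
    then have "openin T (cdom c - cinv (\<kappa> i) ` K i)" using openin_cdom[OF c(1)] by blast
    then have op: "open ?U" by (rule open_cmap_image[OF c(1)]) auto
    have qU: "cmap c q \<in> ?U" using c q by auto
    have "\<eta> i (cinv c y) = 0" if y: "y \<in> ?U" for y
    proof -
      obtain p where "y = cmap c p" "p \<in> cdom c" "p \<notin> cinv (\<kappa> i) ` K i" using y by blast
      then show ?thesis using supp[OF i, of p] cdom_subset[OF c(1)] c(1) by auto
    qed
    then have "frechet_derivative (\<lambda>y. \<eta> i (cinv c y)) (at (cmap c q)) = (\<lambda>_. 0)"
      using frechet_derivative_cong_open[OF op qU, of "\<lambda>y. \<eta> i (cinv c y)" "\<lambda>_. 0"] by simp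
    then have "along X (\<eta> i) q = 0"
      using along_chart[OF X c(1) cmap_cimg[OF c], of "\<eta> i"] \<eta>C i c by simp
    then show ?thesis using supp[OF i q] by (simp add: u_def)
  qed
  \<comment> \<open>The terms \<open>X(\<eta> i)\<close> cancel in the sum, because the partition
    sums to the constant 1.\<close>
  have usum: "(\<Sum>i\<in>F. u i q) = h q" if q: "q \<in> topspace T" for q
  proof -
    obtain c where c: "c \<in> \<A>" "q \<in> cdom c" by (rule chart_at[OF q])
    let ?x = "cmap c q"
    have "?x \<in> cimg c" using c by simp
    have "((\<lambda>y. \<Sum>i\<in>F. \<eta> i (cinv c y)) has_derivative
      (\<lambda>v. \<Sum>i\<in>F. frechet_derivative (\<lambda>y. \<eta> i (cinv c y)) (at ?x) v)) (at ?x)"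
      using \<eta>C[OF _ c(1)] \<open>?x \<in> cimg c\<close>
      by (intro has_derivative_sum) (simp add: frechet_derivative_works)
    moreover have "((\<lambda>y. \<Sum>i\<in>F. \<eta> i (cinv c y)) has_derivative (\<lambda>v. 0)) (at ?x)"
      by (rule has_derivative_transform_within_open[OF has_derivative_const open_cimg[OF c(1)] \<open>?x \<in> cimg c\<close>])
         (use one cinv_topspace[OF c(1)] in simp)
    ultimately have "(\<lambda>v. \<Sum>i\<in>F. frechet_derivative (\<lambda>y. \<eta> i (cinv c y)) (at ?x) v) = (\<lambda>v. 0)"
      by (rule has_derivative_unique)
    from fun_cong[OF this] have "(\<Sum>i\<in>F. along X (\<eta> i) q) = 0"
      using along_chart[OF X c(1) \<open>?x \<in> cimg c\<close> \<eta>C] c by simp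
    then show ?thesis
      by (simp add: u_def sum.distrib one[OF q] flip: sum_distrib_right)
  qed
  have uint: "chart_integral (\<kappa> i) (u i) = 0" if i: "i \<in> F" for i
  proof -
    let ?c = "\<kappa> i"
    have c: "?c \<in> \<A>" using \<kappa> i by blast
    have XC: "Ck_on 1 (X ?c) (cimg ?c)"
      by (rule smooth_onD[OF vector_field_smooth[OF X c]])
    have "(LINT x:cimg ?c|lborel. \<eta> i (cinv ?c x) * (\<Sum>j\<in>UNIV. pd j (\<lambda>y. (w ?c y *\<^sub>R X ?c y) $ j) x)
        + frechet_derivative (\<lambda>y. \<eta> i (cinv ?c y)) (at x) (w ?c x *\<^sub>R X ?c x)) = 0"
    proof (rule integral_divergence_compact_support[OF open_cimg[OF c] K[OF i] \<eta>C[OF i c]])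
      show "\<eta> i (cinv ?c x) = 0" if "x \<in> cimg ?c - K i" for x
      proof (rule supp[OF i])
        show "cinv ?c x \<notin> cinv ?c ` K i"
          by (rule outside[OF i that])
      qed (use that cinv_topspace[OF c] in blast)
      show "Ck_on 1 (\<lambda>y. w ?c y *\<^sub>R X ?c y) (cimg ?c)"
        by (rule Ck_on_scaleR[OF open_cimg[OF c] density_Ck[OF c] XC])
    qed
    moreover have "\<eta> i (cinv ?c x) * (\<Sum>j\<in>UNIV. pd j (\<lambda>y. (w ?c y *\<^sub>R X ?c y) $ j) x)
        + frechet_derivative (\<lambda>y. \<eta> i (cinv ?c y)) (at x) (w ?c x *\<^sub>R X ?c x)
        = w ?c x * u i (cinv ?c x)" if x: "x \<in> cimg ?c" for x
    proof -
      have "linear (frechet_derivative (\<lambda>y. \<eta> i (cinv ?c y)) (at x))"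
        using \<eta>C[OF i c] x by (intro linear_frechet_derivative) simp
      then have "frechet_derivative (\<lambda>y. \<eta> i (cinv ?c y)) (at x) (w ?c x *\<^sub>R X ?c x)
        = w ?c x * along X (\<eta> i) (cinv ?c x)"
        using along_chart[OF X c x \<eta>C[OF i]] by (simp add: linear_scale)
      then show ?thesis using div[OF c x] by (simp add: u_def algebra_simps)
    qed
    ultimately show ?thesis
      unfolding chart_integral_def using open_cimg[OF c]
      by (subst (asm) set_lebesgue_integral_cong[where g = "\<lambda>x. w ?c x * u i (cinv ?c x)"]) auto
  qed
  have suppK: "v (cinv (\<kappa> j) x) * \<eta> j (cinv (\<kappa> j) x) = 0" if "j \<in> F" "x \<in> cimg (\<kappa> j) - K j" for j x and v :: "'a \<Rightarrow> real"
  proof -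
    have "cinv (\<kappa> j) x \<notin> cinv (\<kappa> j) ` K j"
      by (rule outside[OF that])
    then show ?thesis using supp[OF that(1)] cinv_topspace[OF \<kappa>[OF that(1)]] that(2) by auto
  qed
  have int: "set_integrable lborel (cimg (\<kappa> j)) (\<lambda>x. w (\<kappa> j) x * (v (cinv (\<kappa> j) x) * \<eta> j (cinv (\<kappa> j) x)))"
    if j: "j \<in> F" and v: "continuous_on (cimg (\<kappa> j)) (\<lambda>x. v (cinv (\<kappa> j) x))" for j v
    by (rule chart_integrable[OF \<kappa>[OF j] K[OF j], of "\<lambda>p. v p * \<eta> j p",
          OF continuous_on_mult[OF v \<eta>cont[OF j \<kappa>[OF j]]] suppK[OF j, where v = v]])
  have swap: "chart_integral (\<kappa> i) (\<lambda>q. u i q * \<eta> j q) = chart_integral (\<kappa> j) (\<lambda>q. u i q * \<eta> j q)"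
    and int': "set_integrable lborel (cimg (\<kappa> i)) (\<lambda>x. w (\<kappa> i) x * (u i (cinv (\<kappa> i) x) * \<eta> j (cinv (\<kappa> i) x)))"
    if i: "i \<in> F" and j: "j \<in> F" for i j
  proof -
    show "chart_integral (\<kappa> i) (\<lambda>q. u i q * \<eta> j q) = chart_integral (\<kappa> j) (\<lambda>q. u i q * \<eta> j q)"
    proof (rule chart_integral_swap[OF \<kappa>[OF i] \<kappa>[OF j]])
      show "continuous_on (cimg (\<kappa> j)) (\<lambda>x. u i (cinv (\<kappa> j) x) * \<eta> j (cinv (\<kappa> j) x))"
        by (intro continuous_on_mult ucont \<eta>cont i j \<kappa>)
      show "u i q * \<eta> j q = 0" if "q \<in> topspace T" "q \<notin> cdom (\<kappa> i) \<inter> cdom (\<kappa> j)" for q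
      proof -
        have "q \<notin> cinv (\<kappa> i) ` K i \<or> q \<notin> cinv (\<kappa> j) ` K j"
          using that(2) KD[OF i] KD[OF j] by (meson IntI subsetD)
        then have "u i q = 0 \<or> \<eta> j q = 0" using usupp[OF i that(1)] supp[OF j that(1)] by blast
        then show ?thesis by simp
      qed
      show "set_integrable lborel (cimg (\<kappa> j)) (\<lambda>x. w (\<kappa> j) x * (u i (cinv (\<kappa> j) x) * \<eta> j (cinv (\<kappa> j) x)))"
        by (rule int[OF j ucont[OF i \<kappa>[OF j]]])
    qed
    show "set_integrable lborel (cimg (\<kappa> i)) (\<lambda>x. w (\<kappa> i) x * (u i (cinv (\<kappa> i) x) * \<eta> j (cinv (\<kappa> i) x)))"
    proof (rule chart_integrable[OF \<kappa>[OF i] K[OF i], of "\<lambda>p. u i p * \<eta> j p"])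
      show "continuous_on (cimg (\<kappa> i)) (\<lambda>x. u i (cinv (\<kappa> i) x) * \<eta> j (cinv (\<kappa> i) x))"
        by (intro continuous_on_mult ucont \<eta>cont i j \<kappa>)
      show "u i (cinv (\<kappa> i) x) * \<eta> j (cinv (\<kappa> i) x) = 0" if "x \<in> cimg (\<kappa> i) - K i" for x
      proof -
        have "cinv (\<kappa> i) x \<notin> cinv (\<kappa> i) ` K i"
          by (rule outside[OF i that])
        then have "u i (cinv (\<kappa> i) x) = 0"
          using usupp[OF i cinv_topspace[OF \<kappa>[OF i]]] that by blast
        then show ?thesis by simp
      qed
    qed
  qed
  have split: "chart_integral (\<kappa> i) (u i) = (\<Sum>j\<in>F. chart_integral (\<kappa> i) (\<lambda>q. u i q * \<eta> j q))"
    if i: "i \<in> F" for i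
  proof -
    have "indicator (cimg (\<kappa> i)) x *\<^sub>R (w (\<kappa> i) x * u i (cinv (\<kappa> i) x)) =
      (\<Sum>j\<in>F. indicator (cimg (\<kappa> i)) x *\<^sub>R (w (\<kappa> i) x * (u i (cinv (\<kappa> i) x) * \<eta> j (cinv (\<kappa> i) x))))" for x
    proof (cases "x \<in> cimg (\<kappa> i)")
      case True
      then show ?thesis using one[OF cinv_topspace[OF \<kappa>[OF i] True]]
        by (simp flip: sum_distrib_left)
    qed simp
    then show ?thesis
      unfolding chart_integral_def set_lebesgue_integral_def
      using int'[OF i] by (simp add: set_integrable_def)
  qed
  have join: "chart_integral (\<kappa> j) (\<lambda>q. h q * \<eta> j q) = (\<Sum>i\<in>F. chart_integral (\<kappa> j) (\<lambda>q. u i q * \<eta> j q))"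
    if j: "j \<in> F" for j
  proof -
    have "indicator (cimg (\<kappa> j)) x *\<^sub>R (w (\<kappa> j) x * (h (cinv (\<kappa> j) x) * \<eta> j (cinv (\<kappa> j) x))) =
      (\<Sum>i\<in>F. indicator (cimg (\<kappa> j)) x *\<^sub>R (w (\<kappa> j) x * (u i (cinv (\<kappa> j) x) * \<eta> j (cinv (\<kappa> j) x))))" for x
    proof (cases "x \<in> cimg (\<kappa> j)")
      case True
      then show ?thesis using usum[OF cinv_topspace[OF \<kappa>[OF j] True]]
        by (simp flip: sum_distrib_left sum_distrib_right)
    qed simp
    then show ?thesis
      unfolding chart_integral_def set_lebesgue_integral_def
      using int[OF j ucont[OF _ \<kappa>[OF j]]] by (simp add: set_integrable_def)
  qed
  \<comment> \<open>The doubly localised pieces \<open>u i * \<eta> j\<close> may be computed in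
    either of the two charts, so the double sum can be collected by \<open>j\<close> into
    \<open>h * \<eta> j\<close> or by \<open>i\<close> into \<open>u i\<close>.\<close>
  have "(\<Sum>j\<in>F. chart_integral (\<kappa> j) (\<lambda>q. h q * \<eta> j q)) = (\<Sum>j\<in>F. \<Sum>i\<in>F. chart_integral (\<kappa> i) (\<lambda>q. u i q * \<eta> j q))"
    using join swap by simp
  also have "\<dots> = (\<Sum>i\<in>F. chart_integral (\<kappa> i) (u i))"
    by (subst sum.swap) (simp add: split)
  also have "\<dots> = 0" using uint by simp
  finally have total: "(\<Sum>j\<in>F. chart_integral (\<kappa> j) (\<lambda>q. h q * \<eta> j q)) = 0" .
  have nonneg: "w (\<kappa> j) x * (h (cinv (\<kappa> j) x) * \<eta> j (cinv (\<kappa> j) x)) \<ge> 0"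
    if "j \<in> F" "x \<in> cimg (\<kappa> j)" for j x
    using density_pos[OF \<kappa>[OF that(1)] that(2)] h(2) \<eta>0[OF that(1)] cinv_topspace[OF \<kappa>[OF that(1)] that(2)]
    by (simp add: less_imp_le)
  have "chart_integral (\<kappa> j) (\<lambda>q. h q * \<eta> j q) \<ge> 0" if "j \<in> F" for j
    unfolding chart_integral_def set_lebesgue_integral_def
    using nonneg[OF that] by (intro Bochner_Integration.integral_nonneg) (simp add: indicator_def)
  then have zero: "chart_integral (\<kappa> j) (\<lambda>q. h q * \<eta> j q) = 0" if "j \<in> F" for j
    using total sum_nonneg_eq_0_iff[OF F, of "\<lambda>j. chart_integral (\<kappa> j) (\<lambda>q. h q * \<eta> j q)"] that by blast
  have "h p * \<eta> j p = 0" if j: "j \<in> F" for j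
  proof (cases "p \<in> cinv (\<kappa> j) ` K j")
    case True
    then obtain x where x: "x \<in> cimg (\<kappa> j)" "p = cinv (\<kappa> j) x" using K(2)[OF j] by blast
    have "w (\<kappa> j) x * (h (cinv (\<kappa> j) x) * \<eta> j (cinv (\<kappa> j) x)) = 0"
    proof (rule integral_nonneg_continuous_eq_0[OF open_cimg[OF \<kappa>[OF j]] _ nonneg[OF j] int[OF j h(1)[OF \<kappa>[OF j]]] _ x(1)])
      show "continuous_on (cimg (\<kappa> j)) (\<lambda>x. w (\<kappa> j) x * (h (cinv (\<kappa> j) x) * \<eta> j (cinv (\<kappa> j) x)))"
        by (intro continuous_on_mult h(1) \<eta>cont j \<kappa> Ck_on_continuous[OF density_Ck])
    qed (use zero[OF j] in \<open>simp_all add: chart_integral_def\<close>)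
    then show ?thesis using density_pos[OF \<kappa>[OF j] x(1)] x(2) by simp
  qed (use supp[OF j p] in simp)
  then have "(\<Sum>j\<in>F. h p * \<eta> j p) = 0" by (intro sum.neutral ballI)
  then show ?thesis using one[OF p] by (simp flip: sum_distrib_left)
qed

end

end

section \<open>The quasi Einstein equation in a chart\<close>

lemma matrix_component_differentiable:
  fixes G :: "real^'n::finite \<Rightarrow> real^'m::finite^'k::finite"
  assumes "G differentiable (at x)"
  shows "((\<lambda>y. G y $ i $ j) has_derivative (\<lambda>v. frechet_derivative G (at x) v $ i $ j)) (at x)"
  using bounded_linear.has_derivative[OF bounded_linear_matrix_component] assms
  by (simp add: frechet_derivative_works)

lemma vec_component_differentiable:
  fixes X :: "real^'n::finite \<Rightarrow> real^'k::finite"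
  assumes "X differentiable (at x)"
  shows "((\<lambda>y. X y $ i) has_derivative (\<lambda>v. frechet_derivative X (at x) v $ i)) (at x)"
  using bounded_linear.has_derivative[OF bounded_linear_vec_nth] assms
  by (simp add: frechet_derivative_works)

lemma inner_matrix_vector:
  fixes M :: "real^'n::finite^'n"
  shows "v \<bullet> (M *v u) = (\<Sum>i\<in>UNIV. \<Sum>j\<in>UNIV. v $ i * (M $ i $ j * u $ j))"
  by (simp add: inner_vec_def matrix_vector_mult_def sum_distrib_left)

lemma pd_cmult:
  fixes f :: "real^'n::finite \<Rightarrow> real"
  assumes "f differentiable (at x)"
  shows "pd i (\<lambda>y. r * f y) x = r * pd i f x"
  using pd_mult[of "\<lambda>_. r" x f i] assms by (simp add: pd_def)

lemma pd_norm_square: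
  fixes G :: "real^'n::finite \<Rightarrow> real^'n^'n" and X :: "real^'n \<Rightarrow> real^'n"
  assumes G: "G differentiable (at x)" and X: "X differentiable (at x)"
  shows "pd k (\<lambda>y. X y \<bullet> (G y *v X y)) x = (\<Sum>i\<in>UNIV. \<Sum>j\<in>UNIV.
      pd k (\<lambda>y. X y $ i) x * G x $ i $ j * X x $ j
    + X x $ i * pd k (\<lambda>y. G y $ i $ j) x * X x $ j
    + X x $ i * G x $ i $ j * pd k (\<lambda>y. X y $ j) x)"
proof -
  let ?DX = "\<lambda>i v. frechet_derivative X (at x) v $ i"
  let ?DG = "\<lambda>i j v. frechet_derivative G (at x) v $ i $ j"
  have "((\<lambda>y. \<Sum>i\<in>UNIV. \<Sum>j\<in>UNIV. X y $ i * (G y $ i $ j * X y $ j)) has_derivative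
     (\<lambda>v. \<Sum>i\<in>UNIV. \<Sum>j\<in>UNIV. X x $ i * (G x $ i $ j * ?DX j v + ?DG i j v * X x $ j)
        + ?DX i v * (G x $ i $ j * X x $ j))) (at x)"
    by (intro has_derivative_sum has_derivative_mult vec_component_differentiable[OF X]
        matrix_component_differentiable[OF G])
  from has_derivative_imp_frechet[OF this] show ?thesis
    unfolding pd_def inner_matrix_vector
      has_derivative_imp_frechet[OF vec_component_differentiable[OF X]]
      has_derivative_imp_frechet[OF matrix_component_differentiable[OF G]]
    by (simp add: algebra_simps)
qed

text \<open>The invariant reason is \<open>[X, X] = 0\<close>, so that the Lie derivative of the
  metric evaluated on \<open>(X, X)\<close> is \<open>X(g(X, X))\<close>. In coordinates the three
  sums of either side agree after renaming indices.\<close>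

lemma lie_derivative_diagonal:
  fixes G :: "real^'n::finite \<Rightarrow> real^'n^'n" and X :: "real^'n \<Rightarrow> real^'n"
  assumes "G differentiable (at x)" "X differentiable (at x)"
  shows "X x \<bullet> (lie_derivative X G x *v X x)
     = (\<Sum>k\<in>UNIV. X x $ k * pd k (\<lambda>y. X y \<bullet> (G y *v X y)) x)"
proof -
  let ?X = "\<lambda>i. X x $ i" and ?G = "\<lambda>i j. G x $ i $ j"
  let ?dX = "\<lambda>k i. pd k (\<lambda>y. X y $ i) x" and ?dG = "\<lambda>k i j. pd k (\<lambda>y. G y $ i $ j) x"
  have l: "X x \<bullet> (lie_derivative X G x *v X x) =
      (\<Sum>i\<in>UNIV. \<Sum>j\<in>UNIV. \<Sum>k\<in>UNIV. ?X i * (?X k * ?dG k i j) * ?X j)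
    + (\<Sum>i\<in>UNIV. \<Sum>j\<in>UNIV. \<Sum>k\<in>UNIV. ?X i * (?dX i k * ?G k j) * ?X j)
    + (\<Sum>i\<in>UNIV. \<Sum>j\<in>UNIV. \<Sum>k\<in>UNIV. ?X i * (?dX j k * ?G i k) * ?X j)"
    by (simp add: inner_matrix_vector lie_derivative_def sum.distrib sum_distrib_left sum_distrib_right algebra_simps)
  have r: "(\<Sum>k\<in>UNIV. X x $ k * pd k (\<lambda>y. X y \<bullet> (G y *v X y)) x) =
      (\<Sum>k\<in>UNIV. \<Sum>i\<in>UNIV. \<Sum>j\<in>UNIV. ?X i * (?X k * ?dG k i j) * ?X j)
    + (\<Sum>k\<in>UNIV. \<Sum>i\<in>UNIV. \<Sum>j\<in>UNIV. ?X k * (?dX k i * ?G i j) * ?X j)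
    + (\<Sum>k\<in>UNIV. \<Sum>i\<in>UNIV. \<Sum>j\<in>UNIV. ?X i * (?dX k j * ?G i j) * ?X k)"
    by (simp add: pd_norm_square[OF assms] sum.distrib sum_distrib_left sum_distrib_right algebra_simps)
  have 1: "(\<Sum>k\<in>UNIV. \<Sum>i\<in>UNIV. \<Sum>j\<in>UNIV. ?X i * (?X k * ?dG k i j) * ?X j)
     = (\<Sum>i\<in>UNIV. \<Sum>j\<in>UNIV. \<Sum>k\<in>UNIV. ?X i * (?X k * ?dG k i j) * ?X j)"
    by (subst sum.swap) (rule sum.cong[OF refl sum.swap])
  have 2: "(\<Sum>k\<in>UNIV. \<Sum>i\<in>UNIV. \<Sum>j\<in>UNIV. ?X k * (?dX k i * ?G i j) * ?X j)
     = (\<Sum>i\<in>UNIV. \<Sum>j\<in>UNIV. \<Sum>k\<in>UNIV. ?X i * (?dX i k * ?G k j) * ?X j)"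
    by (rule sum.cong[OF refl sum.swap])
  have 3: "(\<Sum>k\<in>UNIV. \<Sum>i\<in>UNIV. \<Sum>j\<in>UNIV. ?X i * (?dX k j * ?G i j) * ?X k)
     = (\<Sum>i\<in>UNIV. \<Sum>j\<in>UNIV. \<Sum>k\<in>UNIV. ?X i * (?dX j k * ?G i k) * ?X j)"
    by (rule sum.swap)
  show ?thesis unfolding l r 1 2 3 ..
qed

text \<open>Each of the two terms with a derivative of \<open>X\<close> contains a metric entry that
  cancels against the inverse metric and leaves the coordinate divergence. What remains is the trace
  that also appears when the volume density is differentiated.\<close>

lemma trace_lie_derivative:
  fixes G :: "real^'n::finite \<Rightarrow> real^'n^'n" and X :: "real^'n \<Rightarrow> real^'n"
  assumes "det (G x) \<noteq> 0"
  shows "trace (matrix_inv (G x) ** lie_derivative X G x) =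
      (\<Sum>k\<in>UNIV. X x $ k * trace (matrix_inv (G x) ** (\<chi> i j. pd k (\<lambda>y. G y $ i $ j) x)))
      + 2 * (\<Sum>k\<in>UNIV. pd k (\<lambda>y. X y $ k) x)"
proof -
  let ?X = "\<lambda>i. X x $ i" and ?G = "\<lambda>i j. G x $ i $ j" and ?I = "\<lambda>i j. matrix_inv (G x) $ i $ j"
  let ?dX = "\<lambda>k i. pd k (\<lambda>y. X y $ i) x" and ?dG = "\<lambda>k i j. pd k (\<lambda>y. G y $ i $ j) x"
  have inv1: "(\<Sum>k\<in>UNIV. ?G i k * ?I k j) = (if i = j then 1 else 0)"
    and inv2: "(\<Sum>k\<in>UNIV. ?I i k * ?G k j) = (if i = j then 1 else 0)" for i j
    using matrix_inv_inverse[OF assms] by (simp_all add: vec_eq_iff matrix_matrix_mult_def mat_def)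
  have "trace (matrix_inv (G x) ** lie_derivative X G x) =
      (\<Sum>i\<in>UNIV. \<Sum>j\<in>UNIV. \<Sum>k\<in>UNIV. ?X k * (?I i j * ?dG k j i))
    + (\<Sum>i\<in>UNIV. \<Sum>j\<in>UNIV. \<Sum>k\<in>UNIV. ?dX j k * (?G k i * ?I i j))
    + (\<Sum>i\<in>UNIV. \<Sum>j\<in>UNIV. \<Sum>k\<in>UNIV. ?dX i k * (?I i j * ?G j k))"
    by (simp add: trace_def matrix_matrix_mult_def lie_derivative_def sum.distrib sum_distrib_left algebra_simps)
  also have "(\<Sum>i\<in>UNIV. \<Sum>j\<in>UNIV. \<Sum>k\<in>UNIV. ?X k * (?I i j * ?dG k j i))
     = (\<Sum>k\<in>UNIV. X x $ k * trace (matrix_inv (G x) ** (\<chi> i j. ?dG k i j)))"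
  proof -
    have "(\<Sum>i\<in>UNIV. \<Sum>j\<in>UNIV. \<Sum>k\<in>UNIV. ?X k * (?I i j * ?dG k j i))
      = (\<Sum>i\<in>UNIV. \<Sum>k\<in>UNIV. \<Sum>j\<in>UNIV. ?X k * (?I i j * ?dG k j i))"
      by (rule sum.cong[OF refl sum.swap])
    also have "\<dots> = (\<Sum>k\<in>UNIV. \<Sum>i\<in>UNIV. \<Sum>j\<in>UNIV. ?X k * (?I i j * ?dG k j i))"
      by (rule sum.swap)
    finally show ?thesis
      by (simp add: trace_def matrix_matrix_mult_def sum_distrib_left)
  qed
  also have "(\<Sum>i\<in>UNIV. \<Sum>j\<in>UNIV. \<Sum>k\<in>UNIV. ?dX j k * (?G k i * ?I i j)) = (\<Sum>k\<in>UNIV. ?dX k k)"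
  proof -
    have "(\<Sum>i\<in>UNIV. \<Sum>j\<in>UNIV. \<Sum>k\<in>UNIV. ?dX j k * (?G k i * ?I i j))
      = (\<Sum>j\<in>UNIV. \<Sum>i\<in>UNIV. \<Sum>k\<in>UNIV. ?dX j k * (?G k i * ?I i j))"
      by (rule sum.swap)
    also have "\<dots> = (\<Sum>j\<in>UNIV. \<Sum>k\<in>UNIV. \<Sum>i\<in>UNIV. ?dX j k * (?G k i * ?I i j))"
      by (rule sum.cong[OF refl sum.swap])
    also have "\<dots> = (\<Sum>j\<in>UNIV. \<Sum>k\<in>UNIV. ?dX j k * (if k = j then 1 else 0))"
      by (simp only: sum_distrib_left[symmetric] inv1)
    finally show ?thesis by (simp add: if_distrib cong: if_cong)
  qed
  also have "(\<Sum>i\<in>UNIV. \<Sum>j\<in>UNIV. \<Sum>k\<in>UNIV. ?dX i k * (?I i j * ?G j k)) = (\<Sum>k\<in>UNIV. ?dX k k)"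
  proof -
    have "(\<Sum>i\<in>UNIV. \<Sum>j\<in>UNIV. \<Sum>k\<in>UNIV. ?dX i k * (?I i j * ?G j k))
      = (\<Sum>i\<in>UNIV. \<Sum>k\<in>UNIV. \<Sum>j\<in>UNIV. ?dX i k * (?I i j * ?G j k))"
      by (rule sum.cong[OF refl sum.swap])
    also have "\<dots> = (\<Sum>i\<in>UNIV. \<Sum>k\<in>UNIV. ?dX i k * (if i = k then 1 else 0))"
      by (simp only: sum_distrib_left[symmetric] inv2)
    finally show ?thesis by (simp add: if_distrib cong: if_cong)
  qed
  finally show ?thesis by simp
qed

text \<open>For \<open>M\<close> the inverse metric and \<open>a\<close> the form dual to
  \<open>X\<close>, this number is the squared length of \<open>X\<close>.\<close>

lemma trace_tensor_square:
  fixes M A :: "real^'n::finite^'n"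
  shows "trace (M ** tensor_square a) = a \<bullet> (M *v a)"
  by (simp add: trace_def matrix_matrix_mult_def tensor_square_def inner_matrix_vector algebra_simps)

lemma inner_tensor_square:
  fixes a v :: "real^'n::finite"
  shows "v \<bullet> (tensor_square a *v v) = (v \<bullet> a)\<^sup>2"
  unfolding inner_matrix_vector
  by (simp add: tensor_square_def inner_vec_def power2_eq_square sum_product algebra_simps)

text \<open>The segment from the identity to \<open>A\<close> consists of matrices with positive
  quadratic form, hence with trivial kernel. The determinant starts at 1 and has no zero on the way,
  so by the intermediate value theorem it stays positive.\<close>

lemma det_pos_definite:
  fixes A :: "real^'n::finite^'n"
  assumes "\<And>v. v \<noteq> 0 \<Longrightarrow> v \<bullet> (A *v v) > 0"
  shows "det A > 0"
proof (rule ccontr)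
  assume neg: "\<not> det A > 0"
  let ?C = "\<lambda>t. (1 - t) *\<^sub>R mat 1 + t *\<^sub>R A"
  have comp: "?C t $ i $ j = (1 - t) * (mat 1 $ i $ j) + t * A $ i $ j" for t i j
    by simp
  have "continuous_on {0..1} (\<lambda>t. det (?C t))"
    unfolding det_def comp by (intro continuous_intros)
  moreover have "det (?C 1) \<le> 0" "0 \<le> det (?C 0)" using neg by simp_all
  ultimately obtain t where t: "0 \<le> t" "t \<le> 1" "det (?C t) = 0"
    using IVT2'[of "\<lambda>t. det (?C t)" 1 0 0] by auto
  then have "\<not> inj ((*v) (?C t))"
    using inj_matrix_vector_mult invertible_det_nz by (metis invertible_left_inverse matrix_left_invertible_injective)
  then obtain v where v: "v \<noteq> 0" "?C t *v v = 0"
    by (metis matrix_left_invertible_injective matrix_left_invertible_ker)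
  have "v \<bullet> (?C t *v v) = (1 - t) * (v \<bullet> v) + t * (v \<bullet> (A *v v))"
    by (simp add: matrix_vector_mult_add_rdistrib scaleR_matrix_vector_assoc[symmetric] inner_add_right)
  also have "\<dots> > 0"
  proof (cases "t = 0")
    case False
    then have "t * (v \<bullet> (A *v v)) > 0" using t assms[OF v(1)] by simp
    then show ?thesis using t by (simp add: add_nonneg_pos)
  qed (use v in simp)
  finally show False using v(2) by simp
qed

lemma (in smooth_manifold) vector_field_scaleR:
  assumes "smooth_vector_field \<A> X"
  shows "smooth_vector_field \<A> (\<lambda>c x. r *\<^sub>R X c x)"
proof -
  have "Ck_on k (\<lambda>x. r *\<^sub>R X c x) (cimg c)" if "c \<in> \<A>" for c k
    by (rule Ck_on_scaleR[OF open_cimg[OF that] Ck_on_const[OF open_cimg[OF that]]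
          smooth_onD[OF vector_field_smooth[OF assms that]]])
  then show ?thesis
    using assms by (auto simp: smooth_vector_field_def smooth_on_def matrix_vector_mult_scaleR)
qed

context riemannian_manifold
begin

context
  fixes c assumes c: "c \<in> \<A>"
begin

lemma metric_smooth: "smooth_on (g c) (cimg c)"
  using metric c by (simp add: riemannian_metric_def)

lemma metric_pos: "x \<in> cimg c \<Longrightarrow> v \<noteq> 0 \<Longrightarrow> v \<bullet> (g c x *v v) > 0"
  using metric c by (simp add: riemannian_metric_def)

lemma det_metric_pos: "x \<in> cimg c \<Longrightarrow> det (g c x) > 0"
  using metric_pos by (rule det_pos_definite)

end

lemma metric_transition:
  assumes "c \<in> \<A>" "d \<in> \<A>" "x \<in> overlap c d"
  shows "g c x = transpose (jacobian c d x) ** g d (transition c d x) ** jacobian c d x"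
  using metric assms unfolding riemannian_metric_def overlap_def by blast

lemma norm_square_transition:
  assumes X: "smooth_vector_field \<A> X" and "c \<in> \<A>" "d \<in> \<A>" "x \<in> overlap c d"
  shows "X c x \<bullet> (g c x *v X c x) = X d (transition c d x) \<bullet> (g d (transition c d x) *v X d (transition c d x))"
  unfolding metric_transition[OF assms(2-)] vector_field_transition[OF assms]
  by (simp flip: matrix_vector_mul_assoc) (metis dot_lmul_matrix inner_commute transpose_matrix_vector vector_transpose_matrix)

section \<open>The volume density and the rigidity of solutions\<close>

definition volume_density :: "('a, 'n) chart \<Rightarrow> real^'n \<Rightarrow> real" where
  "volume_density c x = sqrt (det (g c x))"

lemma is_density_volume: "is_density volume_density"
  unfolding is_density_def
proof (intro conjI ballI)
  fix c assume c: "c \<in> \<A>"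
  show "Ck_on 1 (volume_density c) (cimg c)"
    unfolding volume_density_def
    by (rule Ck_on_sqrt[OF open_cimg[OF c] det_metric_pos[OF c]
          Ck_on_det[OF open_cimg[OF c] smooth_onD[OF metric_smooth[OF c]]]])
  show "volume_density c x > 0" if "x \<in> cimg c" for x
    using det_metric_pos[OF c that] by (simp add: volume_density_def)
next
  fix c d x assume "c \<in> \<A>" "d \<in> \<A>" "x \<in> overlap c d"
  from metric_transition[OF this]
  have "det (g c x) = (det (jacobian c d x))\<^sup>2 * det (g d (transition c d x))"
    by (simp add: det_mul power2_eq_square)
  then show "volume_density c x = \<bar>det (jacobian c d x)\<bar> * volume_density d (transition c d x)"
    by (simp add: volume_density_def real_sqrt_mult)
qed

text \<open>Jacobi's formula under the square root; the factor \<open>1/2\<close> matches the one in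
  front of the Lie derivative in the quasi Einstein equation.\<close>

lemma pd_volume_density:
  assumes c: "c \<in> \<A>" and x: "x \<in> cimg c"
  shows "pd k (volume_density c) x = volume_density c x *
     ((1/2) * trace (matrix_inv (g c x) ** (\<chi> i j. pd k (\<lambda>y. g c y $ i $ j) x)))"
proof -
  let ?D = "frechet_derivative (g c) (at x)"
  have gd: "g c differentiable (at x)"
    by (rule smooth_on_differentiable[OF metric_smooth[OF c] x])
  have pos: "det (g c x) > 0" by (rule det_metric_pos[OF c x])
  have "((\<lambda>y. det (g c y)) has_derivative (\<lambda>v. det (g c x) * trace (matrix_inv (g c x) ** ?D v))) (at x)"
    by (rule has_derivative_det) (use gd pos in \<open>simp_all add: frechet_derivative_works\<close>)
  from has_derivative_imp_frechet[OF has_derivative_real_sqrt[OF pos this]]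
  have "pd k (volume_density c) x = det (g c x) * trace (matrix_inv (g c x) ** ?D (axis k 1)) * (inverse (sqrt (det (g c x))) / 2)"
    by (simp add: pd_def volume_density_def[abs_def])
  moreover have "?D (axis k 1) = (\<chi> i j. pd k (\<lambda>y. g c y $ i $ j) x)"
    by (simp add: vec_eq_iff pd_def has_derivative_imp_frechet[OF matrix_component_differentiable[OF gd]])
  moreover have "det (g c x) * inverse (sqrt (det (g c x))) = volume_density c x"
    using pos by (simp add: volume_density_def field_simps)
  ultimately show ?thesis by (simp add: algebra_simps)
qed

lemma quasi_einstein_rigidity:
  assumes comp: "compact_space T" and m: "m \<noteq> 0"
    and X: "smooth_vector_field \<A> X" and nontriv: "\<not> trivial_field \<A> X"
    and eq: "\<And>c x. c \<in> \<A> \<Longrightarrow> x \<in> cimg c \<Longrightarrow>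
      (1/2) *\<^sub>R lie_derivative (X c) (g c) x - (1/m) *\<^sub>R tensor_square (flat (g c) (X c) x) = B *\<^sub>R g c x"
  shows "CARD('n) = 1" and "\<And>c x. c \<in> \<A> \<Longrightarrow> x \<in> cimg c \<Longrightarrow> X c x \<noteq> 0"
proof -
  let ?q = "\<lambda>c x. X c x \<bullet> (g c x *v X c x)"
  define f where "f = glue ?q"
  have f: "f (cinv c x) = ?q c x" if "c \<in> \<A>" "x \<in> cimg c" for c x
    unfolding f_def by (rule glue_chart[OF that norm_square_transition[OF X that(1)]])
  have lie: "lie_derivative (X c) (g c) x = (2 * B) *\<^sub>R g c x + (2/m) *\<^sub>R tensor_square (g c x *v X c x)"
    if "c \<in> \<A>" "x \<in> cimg c" for c x
    using arg_cong[OF eq[OF that], of "\<lambda>M. 2 *\<^sub>R M"] by (simp add: flat_def algebra_simps)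
  have Xd: "X c differentiable (at x)" and gd: "g c differentiable (at x)" if "c \<in> \<A>" "x \<in> cimg c" for c x
    using that smooth_on_differentiable[OF vector_field_smooth[OF X]] smooth_on_differentiable[OF metric_smooth]
    by blast+
  have qC: "continuous_on (cimg c) (?q c)" if "c \<in> \<A>" for c
    using smooth_on_continuous[OF vector_field_smooth[OF X that]]
      smooth_on_continuous[OF metric_smooth[OF that]]
    unfolding inner_matrix_vector by (intro continuous_intros)
  \<comment> \<open>The equation is inserted into \<open>(X, X)\<close>, where the tensor square
    contributes the square of \<open>f\<close>.\<close>
  have Xf: "(\<Sum>k\<in>UNIV. X c x $ k * pd k (?q c) x) = 2 * f (cinv c x) * (f (cinv c x) / m + B)"
    if "c \<in> \<A>" "x \<in> cimg c" for c x
  proof -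
    have "X c x \<bullet> (lie_derivative (X c) (g c) x *v X c x)
       = 2 * B * ?q c x + (2/m) * (?q c x)\<^sup>2"
      by (simp add: lie[OF that] matrix_vector_mult_add_rdistrib inner_add_right inner_tensor_square
          scaleR_matrix_vector_assoc[symmetric])
    then show ?thesis
      using lie_derivative_diagonal[OF gd[OF that] Xd[OF that]] f[OF that]
      by (simp add: power2_eq_square algebra_simps)
  qed
  have div: "(\<Sum>i\<in>UNIV. pd i (\<lambda>y. volume_density c y * X c y $ i) x)
      = volume_density c x * (f (cinv c x) / m + CARD('n) * B)" if "c \<in> \<A>" "x \<in> cimg c" for c x
  proof -
    let ?w = "volume_density c" and ?I = "matrix_inv (g c x)"
    let ?dG = "\<lambda>k. \<chi> i j. pd k (\<lambda>y. g c y $ i $ j) x"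
    have nz: "det (g c x) \<noteq> 0" using det_metric_pos[OF that] by simp
    have wd: "?w differentiable (at x)" using density_Ck[OF is_density_volume that(1)] that(2) by simp
    have Xi: "(\<lambda>y. X c y $ i) differentiable (at x)" for i
      using vec_component_differentiable[OF Xd[OF that]] by (auto simp: differentiable_def)
    have tr: "trace (?I ** lie_derivative (X c) (g c) x) = 2 * (CARD('n) * B + f (cinv c x) / m)"
    proof -
      have "?I ** ((2 * B) *\<^sub>R g c x + (2/m) *\<^sub>R tensor_square (g c x *v X c x))
        = (2 * B) *\<^sub>R mat 1 + (2/m) *\<^sub>R (?I ** tensor_square (g c x *v X c x))"
      proof -
        have "?I ** (r *\<^sub>R M) = r *\<^sub>R (?I ** M)" for r and M :: "real^'n^'n"
          by (simp add: matrix_matrix_mult_def vec_eq_iff sum_distrib_left algebra_simps)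
        then show ?thesis
          by (simp only: matrix_add_ldistrib matrix_inv_inverse(2)[OF nz])
      qed
      moreover have "trace (?I ** tensor_square (g c x *v X c x)) = f (cinv c x)"
        using matrix_inv_inverse(2)[OF nz]
        by (simp add: trace_tensor_square f[OF that] matrix_vector_mul_assoc inner_commute)
      moreover have "trace (r *\<^sub>R M) = r * trace M" for r and M :: "real^'n^'n"
        by (simp add: trace_def sum_distrib_left)
      ultimately show ?thesis by (simp add: lie[OF that] trace_add trace_I algebra_simps)
    qed
    \<comment> \<open>The product rule brings in the derivative of the density; the bracket is then
      half the trace of the Lie derivative, which the equation has already evaluated in
      \<open>tr\<close>.\<close>
    have "(\<Sum>i\<in>UNIV. pd i (\<lambda>y. ?w y * X c y $ i) x) = ?w x * ((\<Sum>i\<in>UNIV. pd i (\<lambda>y. X c y $ i) x)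
        + (1/2) * (\<Sum>i\<in>UNIV. X c x $ i * trace (?I ** ?dG i)))"
      by (simp add: pd_mult[OF wd Xi] pd_volume_density[OF that] sum.distrib sum_distrib_left algebra_simps)
    also have "\<dots> = ?w x * ((1/2) * trace (?I ** lie_derivative (X c) (g c) x))"
      by (simp add: trace_lie_derivative[of "g c" x "X c", OF nz])
    finally show ?thesis by (simp add: tr algebra_simps)
  qed
  obtain p where p: "p \<in> topspace T" "\<And>q. q \<in> topspace T \<Longrightarrow> f q \<le> f p"
  proof -
    have "continuous_map T euclidean f"
      using qC f by (intro continuous_map_charts) (simp cong: continuous_on_cong)
    then have "compactin euclidean (f ` topspace T)"
      using comp by (intro image_compactin) (auto simp: compact_space_def)
    then have "compact (f ` topspace T)" by simp
    from compact_attains_sup[OF this] show ?thesis using that nonempty by blast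
  qed
  obtain c where c: "c \<in> \<A>" "p \<in> cdom c" by (rule chart_at[OF p(1)])
  let ?x = "cmap c p"
  have x: "?x \<in> cimg c" "cinv c ?x = p" using c by simp_all
  have "pd k (?q c) ?x = 0" for k
  proof -
    have "?q c differentiable (at ?x)"
      unfolding inner_matrix_vector
      using vec_component_differentiable[OF Xd[OF c(1) x(1)]] matrix_component_differentiable[OF gd[OF c(1) x(1)]]
      by (intro differentiable_sum ballI differentiable_mult finite) (auto simp: differentiable_def)
    then have "(?q c has_derivative frechet_derivative (?q c) (at ?x)) (at ?x)"
      by (simp add: frechet_derivative_works)
    moreover have "\<forall>y\<in>cimg c. ?q c y \<le> ?q c ?x"
      using p(2) f[OF c(1)] x cinv_topspace[OF c(1)] by metis
    ultimately have "frechet_derivative (?q c) (at ?x) = (\<lambda>_. 0)"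
      using differential_zero_maxmin[OF x(1) open_cimg[OF c(1)]] by blast
    then show ?thesis by (simp add: pd_def)
  qed
  \<comment> \<open>At a maximum the derivative of \<open>f\<close> along \<open>X\<close> vanishes,
    so one of the two factors in \<open>Xf\<close> is zero.\<close>
  then have crit: "f p = 0 \<or> f p = - m * B"
  proof -
    have "f p / m = - B" if "f p \<noteq> 0"
      using that Xf[OF c(1) x(1)] x(2) \<open>\<And>k. pd k (?q c) ?x = 0\<close> by (simp add: eq_neg_iff_add_eq_0)
    then show ?thesis using m by (auto simp: field_simps)
  qed
  obtain d y where d: "d \<in> \<A>" "y \<in> cimg d" "X d y \<noteq> 0" using nontriv by (auto simp: trivial_field_def)
  then have "f (cinv d y) > 0" using metric_pos f by simp
  then have "f p > 0" using p(2)[OF cinv_topspace[OF d(1,2)]] by simp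
  with crit have fp: "f p = - m * B" "m * B < 0" by simp_all
  \<comment> \<open>\<open>h\<close> is \<open>- m\<close> times the divergence of \<open>X\<close>.
    Multiplying by \<open>- m\<close> clears the denominator and leaves a quantity bounded below by
    the maximum of \<open>f\<close>, whatever the sign of \<open>m\<close>.\<close>
  define h where "h q = - (f q + CARD('n) * (m * B))" for q
  have hn: "h q \<ge> - (m * B) * (real CARD('n) - 1)" if "q \<in> topspace T" for q
    using p(2)[OF that] fp(1) by (simp add: h_def algebra_simps)
  have card1: "real CARD('n) \<ge> 1"
    by (simp add: Suc_leI)
  then have lower: "- (m * B) * (real CARD('n) - 1) \<ge> 0"
    using fp(2) by (intro mult_nonneg_nonneg) auto
  let ?Y = "\<lambda>c x. (- m) *\<^sub>R X c x"
  have h0: "h q = 0" if q: "q \<in> topspace T" for q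
  proof (rule divergence_nonneg_imp_zero[OF is_density_volume comp _ _ _ _ q, of ?Y h])
    show "smooth_vector_field \<A> ?Y"
      by (rule vector_field_scaleR[OF X])
    show "continuous_on (cimg c) (\<lambda>x. h (cinv c x))" if "c \<in> \<A>" for c
      unfolding h_def using qC[OF that] f[OF that]
      by (intro continuous_intros) (simp cong: continuous_on_cong)
    show "h p \<ge> 0" if "p \<in> topspace T" for p
      using hn[OF that] lower by linarith
    show "(\<Sum>i\<in>UNIV. pd i (\<lambda>y. volume_density c y * ?Y c y $ i) x) = volume_density c x * h (cinv c x)"
      if "c \<in> \<A>" "x \<in> cimg c" for c x
    proof -
      have "volume_density c differentiable (at x)"
        using density_Ck[OF is_density_volume that(1)] that(2) by simp
      moreover have "(\<lambda>y. X c y $ i) differentiable (at x)" for i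
        using vec_component_differentiable[OF Xd[OF that]] by (auto simp: differentiable_def)
      ultimately have "pd i (\<lambda>y. volume_density c y * ?Y c y $ i) x
        = - m * pd i (\<lambda>y. volume_density c y * X c y $ i) x" for i
        using pd_cmult[of "\<lambda>y. volume_density c y * X c y $ i" x i "- m"]
        by (simp add: differentiable_mult algebra_simps)
      then have "(\<Sum>i\<in>UNIV. pd i (\<lambda>y. volume_density c y * ?Y c y $ i) x)
        = - m * (\<Sum>i\<in>UNIV. pd i (\<lambda>y. volume_density c y * X c y $ i) x)"
        by (simp add: sum_distrib_left)
      also have "\<dots> = volume_density c x * h (cinv c x)"
        unfolding div[OF that] using m by (simp add: h_def field_simps)
      finally show ?thesis .
    qed
  qed
  \<comment> \<open>The lower bound for \<open>h\<close> is nonnegative and \<open>h\<close>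
    vanishes, so the bound itself is zero; as \<open>m * B < 0\<close>, the dimension is
    one.\<close>
  have "- (m * B) * (real CARD('n) - 1) = 0"
    using hn[OF p(1)] h0[OF p(1)] lower by linarith
  then show n1: "CARD('n) = 1" using fp(2) by auto
  fix c x assume cx: "c \<in> \<A>" "x \<in> cimg c"
  have "f (cinv c x) = - m * B"
    using h0[OF cinv_topspace[OF cx]] n1 by (simp add: h_def)
  then show "X c x \<noteq> 0" using f[OF cx] fp(2) by auto
qed

end

section \<open>Integral curves of a nonvanishing field on a one-dimensional manifold\<close>

lemma open_real_vec_image:
  fixes \<iota> :: "'n::finite"
  assumes dim: "UNIV = {\<iota>}" and "open V"
  shows "open ((vec :: real \<Rightarrow> real^'n) ` V)"
proof -
  have "vec ` V = (\<lambda>x::real^'n. x $ \<iota>) -` V"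
    using dim by (auto simp: vec_eq_iff image_iff) (metis UNIV_I singletonD)
  then show ?thesis using \<open>open V\<close> by (simp add: open_vimage_vec_nth)
qed

text \<open>The index \<open>\<iota>\<close> names the only coordinate. In a chart the field is thus
  the scalar \<open>X c x $ \<iota>\<close>, and since it has no zero its reciprocal can be
  integrated.\<close>

locale nonvanishing_field_1 = smooth_manifold T \<A>
  for T :: "'a topology" and \<A> :: "('a, 'n::finite) chart set" +
  fixes X :: "('a, 'n) vfield" and \<iota> :: 'n
  assumes dim: "UNIV = {\<iota>}"
    and X: "smooth_vector_field \<A> X"
    and nonzero: "\<And>c x. c \<in> \<A> \<Longrightarrow> x \<in> cimg c \<Longrightarrow> X c x \<noteq> 0"
begin

lemma vec_component: "vec (x $ \<iota>) = (x :: real^'n)"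
  using dim by (simp add: vec_eq_iff) (metis UNIV_I singletonD)

lemma eq_by_component: "x $ \<iota> = y $ \<iota> \<Longrightarrow> x = (y :: real^'n)"
  by (metis vec_component)

lemma component_nonzero: "c \<in> \<A> \<Longrightarrow> x \<in> cimg c \<Longrightarrow> X c x $ \<iota> \<noteq> 0"
  using nonzero eq_by_component by (metis zero_index)

lemma norm_component: "norm (x :: real^'n) = \<bar>x $ \<iota>\<bar>"
  by (simp add: norm_vec_def L2_set_def dim)

lemma continuous_field: "c \<in> \<A> \<Longrightarrow> continuous_on (cimg c) (X c)"
  by (rule smooth_on_continuous[OF vector_field_smooth[OF X]])

lemma bounded_linear_vec: "bounded_linear (vec :: real \<Rightarrow> real^'n)"
  by (intro linear_linear[THEN iffD2] linearI) (auto simp: vec_eq_iff)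

text \<open>The time that the flow needs from \<open>x0\<close> to \<open>x\<close> is the integral of \<open>1/X\<close>.\<close>

lemma local_time_1:
  assumes c: "c \<in> \<A>" and x0: "x0 \<in> cimg c"
  obtains r h where "r > 0" "h (x0 $ \<iota>) = (0::real)" "ball x0 r \<subseteq> cimg c"
    "\<And>s. \<bar>s - x0 $ \<iota>\<bar> < r \<Longrightarrow> (h has_real_derivative 1 / X c (vec s) $ \<iota>) (at s)"
proof -
  let ?a = "x0 $ \<iota>"
  obtain r where r: "r > 0" "cball x0 r \<subseteq> cimg c"
    using open_cimg[OF c] x0 open_contains_cball by metis
  let ?J = "{?a - r..?a + r}"
  have vecJ: "vec s \<in> cimg c" if "s \<in> ?J" for s
  proof -
    have "dist x0 (vec s) \<le> r" using that by (auto simp: dist_norm norm_component)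
    then show ?thesis using r(2) by auto
  qed
  have "continuous_on ?J (\<lambda>s. X c (vec s))"
    by (rule continuous_on_compose2[OF continuous_field[OF c] linear_continuous_on[OF bounded_linear_vec]])
       (use vecJ in auto)
  then have "continuous_on ?J (\<lambda>s. 1 / X c (vec s) $ \<iota>)"
    using component_nonzero[OF c vecJ] by (intro continuous_intros) auto
  from antiderivative_continuous[OF this]
  obtain H where H: "\<And>s. s \<in> ?J \<Longrightarrow> (H has_vector_derivative 1 / X c (vec s) $ \<iota>) (at s within ?J)"
    by blast
  show ?thesis
  proof (rule that[of r "\<lambda>s. H s - H ?a"])
    show "((\<lambda>s. H s - H ?a) has_real_derivative 1 / X c (vec s) $ \<iota>) (at s)" if "\<bar>s - ?a\<bar> < r" for s
    proof -
      have "s \<in> interior ?J" using that by auto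
      then have "(H has_vector_derivative 1 / X c (vec s) $ \<iota>) (at s)"
        using H[of s] interior_subset[of ?J] at_within_interior[of s ?J] by auto
      then show ?thesis
        by (auto simp: has_real_derivative_iff_has_vector_derivative intro!: derivative_eq_intros)
    qed
  qed (use r in auto)
qed

text \<open>The derivative of \<open>\<theta>\<close> along \<open>X\<close> is 1. The derivative of
  its one-variable version never vanishes, so the mean value theorem yields injectivity.\<close>

lemma local_time:
  assumes c: "c \<in> \<A>" and x0: "x0 \<in> cimg c"
  obtains U \<theta> where "open U" "x0 \<in> U" "U \<subseteq> cimg c" "\<theta> x0 = (0::real)" "inj_on \<theta> U"
    "\<And>x. x \<in> U \<Longrightarrow> (\<theta> has_derivative (\<lambda>v. v $ \<iota> / X c x $ \<iota>)) (at x)"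
proof -
  obtain r h where r: "r > 0" "ball x0 r \<subseteq> cimg c" and h: "h (x0 $ \<iota>) = (0::real)"
    "\<And>s. \<bar>s - x0 $ \<iota>\<bar> < r \<Longrightarrow> (h has_real_derivative 1 / X c (vec s) $ \<iota>) (at s)"
    by (rule local_time_1[OF assms]) blast
  have ball: "x \<in> ball x0 r \<longleftrightarrow> \<bar>x $ \<iota> - x0 $ \<iota>\<bar> < r" for x
    by (simp add: dist_norm norm_component abs_minus_commute)
  have inj: "s = t" if st: "\<bar>s - x0 $ \<iota>\<bar> < r" "\<bar>t - x0 $ \<iota>\<bar> < r" "h s = h t" for s t
  proof -
    have False if "s < t" "\<bar>s - x0 $ \<iota>\<bar> < r" "\<bar>t - x0 $ \<iota>\<bar> < r" "h s = h t" for s t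
    proof -
      have "(h has_real_derivative 1 / X c (vec z) $ \<iota>) (at z)" if "s \<le> z" "z \<le> t" for z
        using that \<open>\<bar>s - x0 $ \<iota>\<bar> < r\<close> \<open>\<bar>t - x0 $ \<iota>\<bar> < r\<close> by (intro h(2)) auto
      from MVT2[OF \<open>s < t\<close> this] obtain z where z: "s < z" "z < t"
        "h t - h s = (t - s) * (1 / X c (vec z) $ \<iota>)" by blast
      have "\<bar>vec z $ \<iota> - x0 $ \<iota>\<bar> < r" using z(1,2) that(2,3) by auto
      then have "vec z \<in> ball x0 r" using ball by blast
      then have "X c (vec z) $ \<iota> \<noteq> 0" using r(2) component_nonzero[OF c] by blast
      then show False using z(3) \<open>h s = h t\<close> \<open>s < t\<close> by simp
    qed
    then show ?thesis using st by (metis linorder_neqE_linordered_idom)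
  qed
  show ?thesis
  proof (rule that[of "ball x0 r" "\<lambda>x. h (x $ \<iota>)"])
    show "inj_on (\<lambda>x. h (x $ \<iota>)) (ball x0 r)"
    proof (rule inj_onI)
      fix x y assume "x \<in> ball x0 r" "y \<in> ball x0 r" "h (x $ \<iota>) = h (y $ \<iota>)"
      then have "x $ \<iota> = y $ \<iota>" unfolding ball by (rule inj)
      then show "x = y" by (rule eq_by_component)
    qed
    fix x assume "x \<in> ball x0 r"
    then have "\<bar>x $ \<iota> - x0 $ \<iota>\<bar> < r" using ball by blast
    from h(2)[OF this]
    have "(h has_derivative (\<lambda>s. s * (1 / X c (vec (x $ \<iota>)) $ \<iota>))) (at (x $ \<iota>))"
      unfolding has_field_derivative_def by (rule has_derivative_eq_rhs) (simp add: fun_eq_iff)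
    from has_derivative_compose[OF bounded_linear_imp_has_derivative[OF bounded_linear_vec_nth] this]
    show "((\<lambda>x. h (x $ \<iota>)) has_derivative (\<lambda>v. v $ \<iota> / X c x $ \<iota>)) (at x)"
      by (simp add: vec_component)
  qed (use r h in auto)
qed

text \<open>Derivatives are two-sided, so the notion is meant for open \<open>I\<close>. The
  equation is demanded in every chart around the point, which spares a change of charts whenever a
  curve is used.\<close>

definition integral_curve :: "(real \<Rightarrow> 'a) \<Rightarrow> real set \<Rightarrow> bool" where
  "integral_curve \<sigma> I \<longleftrightarrow> continuous_map (top_of_set I) T \<sigma> \<and>
     (\<forall>t\<in>I. \<forall>c\<in>\<A>. \<sigma> t \<in> cdom c \<longrightarrow>
       ((\<lambda>s. cmap c (\<sigma> s)) has_vector_derivative X c (cmap c (\<sigma> t))) (at t))"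

lemma integral_curve_topspace: "integral_curve \<sigma> I \<Longrightarrow> t \<in> I \<Longrightarrow> \<sigma> t \<in> topspace T"
  by (auto simp: integral_curve_def continuous_map_def)

lemma integral_curve_open:
  assumes "integral_curve \<sigma> I" "open I" "openin T U"
  shows "open {t \<in> I. \<sigma> t \<in> U}"
proof -
  have "openin (top_of_set I) {t \<in> I. \<sigma> t \<in> U}"
    using assms by (auto simp: integral_curve_def continuous_map_def)
  then show ?thesis using assms(2) openin_open_eq by blast
qed

lemma integral_curve_derivative:
  "integral_curve \<sigma> I \<Longrightarrow> t \<in> I \<Longrightarrow> c \<in> \<A> \<Longrightarrow> \<sigma> t \<in> cdom c \<Longrightarrow>
     ((\<lambda>s. cmap c (\<sigma> s)) has_vector_derivative X c (cmap c (\<sigma> t))) (at t)"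
  by (simp add: integral_curve_def)

text \<open>Both continuity and the differential equation are local in time; this is what allows
  curves to be pieced together.\<close>

lemma integral_curve_local:
  assumes "\<And>t. t \<in> I \<Longrightarrow> \<exists>J \<sigma>'. open J \<and> t \<in> J \<and> J \<subseteq> I \<and> integral_curve \<sigma>' J \<and> (\<forall>s\<in>J. \<sigma> s = \<sigma>' s)"
  shows "integral_curve \<sigma> I"
  unfolding integral_curve_def
proof (intro conjI ballI impI)
  have *: "\<exists>J. open J \<and> t \<in> J \<and> J \<subseteq> I \<and> (\<forall>s\<in>J. \<sigma> s \<in> topspace T) \<and> (\<forall>U. openin T U \<longrightarrow> open {s \<in> J. \<sigma> s \<in> U})"
    if t: "t \<in> I" for t
  proof -
    obtain J \<sigma>' where J: "open J" "t \<in> J" "J \<subseteq> I" "integral_curve \<sigma>' J" "\<And>s. s \<in> J \<Longrightarrow> \<sigma> s = \<sigma>' s"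
      using assms[OF t] by blast
    have "{s \<in> J. \<sigma> s \<in> U} = {s \<in> J. \<sigma>' s \<in> U}" for U using J(5) by auto
    then show ?thesis
      using J integral_curve_open[OF J(4,1)] integral_curve_topspace[OF J(4)] by metis
  qed
  have sub: "openin (top_of_set I) {s \<in> I. \<sigma> s \<in> U}" if U: "openin T U" for U
  proof (subst openin_subopen, intro ballI)
    fix t assume t: "t \<in> {s \<in> I. \<sigma> s \<in> U}"
    then have "t \<in> I" by simp
    from *[OF this] obtain J where J: "open J" "t \<in> J" "J \<subseteq> I"
      "\<forall>U. openin T U \<longrightarrow> open {s \<in> J. \<sigma> s \<in> U}" by blast
    then have "openin (top_of_set I) {s \<in> J. \<sigma> s \<in> U}"
      using U by (intro open_subset) auto
    then show "\<exists>V. openin (top_of_set I) V \<and> t \<in> V \<and> V \<subseteq> {s \<in> I. \<sigma> s \<in> U}"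
      using J t by (intro exI[of _ "{s \<in> J. \<sigma> s \<in> U}"]) auto
  qed
  show "continuous_map (top_of_set I) T \<sigma>"
    unfolding continuous_map_def
  proof (intro conjI allI impI)
    show "\<sigma> \<in> topspace (top_of_set I) \<rightarrow> topspace T" using * by fastforce
  qed (use sub in simp)
next
  fix t c assume t: "t \<in> I" "c \<in> \<A>" "\<sigma> t \<in> cdom c"
  obtain J \<sigma>' where J: "open J" "t \<in> J" "integral_curve \<sigma>' J" "\<And>s. s \<in> J \<Longrightarrow> \<sigma> s = \<sigma>' s"
    using assms[OF t(1)] by blast
  have "((\<lambda>s. cmap c (\<sigma>' s)) has_vector_derivative X c (cmap c (\<sigma>' t))) (at t)"
    using integral_curve_derivative[OF J(3,2) t(2)] t(3) J by simp
  from has_vector_derivative_transform_within_open[OF this J(1,2), of "\<lambda>s. cmap c (\<sigma> s)"] J(4) J(2)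
  show "((\<lambda>s. cmap c (\<sigma> s)) has_vector_derivative X c (cmap c (\<sigma> t))) (at t)"
    by simp
qed

lemma integral_curve_subset:
  "integral_curve \<sigma> I \<Longrightarrow> J \<subseteq> I \<Longrightarrow> integral_curve \<sigma> J"
  by (auto simp: integral_curve_def intro: continuous_map_from_subtopology_mono)

lemma integral_curve_shift:
  assumes "integral_curve \<sigma> I"
  shows "integral_curve (\<lambda>t. \<sigma> (t + a)) {t. t + a \<in> I}"
  unfolding integral_curve_def
proof (intro conjI ballI impI)
  have "continuous_map (top_of_set {t. t + a \<in> I}) (top_of_set I) (\<lambda>t. t + a)"
    by (auto intro!: continuous_intros)
  from continuous_map_compose[OF this, of T \<sigma>] assms
  show "continuous_map (top_of_set {t. t + a \<in> I}) T (\<lambda>t. \<sigma> (t + a))"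
    by (simp add: integral_curve_def o_def)
  fix t c assume "t \<in> {t. t + a \<in> I}" "c \<in> \<A>" "\<sigma> (t + a) \<in> cdom c"
  then have 1: "((\<lambda>s. cmap c (\<sigma> s)) has_vector_derivative X c (cmap c (\<sigma> (t + a)))) (at (t + a))"
    using integral_curve_derivative[OF assms] by simp
  have "((\<lambda>t. t + a) has_vector_derivative 1) (at t)"
    by (auto intro!: derivative_eq_intros)
  from vector_diff_chain_at[OF this 1]
  show "((\<lambda>s. cmap c (\<sigma> (s + a))) has_vector_derivative X c (cmap c (\<sigma> (t + a)))) (at t)"
    by (simp add: o_def)
qed

text \<open>Since \<open>\<theta>\<close> has derivative 1 along \<open>X\<close>, the function
  \<open>\<theta> (cmap c (\<sigma> t)) - t\<close> has zero derivative on a connected set.\<close>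

lemma time_along_curve:
  assumes \<sigma>: "integral_curve \<sigma> J" and J: "open J" "connected J" and c: "c \<in> \<A>" and U: "U \<subseteq> cimg c"
    and \<theta>: "\<And>x. x \<in> U \<Longrightarrow> (\<theta> has_derivative (\<lambda>v. v $ \<iota> / X c x $ \<iota>)) (at x)"
    and in_U: "\<And>t. t \<in> J \<Longrightarrow> \<sigma> t \<in> cinv c ` U"
    and st: "s \<in> J" "t \<in> J"
  shows "\<theta> (cmap c (\<sigma> t)) - \<theta> (cmap c (\<sigma> s)) = t - s"
proof -
  let ?y = "\<lambda>t. cmap c (\<sigma> t)"
  have y: "?y t \<in> U" "\<sigma> t \<in> cdom c" if "t \<in> J" for t
    using in_U[OF that] U cmap_cinv[OF c] cinv_cdom[OF c] by (auto simp: subset_iff)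
  have d: "((\<lambda>t. \<theta> (?y t) - t) has_derivative (\<lambda>h. 0)) (at t)" if "t \<in> J" for t
  proof -
    have "(?y has_derivative (\<lambda>h. h *\<^sub>R X c (?y t))) (at t)"
      using integral_curve_derivative[OF \<sigma> that c y(2)[OF that]] by (simp add: has_vector_derivative_def)
    from has_derivative_compose[OF this \<theta>[OF y(1)[OF that]]]
    have "((\<lambda>t. \<theta> (?y t)) has_derivative (\<lambda>h. h)) (at t)"
      using component_nonzero[OF c] y(1)[OF that] U by (simp add: subset_iff)
    from has_derivative_diff[OF this has_derivative_ident] show ?thesis by simp
  qed
  have "\<theta> (?y s) - s = \<theta> (?y t) - t"
    by (rule has_derivative_zero_unique_connected[OF J d st])
  then show ?thesis by simp
qed

text \<open>While both curves stay in the domain of an injective time function, each point is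
  determined by its time value, and both time values equal the common initial value plus
  \<open>t - t0\<close>. No Lipschitz estimate is involved.\<close>

lemma integral_curve_unique_local:
  assumes \<sigma>: "integral_curve \<sigma> I" and \<tau>: "integral_curve \<tau> I" and I: "open I" "t0 \<in> I"
    and eq: "\<sigma> t0 = \<tau> t0"
  shows "\<exists>J. open J \<and> t0 \<in> J \<and> J \<subseteq> I \<and> (\<forall>t\<in>J. \<sigma> t = \<tau> t)"
proof -
  obtain c where c: "c \<in> \<A>" "\<sigma> t0 \<in> cdom c"
    by (rule chart_at[OF integral_curve_topspace[OF \<sigma> I(2)]])
  obtain U \<theta> where U: "open U" "cmap c (\<sigma> t0) \<in> U" "U \<subseteq> cimg c" and inj: "inj_on \<theta> U"
    and \<theta>: "\<And>x. x \<in> U \<Longrightarrow> (\<theta> has_derivative (\<lambda>v. v $ \<iota> / X c x $ \<iota>)) (at x)"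
    by (rule local_time[OF c(1) cmap_cimg[OF c]]) blast
  have opU: "openin T (cinv c ` U)" by (rule openin_cinv_image[OF c(1) U(1,3)])
  have "open ({t \<in> I. \<sigma> t \<in> cinv c ` U} \<inter> {t \<in> I. \<tau> t \<in> cinv c ` U})" (is "open ?J")
    using integral_curve_open[OF \<sigma> I(1) opU] integral_curve_open[OF \<tau> I(1) opU] by blast
  moreover have "\<sigma> t0 \<in> cinv c ` U" using U(2) c by (metis cinv_cmap imageI)
  then have "t0 \<in> ?J" using eq I by auto
  ultimately obtain e where e: "e > 0" "ball t0 e \<subseteq> ?J" by (meson open_contains_ball)
  let ?B = "ball t0 e"
  have B: "open ?B" "connected ?B" "t0 \<in> ?B" "?B \<subseteq> I" using e by auto
  have *: "\<theta> (cmap c (\<rho> t)) = \<theta> (cmap c (\<rho> t0)) + (t - t0)" "cmap c (\<rho> t) \<in> U" "\<rho> t \<in> cdom c"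
    if "t \<in> ?B" "integral_curve \<rho> I" "\<And>t. t \<in> ?B \<Longrightarrow> \<rho> t \<in> cinv c ` U" for t \<rho>
  proof -
    show "\<theta> (cmap c (\<rho> t)) = \<theta> (cmap c (\<rho> t0)) + (t - t0)"
      using time_along_curve[OF integral_curve_subset[OF that(2) B(4)] B(1,2) c(1) U(3) \<theta> that(3) B(3) that(1)]
      by simp
    show "cmap c (\<rho> t) \<in> U" "\<rho> t \<in> cdom c"
      using that(3)[OF that(1)] U(3) cmap_cinv[OF c(1)] cinv_cdom[OF c(1)] by (auto simp: subset_iff)
  qed
  have "\<sigma> t = \<tau> t" if t: "t \<in> ?B" for t
  proof -
    have 1: "\<And>t. t \<in> ?B \<Longrightarrow> \<sigma> t \<in> cinv c ` U" and 2: "\<And>t. t \<in> ?B \<Longrightarrow> \<tau> t \<in> cinv c ` U"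
      using e(2) by blast+
    note s = *[OF t \<sigma> 1] and u = *[OF t \<tau> 2]
    have "\<theta> (cmap c (\<sigma> t)) = \<theta> (cmap c (\<tau> t))" using s(1) u(1) eq by simp
    then have "cmap c (\<sigma> t) = cmap c (\<tau> t)" using inj s(2) u(2) by (simp add: inj_on_eq_iff)
    then show ?thesis using s(3) u(3) c(1) by (metis cinv_cmap)
  qed
  then show ?thesis using B by blast
qed

text \<open>Agreement is open by local uniqueness, disagreement is open because the manifold is
  Hausdorff, and \<open>I\<close> is connected.\<close>

lemma integral_curve_unique:
  assumes \<sigma>: "integral_curve \<sigma> I" and \<tau>: "integral_curve \<tau> I" and I: "open I" "connected I" "t0 \<in> I"
    and eq: "\<sigma> t0 = \<tau> t0" and t: "t \<in> I"
  shows "\<sigma> t = \<tau> t"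
proof -
  let ?E = "{t \<in> I. \<sigma> t = \<tau> t}" and ?N = "{t \<in> I. \<sigma> t \<noteq> \<tau> t}"
  have "open ?E"
  proof (subst open_subopen, intro ballI)
    fix s assume "s \<in> ?E"
    then obtain J where "open J" "s \<in> J" "J \<subseteq> I" "\<forall>t\<in>J. \<sigma> t = \<tau> t"
      using integral_curve_unique_local[OF \<sigma> \<tau> I(1), of s] by auto
    then show "\<exists>V. open V \<and> s \<in> V \<and> V \<subseteq> ?E" by blast
  qed
  moreover have "open ?N"
  proof (subst open_subopen, intro ballI)
    fix s assume s: "s \<in> ?N"
    then have "\<sigma> s \<in> topspace T" "\<tau> s \<in> topspace T" "\<sigma> s \<noteq> \<tau> s"
      using integral_curve_topspace[OF \<sigma>] integral_curve_topspace[OF \<tau>] by auto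
    then obtain U V where UV: "openin T U" "openin T V" "\<sigma> s \<in> U" "\<tau> s \<in> V" "disjnt U V"
      using Hausdorff unfolding Hausdorff_space_def by blast
    have "open ({t \<in> I. \<sigma> t \<in> U} \<inter> {t \<in> I. \<tau> t \<in> V})"
      using integral_curve_open[OF \<sigma> I(1) UV(1)] integral_curve_open[OF \<tau> I(1) UV(2)] by blast
    moreover have "{t \<in> I. \<sigma> t \<in> U} \<inter> {t \<in> I. \<tau> t \<in> V} \<subseteq> ?N" using UV(5) by (auto simp: disjnt_iff)
    ultimately show "\<exists>V. open V \<and> s \<in> V \<and> V \<subseteq> ?N" using s UV by blast
  qed
  ultimately have "?E \<inter> I = {} \<or> ?N \<inter> I = {}"
    by (intro connectedD[OF I(2)]) auto
  then show ?thesis using I(3) eq t by blast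
qed

text \<open>The curve is the inverse of the local time function.\<close>

lemma flow_box:
  assumes p: "p \<in> topspace T"
  obtains e \<sigma> where "e > 0" "\<sigma> 0 = p" "integral_curve \<sigma> {-e<..<e}" "inj_on \<sigma> {-e<..<e}"
    "\<And>S. open S \<Longrightarrow> S \<subseteq> {-e<..<e} \<Longrightarrow> openin T (\<sigma> ` S)"
proof -
  obtain c where c: "c \<in> \<A>" "p \<in> cdom c" by (rule chart_at[OF p])
  let ?a = "cmap c p $ \<iota>" and ?x = "\<lambda>s. X c (vec s) $ \<iota>"
  obtain r h where r: "r > 0" "ball (cmap c p) r \<subseteq> cimg c" and h: "h ?a = (0::real)"
    "\<And>s. \<bar>s - ?a\<bar> < r \<Longrightarrow> (h has_real_derivative 1 / ?x s) (at s)"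
    by (rule local_time_1[OF c(1) cmap_cimg[OF c]]) blast
  let ?J = "ball ?a r"
  have J: "\<bar>s - ?a\<bar> < r \<longleftrightarrow> s \<in> ?J" for s by (simp add: dist_real_def abs_minus_commute)
  have vecJ: "vec s \<in> cimg c" if "s \<in> ?J" for s
    using that r(2) by (auto simp: subset_iff dist_norm norm_component dist_real_def)
  have xnz: "?x s \<noteq> 0" if "s \<in> ?J" for s using component_nonzero[OF c(1) vecJ[OF that]] .
  have xc: "continuous_on ?J ?x"
    by (intro continuous_intros continuous_on_compose2[OF continuous_field[OF c(1)] linear_continuous_on[OF bounded_linear_vec]])
       (use vecJ in auto)
  let ?h' = "\<lambda>s. blinfun_scaleR_left (1 / ?x s) :: real \<Rightarrow>\<^sub>L real"
  obtain U V k k' where UV: "open U" "U \<subseteq> ?J" "?a \<in> U" "open V" "h ?a \<in> V" "homeomorphism U V h k"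
    "\<And>y. y \<in> V \<Longrightarrow> (k has_derivative k' y) (at y)"
    "\<And>y. y \<in> V \<Longrightarrow> k' y = inv (blinfun_apply (?h' (k y)))"
  proof (rule inverse_function_theorem[of ?J h ?h' ?a "blinfun_scaleR_left (?x ?a)"])
    show "(h has_derivative blinfun_apply (?h' s)) (at s)" if "s \<in> ?J" for s
    proof -
      have "\<bar>s - ?a\<bar> < r" using that J by blast
      from h(2)[OF this] show ?thesis
        unfolding has_field_derivative_def by (rule has_derivative_eq_rhs) (simp add: fun_eq_iff)
    qed
    have "continuous_on ?J (\<lambda>s. 1 / ?x s)"
      using xc xnz by (intro continuous_on_divide continuous_on_const) auto
    then show "continuous_on ?J ?h'"
      by (rule bounded_linear.continuous_on[OF bounded_linear_blinfun_scaleR_left])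
    have "?a \<in> ?J" using r(1) by simp
    then show "blinfun_scaleR_left (?x ?a) o\<^sub>L ?h' ?a = id_blinfun"
      using xnz by (intro blinfun_eqI) simp
  qed (use r(1) in auto)
  \<comment> \<open>The derivative of the inverse \<open>k\<close> is the reciprocal of
    \<open>1/X\<close>, so \<open>k\<close> solves the differential equation of the flow.\<close>
  have k: "(k has_real_derivative ?x (k y)) (at y)" "k y \<in> U" "h (k y) = y" if "y \<in> V" for y
  proof -
    show kU: "k y \<in> U" and "h (k y) = y" using UV(6) that by (auto simp: homeomorphism_def)
    have "inv (blinfun_apply (?h' (k y))) = (\<lambda>h. h * ?x (k y))"
      using xnz[of "k y"] kU UV(2)
      by (intro inv_equality) (auto simp: subset_iff)
    then show "(k has_real_derivative ?x (k y)) (at y)"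
      using UV(7,8)[OF that] by (simp add: has_field_derivative_def mult_commute_abs)
  qed
  obtain e where e: "e > 0" "{-e<..<e} \<subseteq> V"
    using UV(4,5) h(1) open_contains_ball[of V] by (auto simp: ball_eq_greaterThanLessThan)
  let ?I = "{-e<..<e}" and ?v = "\<lambda>t. vec (k t) :: real^'n"
  let ?\<sigma> = "\<lambda>t. cinv c (?v t)"
  have kt: "t \<in> V" "k t \<in> U" "?v t \<in> cimg c" if "t \<in> ?I" for t
    using that e(2) k(2) UV(2) vecJ by blast+
  have vd: "(?v has_vector_derivative X c (?v t)) (at t)" if "t \<in> ?I" for t
  proof -
    have "(k has_vector_derivative ?x (k t)) (at t)"
      using k(1)[OF kt(1)[OF that]] by (simp add: has_real_derivative_iff_has_vector_derivative)
    from bounded_linear.has_vector_derivative[OF bounded_linear_vec this]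
    show ?thesis by (simp add: vec_component)
  qed
  have "integral_curve ?\<sigma> ?I"
    unfolding integral_curve_def
  proof (intro conjI ballI impI)
    have "continuous_on ?I ?v"
      using vd by (intro continuous_at_imp_continuous_on ballI has_vector_derivative_continuous)
    then have "continuous_map (top_of_set ?I) (top_of_set (cimg c)) ?v"
      using kt by auto
    from continuous_map_compose[OF this continuous_map_cinv[OF c(1)]]
    show "continuous_map (top_of_set ?I) T ?\<sigma>" by (simp add: o_def)
  next
    fix t d assume t: "t \<in> ?I" and d: "d \<in> \<A>" "?\<sigma> t \<in> cdom d"
    have xo: "?v t \<in> overlap c d" using d kt(3)[OF t] c(1) by (simp add: mem_overlap)
    have "(?v has_derivative (\<lambda>h. h *\<^sub>R X c (?v t))) (at t)"
      using vd[OF t] by (simp add: has_vector_derivative_def)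
    from has_derivative_compose[OF this transition_derivative[OF c(1) d(1) xo]]
    have "((\<lambda>s. transition c d (?v s)) has_vector_derivative jacobian c d (?v t) *v X c (?v t)) (at t)"
      by (simp add: has_vector_derivative_def matrix_vector_mult_scaleR)
    then show "((\<lambda>s. cmap d (?\<sigma> s)) has_vector_derivative X d (cmap d (?\<sigma> t))) (at t)"
      using vector_field_transition[OF X c(1) d(1) xo] by (simp add: transition_eq[OF c(1) d(1)])
  qed
  moreover have "?\<sigma> 0 = p"
  proof -
    have "k (h ?a) = ?a" using UV(3,6) by (auto simp: homeomorphism_def)
    then show ?thesis using h(1) c by (simp add: vec_component)
  qed
  moreover have "inj_on ?\<sigma> ?I"
  proof (rule inj_onI)
    fix s t assume st: "s \<in> ?I" "t \<in> ?I" "?\<sigma> s = ?\<sigma> t"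
    then have "?v s = ?v t" using kt(3) cmap_cinv[OF c(1)] by metis
    then have "k s = k t" by (simp add: vec_eq_iff)
    then show "s = t" using k(3) kt(1) st by metis
  qed
  moreover have "openin T (?\<sigma> ` S)" if S: "open S" "S \<subseteq> ?I" for S
  proof -
    have "k ` S = {s \<in> U. h s \<in> S}"
      using S(2) e(2) UV(6) by (auto simp: homeomorphism_def subset_iff image_iff) metis+
    moreover have "continuous_on U h" using UV(6) by (auto simp: homeomorphism_def)
    ultimately have "open (k ` S)"
      using continuous_open_preimage[of U h S] UV(1) S(1) by (simp add: Int_def vimage_def)
    then have "open (vec ` (k ` S) :: (real^'n) set)" by (rule open_real_vec_image[OF dim])
    moreover have "vec ` (k ` S) \<subseteq> cimg c" using kt(3) S(2) by auto
    ultimately have "openin T (cinv c ` (vec ` (k ` S)))" by (rule openin_cinv_image[OF c(1)])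
    then show ?thesis by (simp add: image_image)
  qed
  ultimately show ?thesis using that[of e ?\<sigma>] e(1) by blast
qed

end

section \<open>Completeness of the flow\<close>

context nonvanishing_field_1
begin

text \<open>The flow boxes are halved before a finite subcover is taken: a point reached within half
  the time of a box can still be followed for the other half in both directions. The smallest of the
  finitely many halves works everywhere.\<close>

lemma uniform_flow_time:
  assumes comp: "compact_space T"
  obtains e where "e > 0"
    "\<And>q. q \<in> topspace T \<Longrightarrow> \<exists>\<sigma>. \<sigma> 0 = q \<and> integral_curve \<sigma> {-e<..<e}"
proof -
  have "\<exists>e \<sigma>. e > 0 \<and> \<sigma> 0 = p \<and> integral_curve \<sigma> {-e<..<e} \<and>
      (\<forall>S. open S \<longrightarrow> S \<subseteq> {-e<..<e} \<longrightarrow> openin T (\<sigma> ` S))" if "p \<in> topspace T" for p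
    by (rule flow_box[OF that]) blast
  then obtain e \<sigma> where *: "\<And>p. p \<in> topspace T \<Longrightarrow> e p > 0 \<and> \<sigma> p 0 = p \<and> integral_curve (\<sigma> p) {-e p<..<e p} \<and>
      (\<forall>S. open S \<longrightarrow> S \<subseteq> {-e p<..<e p} \<longrightarrow> openin T (\<sigma> p ` S))"
    by metis
  let ?I = "\<lambda>p. {- (e p / 2)<..<e p / 2}"
  let ?W = "\<lambda>p. \<sigma> p ` ?I p"
  have "openin T (?W p)" if "p \<in> topspace T" for p
    using *[OF that] by (auto simp: subset_iff)
  then have 1: "\<forall>V\<in>?W ` topspace T. openin T V" by blast
  have "p \<in> ?W p" if "p \<in> topspace T" for p
    using *[OF that] by (intro image_eqI[of _ _ 0]) auto
  then have 2: "topspace T \<subseteq> \<Union>(?W ` topspace T)" by blast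
  obtain F' where F': "finite F'" "F' \<subseteq> ?W ` topspace T" "topspace T \<subseteq> \<Union>F'"
    using comp[unfolded compact_space_alt, rule_format, of "?W ` topspace T"] 1 2 by blast
  obtain F where F: "F \<subseteq> topspace T" "finite F" "F' = ?W ` F"
    using finite_subset_image[OF F'(1,2)] by blast
  have "F \<noteq> {}" using F(3) F'(3) nonempty by auto
  let ?e = "Min ((\<lambda>p. e p / 2) ` F)"
  show ?thesis
  proof (rule that[of ?e])
    show "?e > 0" using F(1,2) \<open>F \<noteq> {}\<close> * by (subst Min_gr_iff) auto
    fix q assume "q \<in> topspace T"
    then obtain p where p: "p \<in> F" "q \<in> ?W p" using F(3) F'(3) by blast
    then obtain s where s: "s \<in> ?I p" "q = \<sigma> p s" by blast
    have "p \<in> topspace T" using p(1) F(1) by blast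
    then have "integral_curve (\<lambda>t. \<sigma> p (t + s)) {t. t + s \<in> {-e p<..<e p}}"
      using * integral_curve_shift by blast
    moreover have "{-?e<..<?e} \<subseteq> {t. t + s \<in> {-e p<..<e p}}"
    proof -
      have "?e \<le> e p / 2" by (rule Min_le) (use F(2) p(1) in auto)
      then show ?thesis using s(1) by auto
    qed
    ultimately have "integral_curve (\<lambda>t. \<sigma> p (t + s)) {-?e<..<?e}" by (rule integral_curve_subset)
    then show "\<exists>\<sigma>. \<sigma> 0 = q \<and> integral_curve \<sigma> {-?e<..<?e}" using s(2) by (intro exI[of _ "\<lambda>t. \<sigma> p (t + s)"]) simp
  qed
qed

lemma integral_curve_union:
  assumes \<sigma>: "integral_curve \<sigma> I" and \<tau>: "integral_curve \<tau> J"
    and I: "open I" and J: "open J" and eq: "\<And>t. t \<in> I \<Longrightarrow> t \<in> J \<Longrightarrow> \<sigma> t = \<tau> t"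
  shows "integral_curve (\<lambda>t. if t \<in> I then \<sigma> t else \<tau> t) (I \<union> J)"
proof (rule integral_curve_local)
  fix t assume "t \<in> I \<union> J"
  then show "\<exists>K \<sigma>'. open K \<and> t \<in> K \<and> K \<subseteq> I \<union> J \<and> integral_curve \<sigma>' K
      \<and> (\<forall>s\<in>K. (if s \<in> I then \<sigma> s else \<tau> s) = \<sigma>' s)"
  proof
    assume "t \<in> I" then show ?thesis using \<sigma> I by (intro exI[of _ I] exI[of _ \<sigma>]) auto
  next
    assume "t \<in> J" then show ?thesis using \<tau> J eq by (intro exI[of _ J] exI[of _ \<tau>]) auto
  qed
qed

text \<open>The times reachable by some curve through \<open>p\<close> form a set containing 0 which
  is closed under steps shorter than the uniform time \<open>e\<close>. Such a set and its
  complement are both open, so every time is reachable.\<close>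

lemma complete_integral_curve:
  assumes comp: "compact_space T" and p: "p \<in> topspace T"
  obtains \<gamma> where "integral_curve \<gamma> UNIV" "\<gamma> 0 = p"
proof -
  obtain e where e: "e > 0"
    and flow: "\<And>q. q \<in> topspace T \<Longrightarrow> \<exists>\<sigma>. \<sigma> 0 = q \<and> integral_curve \<sigma> {-e<..<e}"
    by (rule uniform_flow_time[OF comp]) blast
  \<comment> \<open>Curves on bounded open intervals containing both 0 and \<open>t\<close> are
    compared; uniqueness then makes the value at \<open>t\<close> independent of the curve.\<close>
  define R where "R t q \<longleftrightarrow> (\<exists>\<sigma> a b. 0 \<in> {a<..<b} \<and> t \<in> {a<..<b} \<and> integral_curve \<sigma> {a<..<b} \<and> \<sigma> 0 = p \<and> \<sigma> t = q)"
    for t q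
  let ?S = "{t. \<exists>q. R t q}"
  have step: "s \<in> ?S" if ts: "t \<in> ?S" "\<bar>s - t\<bar> < e" for s t
  proof -
    obtain \<sigma> a b where \<sigma>: "0 \<in> {a<..<b}" "t \<in> {a<..<b}" "integral_curve \<sigma> {a<..<b}" "\<sigma> 0 = p"
      using ts(1) by (auto simp: R_def)
    obtain \<tau> where \<tau>: "\<tau> 0 = \<sigma> t" "integral_curve \<tau> {-e<..<e}"
      using flow[OF integral_curve_topspace[OF \<sigma>(3,2)]] by blast
    have "{x. x + - t \<in> {-e<..<e}} = {t - e<..<t + e}" by auto
    then have \<tau>': "integral_curve (\<lambda>x. \<tau> (x - t)) {t - e<..<t + e}"
      using integral_curve_shift[OF \<tau>(2), of "- t"] by simp
    let ?I = "{a<..<b}" and ?J = "{t - e<..<t + e}"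
    \<comment> \<open>Both sets are intervals: uniqueness needs a connected intersection, and the
      union must again be of the shape required by \<open>R\<close>.\<close>
    have IJ: "?I \<inter> ?J = {max a (t - e)<..<min b (t + e)}" "?I \<union> ?J = {min a (t - e)<..<max b (t + e)}"
      using \<sigma>(2) e by auto
    have "\<sigma> x = \<tau> (x - t)" if "x \<in> ?I" "x \<in> ?J" for x
    proof (rule integral_curve_unique[OF integral_curve_subset[OF \<sigma>(3)] integral_curve_subset[OF \<tau>']])
      show "?I \<inter> ?J \<subseteq> ?I" "?I \<inter> ?J \<subseteq> ?J" by auto
      show "open (?I \<inter> ?J)" by simp
      show "connected (?I \<inter> ?J)" unfolding IJ(1) by simp
      show "t \<in> ?I \<inter> ?J" using \<sigma>(2) e by simp
    qed (use \<tau>(1) that in auto)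
    from integral_curve_union[OF \<sigma>(3) \<tau>' _ _ this]
    have "integral_curve (\<lambda>x. if x \<in> ?I then \<sigma> x else \<tau> (x - t)) (?I \<union> ?J)" by simp
    then have "R s (if s \<in> ?I then \<sigma> s else \<tau> (s - t))"
      unfolding R_def IJ(2) using \<sigma> ts(2)
      by (intro exI[of _ "\<lambda>x. if x \<in> ?I then \<sigma> x else \<tau> (x - t)"] exI[of _ "min a (t - e)"] exI[of _ "max b (t + e)"])
         auto
    then show ?thesis by blast
  qed
  have "0 \<in> ?S"
  proof -
    obtain \<sigma> where "\<sigma> 0 = p" "integral_curve \<sigma> {-e<..<e}" using flow[OF p] by blast
    then have "R 0 p" unfolding R_def using e
      by (intro exI[of _ \<sigma>] exI[of _ "-e"] exI[of _ e]) simp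
    then show ?thesis by blast
  qed
  have "open ?S" unfolding open_dist
  proof
    fix t assume t: "t \<in> ?S"
    have "\<forall>s. dist s t < e \<longrightarrow> s \<in> ?S" using step[OF t] by (simp add: dist_real_def)
    then show "\<exists>e>0. \<forall>s. dist s t < e \<longrightarrow> s \<in> ?S" using e by blast
  qed
  moreover have "open (- ?S)" unfolding open_dist
  proof
    fix t assume t: "t \<in> - ?S"
    have "\<forall>s. dist s t < e \<longrightarrow> s \<in> - ?S"
      using step[of _ t] t by (auto simp: dist_real_def abs_minus_commute)
    then show "\<exists>e>0. \<forall>s. dist s t < e \<longrightarrow> s \<in> - ?S" using e by blast
  qed
  ultimately have "?S = UNIV" using clopen[of ?S] \<open>0 \<in> ?S\<close> by (auto simp: closed_def)
  then have ex: "\<exists>q. R t q" for t by blast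
  define \<gamma> where "\<gamma> t = (SOME q. R t q)" for t
  have R\<gamma>: "R t (\<gamma> t)" for t unfolding \<gamma>_def by (rule someI_ex[OF ex])
  \<comment> \<open>By uniqueness the chosen values agree with every curve through \<open>p\<close>,
    so the choices fit together to one curve.\<close>
  have eq: "\<gamma> s = \<sigma> s" if \<sigma>: "0 \<in> {a<..<b}" "s \<in> {a<..<b}" "integral_curve \<sigma> {a<..<b}" "\<sigma> 0 = p" for s a b \<sigma>
  proof -
    obtain \<tau> a' b' where \<tau>: "0 \<in> {a'<..<b'}" "s \<in> {a'<..<b'}" "integral_curve \<tau> {a'<..<b'}" "\<tau> 0 = p" "\<tau> s = \<gamma> s"
      using R\<gamma>[of s] unfolding R_def by blast
    let ?K = "{a<..<b} \<inter> {a'<..<b'}"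
    have K: "?K = {max a a'<..<min b b'}" by auto
    have "\<sigma> s = \<tau> s"
    proof (rule integral_curve_unique[OF integral_curve_subset[OF \<sigma>(3)] integral_curve_subset[OF \<tau>(3)]])
      show "connected ?K" unfolding K by simp
      show "0 \<in> ?K" using \<sigma>(1) \<tau>(1) by simp
    qed (use \<sigma> \<tau> in auto)
    then show ?thesis using \<tau>(5) by simp
  qed
  have "integral_curve \<gamma> UNIV"
  proof (rule integral_curve_local)
    fix t
    obtain \<sigma> a b where \<sigma>: "0 \<in> {a<..<b}" "t \<in> {a<..<b}" "integral_curve \<sigma> {a<..<b}" "\<sigma> 0 = p"
      using R\<gamma>[of t] unfolding R_def by blast
    then show "\<exists>J \<sigma>'. open J \<and> t \<in> J \<and> J \<subseteq> UNIV \<and> integral_curve \<sigma>' J \<and> (\<forall>s\<in>J. \<gamma> s = \<sigma>' s)"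
      using eq by (intro exI[of _ "{a<..<b}"] exI[of _ \<sigma>]) auto
  qed
  moreover have "\<gamma> 0 = p" using R\<gamma>[of 0] unfolding R_def using eq by metis
  ultimately show ?thesis by (rule that)
qed

section \<open>The orbit of a complete curve and its period\<close>

context
  fixes \<gamma> assumes \<gamma>: "integral_curve \<gamma> UNIV"
begin

lemma curve_shift: "integral_curve (\<lambda>t. \<gamma> (t + a)) UNIV"
  using integral_curve_shift[OF \<gamma>, of a] by simp

lemma curve_topspace: "\<gamma> t \<in> topspace T"
  by (rule integral_curve_topspace[OF \<gamma>]) simp

lemma curve_flow_box:
  assumes "\<sigma> 0 = \<gamma> t" "integral_curve \<sigma> {-e<..<e}" "\<bar>s\<bar> < e"
  shows "\<gamma> (t + s) = \<sigma> s"
proof -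
  have s: "s \<in> {-e<..<e}" using assms(3) by auto
  have 0: "0 \<in> {-e<..<e}" using assms(3) by auto
  have "\<gamma> (s + t) = \<sigma> s"
    by (rule integral_curve_unique[OF integral_curve_subset[OF curve_shift] assms(2) _ _ 0 _ s])
       (use assms(1) in auto)
  then show ?thesis by (simp add: add.commute)
qed

text \<open>Near each time the curve coincides with a flow box, whose images of open sets are
  open.\<close>

lemma curve_open_map:
  assumes "open S"
  shows "openin T (\<gamma> ` S)"
proof (subst openin_subopen, intro ballI)
  fix q assume "q \<in> \<gamma> ` S"
  then obtain t where t: "t \<in> S" "q = \<gamma> t" by blast
  obtain e \<sigma> where \<sigma>: "e > 0" "\<sigma> 0 = \<gamma> t" "integral_curve \<sigma> {-e<..<e}"
    "\<And>S. open S \<Longrightarrow> S \<subseteq> {-e<..<e} \<Longrightarrow> openin T (\<sigma> ` S)"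
    by (rule flow_box[OF curve_topspace]) blast
  obtain d where d: "d > 0" "ball t d \<subseteq> S" using assms t(1) open_contains_ball by blast
  let ?d = "min d e"
  have "openin T (\<sigma> ` {-?d<..<?d})" by (rule \<sigma>(4)) auto
  moreover have "\<sigma> ` {-?d<..<?d} \<subseteq> \<gamma> ` S"
  proof
    fix r assume "r \<in> \<sigma> ` {-?d<..<?d}"
    then obtain s where "s \<in> {-?d<..<?d}" "r = \<sigma> s" by blast
    then have s: "\<bar>s\<bar> < ?d" "r = \<sigma> s" by auto
    then have "r = \<gamma> (t + s)" using curve_flow_box[OF \<sigma>(2,3)] by simp
    moreover have "t + s \<in> S" using d(2) s(1) by (auto simp: subset_iff dist_real_def)
    ultimately show "r \<in> \<gamma> ` S" by blast
  qed
  moreover have "q \<in> \<sigma> ` {-?d<..<?d}" using t(2) \<sigma>(1,2) d(1) by (intro image_eqI[of _ _ 0]) auto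
  ultimately show "\<exists>V. openin T V \<and> q \<in> V \<and> V \<subseteq> \<gamma> ` S" by blast
qed

text \<open>The orbit is open. So is its complement: if a flow box around \<open>q\<close> met the
  orbit, uniqueness would put \<open>q\<close> itself on the orbit. Connectedness of the manifold
  leaves no complement.\<close>

lemma curve_surj: "range \<gamma> = topspace T"
proof -
  have o: "openin T (range \<gamma>)" by (rule curve_open_map) simp
  have "openin T (topspace T - range \<gamma>)"
  proof (subst openin_subopen, intro ballI)
    fix q assume q: "q \<in> topspace T - range \<gamma>"
    obtain e \<sigma> where \<sigma>: "e > 0" "\<sigma> 0 = q" "integral_curve \<sigma> {-e<..<e}"
      "\<And>S. open S \<Longrightarrow> S \<subseteq> {-e<..<e} \<Longrightarrow> openin T (\<sigma> ` S)"
      using q by (auto intro: flow_box[of q])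
    have "\<sigma> s \<notin> range \<gamma>" if s: "s \<in> {-e<..<e}" for s
    proof
      assume "\<sigma> s \<in> range \<gamma>"
      then obtain t where t: "\<sigma> s = \<gamma> t" by blast
      have "\<sigma> 0 = \<gamma> (0 + (t - s))"
        by (rule integral_curve_unique[OF \<sigma>(3) integral_curve_subset[OF curve_shift] _ _ s])
           (use t \<sigma>(1) in auto)
      then show False using q \<sigma>(2) by auto
    qed
    then have "\<sigma> ` {-e<..<e} \<inter> range \<gamma> = {}" by blast
    moreover have "openin T (\<sigma> ` {-e<..<e})" by (rule \<sigma>(4)) auto
    moreover note openin_subset[OF this]
    moreover have "q \<in> \<sigma> ` {-e<..<e}" using \<sigma>(1,2) by (intro image_eqI[of _ _ 0]) auto
    ultimately show "\<exists>V. openin T V \<and> q \<in> V \<and> V \<subseteq> topspace T - range \<gamma>"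
      by (intro exI[of _ "\<sigma> ` {-e<..<e}"] conjI) auto
  qed
  then have "closedin T (range \<gamma>)" using o openin_subset by (auto simp: closedin_def)
  with o show ?thesis using connected unfolding connected_space_clopen_in by blast
qed

text \<open>Two time shifts of the curve agree at one instant, hence always, since the field does
  not depend on time.\<close>

lemma curve_periodic:
  assumes "\<gamma> a = \<gamma> b"
  shows "\<gamma> (t + a) = \<gamma> (t + b)"
  using integral_curve_unique[OF curve_shift[of a] curve_shift[of b], of 0 t] assms by simp

text \<open>The images of the intervals from \<open>- n\<close> to \<open>n\<close> form an
  increasing open cover, so one of them is already the whole manifold. A point reached at a later
  time must therefore have been passed before.\<close>

lemma curve_not_inj:
  assumes comp: "compact_space T"
  shows "\<exists>a b. a < b \<and> \<gamma> a = \<gamma> b"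
proof -
  let ?W = "\<lambda>n::nat. \<gamma> ` {-real n<..<real n}"
  have 1: "\<forall>V\<in>range ?W. openin T V" by (auto intro!: curve_open_map)
  have W: "\<gamma> t \<in> \<Union>(range ?W)" for t
  proof -
    obtain n where "\<bar>t\<bar> < real n" using reals_Archimedean2 by blast
    then have "\<gamma> t \<in> ?W n" by (intro imageI) auto
    then show ?thesis by blast
  qed
  have 2: "topspace T \<subseteq> \<Union>(range ?W)"
    unfolding curve_surj[symmetric] by (rule image_subsetI) (rule W)
  obtain F' where F': "finite F'" "F' \<subseteq> range ?W" "topspace T \<subseteq> \<Union>F'"
    using comp[unfolded compact_space_alt, rule_format, of "range ?W"] 1 2 by blast
  obtain N where N: "finite N" "F' = ?W ` N"
    using finite_subset_image[OF F'(1,2)] by blast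
  obtain k where k: "\<And>n. n \<in> N \<Longrightarrow> n \<le> k"
    using N(1) by (auto simp: finite_nat_set_iff_bounded_le)
  have "\<gamma> (real k + 1) \<in> \<Union>F'" by (rule subsetD[OF F'(3) curve_topspace])
  then obtain n where n: "n \<in> N" "\<gamma> (real k + 1) \<in> ?W n" unfolding N(2) by (elim UnionE imageE) simp
  then obtain s where ns: "n \<in> N" "s \<in> {-real n<..<real n}" "\<gamma> (real k + 1) = \<gamma> s"
    by (elim imageE)
  have "real n \<le> real k" using k[OF ns(1)] by simp
  then have "s < real k + 1" using ns(2) by simp
  then show ?thesis using ns(3) by metis
qed

text \<open>Injectivity on a flow box bounds all positive periods below by \<open>e\<close>. As the
  difference of two periods is a period, distinct ones are at least \<open>e\<close> apart, and a
  smallest one exists.\<close>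

lemma minimal_period:
  assumes comp: "compact_space T"
  obtains L where "L > 0" "\<And>a b. \<gamma> a = \<gamma> b \<longleftrightarrow> (\<exists>k::int. a = b + of_int k * L)"
proof -
  obtain e \<sigma> where \<sigma>: "e > 0" "\<sigma> 0 = \<gamma> 0" "integral_curve \<sigma> {-e<..<e}" "inj_on \<sigma> {-e<..<e}"
    by (rule flow_box[OF curve_topspace]) blast
  let ?P = "{L. L > 0 \<and> \<gamma> L = \<gamma> 0}"
  have diff: "\<gamma> (b - a) = \<gamma> 0" if "\<gamma> a = \<gamma> b" for a b
    using curve_periodic[OF that, of "- a"] by simp
  have ge: "L \<ge> e" if L: "L \<in> ?P" for L
  proof (rule ccontr)
    assume "\<not> L \<ge> e"
    then have "\<gamma> (0 + L) = \<sigma> L" using curve_flow_box[OF \<sigma>(2,3), of L] L by simp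
    then have "\<sigma> L = \<sigma> 0" using L \<sigma>(2) by simp
    then show False using \<sigma>(1,4) L \<open>\<not> L \<ge> e\<close> by (auto dest: inj_onD)
  qed
  obtain a b where "a < b" "\<gamma> a = \<gamma> b" using curve_not_inj[OF comp] by blast
  then have ne: "b - a \<in> ?P" using diff by simp
  have bdd: "bdd_below ?P" using ge by (intro bdd_belowI)
  \<comment> \<open>A period within \<open>e\<close> of the infimum is already minimal: a smaller
    one would differ from it by less than \<open>e\<close>.\<close>
  obtain L where L: "L \<in> ?P" "L < Inf ?P + e"
    using cInf_lessD[of ?P "Inf ?P + e"] ne \<sigma>(1) by (metis (lifting) empty_iff less_add_same_cancel1)
  have min: "L \<le> L'" if L': "L' \<in> ?P" for L'
  proof (rule ccontr)
    assume "\<not> L \<le> L'"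
    then have "L - L' \<in> ?P" using diff[of L' L] L L' by simp
    then have "L - L' \<ge> e" by (rule ge)
    moreover have "Inf ?P \<le> L'" by (rule cInf_lower[OF L' bdd])
    ultimately show False using L(2) by simp
  qed
  have per: "\<gamma> (t + of_int k * L) = \<gamma> t" for t and k :: int
  proof -
    have nat: "\<gamma> (t + of_nat n * L) = \<gamma> t" for t and n :: nat
    proof (induction n)
      case (Suc n)
      have "\<gamma> (t + of_nat n * L + L) = \<gamma> (t + of_nat n * L + 0)"
        by (rule curve_periodic) (use L in simp)
      then show ?case using Suc by (simp add: algebra_simps)
    qed simp
    show ?thesis
    proof (cases k rule: int_cases2)
      case (nonneg n) then show ?thesis using nat by simp
    next
      case (nonpos n) then show ?thesis using nat[of "t + of_int k * L" n] by simp
    qed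
  qed
  show ?thesis
  proof (rule that[of L])
    show "L > 0" using L by simp
    fix a b
    show "\<gamma> a = \<gamma> b \<longleftrightarrow> (\<exists>k::int. a = b + of_int k * L)"
    proof
      assume ab: "\<gamma> a = \<gamma> b"
      \<comment> \<open>The remainder of \<open>a - b\<close> modulo \<open>L\<close> is a period or
        zero; by minimality of \<open>L\<close> it is zero.\<close>
      define k where "k = \<lfloor>(a - b) / L\<rfloor>"
      have "L > 0" using L by simp
      then have r: "0 \<le> a - b - of_int k * L" "a - b - of_int k * L < L"
      proof -
        have "of_int k \<le> (a - b) / L" "(a - b) / L < of_int k + 1" by (simp_all add: k_def)
        then have "of_int k * L \<le> a - b" "a - b < (of_int k + 1) * L"
          using \<open>L > 0\<close> by (simp_all only: pos_le_divide_eq pos_divide_less_eq)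
        then show "0 \<le> a - b - of_int k * L" "a - b - of_int k * L < L"
          by (simp_all add: algebra_simps)
      qed
      have "\<gamma> (a - b - of_int k * L) = \<gamma> 0"
        using per[of "a - b" "- k"] diff[of b a] ab by simp
      then have "a - b - of_int k * L = 0"
        using min[of "a - b - of_int k * L"] r by force
      then show "\<exists>k::int. a = b + of_int k * L" by (intro exI[of _ k]) simp
    qed (use per in auto)
  qed
qed

end

end

section \<open>The diffeomorphism with the circle\<close>

lemma cis_eq_cis_iff: "cis x = cis y \<longleftrightarrow> (\<exists>k::int. x = y + 2 * pi * of_int k)"
proof
  assume "cis x = cis y"
  then have "sin x = sin y \<and> cos x = cos y" by (simp add: complex_eq_iff)
  then show "\<exists>k::int. x = y + 2 * pi * of_int k" using sin_cos_eq_iff[of x y] by auto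
next
  assume "\<exists>k::int. x = y + 2 * pi * of_int k"
  then have "sin x = sin y \<and> cos x = cos y" using sin_cos_eq_iff[of x y] by auto
  then show "cis x = cis y" by (simp add: complex_eq_iff)
qed

text \<open>On the unit circle \<open>Arg\<close> is the imaginary part of \<open>Ln\<close>, and
  the logarithmic derivative of \<open>cis t / a\<close> is the constant
  \<open>\<i>\<close>.\<close>

lemma Arg_cis_derivative:
  assumes a: "norm a = 1" and w: "cis t / a \<notin> \<real>\<^sub>\<le>\<^sub>0"
  shows "((\<lambda>t. Arg (cis t / a)) has_real_derivative 1) (at t)"
proof -
  have "a \<noteq> 0" using a by auto
  let ?F = "\<lambda>t. cis t / a"
  have "((\<lambda>t. exp (\<i> * of_real t) / a) has_vector_derivative \<i> * (exp (\<i> * of_real t) / a)) (at t)"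
    using \<open>a \<noteq> 0\<close>
    by (auto intro!: derivative_eq_intros has_vector_derivative_real_field simp: field_simps)
  then have "(?F has_vector_derivative \<i> * ?F t) (at t)" by (simp add: cis_conv_exp)
  from field_vector_diff_chain_at[OF this has_field_derivative_Ln[OF w]]
  have "((\<lambda>t. Ln (?F t)) has_vector_derivative \<i>) (at t)"
    using \<open>a \<noteq> 0\<close> by (simp add: o_def)
  then have "((\<lambda>t. Im (Ln (?F t))) has_vector_derivative 1) (at t)"
    using bounded_linear.has_vector_derivative[OF bounded_linear_Im] by fastforce
  moreover have "Im (Ln (?F t)) = Arg (?F t)" for t
    using \<open>a \<noteq> 0\<close> by (simp add: Arg_eq_Im_Ln)
  ultimately show ?thesis by (simp add: has_real_derivative_iff_has_vector_derivative)
qed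

lemma smooth_onI:
  assumes "open S" "\<And>x. x \<in> S \<Longrightarrow> (f has_derivative f' x) (at x)"
    and "\<And>k v. Ck_on k (\<lambda>x. f' x v) S"
  shows "smooth_on f S"
  unfolding smooth_on_def using Ck_on_lower[OF Ck_on_SucI[OF assms]] by blast

context nonvanishing_field_1
begin

context
  fixes \<gamma> L
  assumes \<gamma>: "integral_curve \<gamma> UNIV"
    and L: "L > 0" and period: "\<And>a b. \<gamma> a = \<gamma> b \<longleftrightarrow> (\<exists>k::int. a = b + of_int k * L)"
begin

text \<open>A local time function, shifted by a time \<open>t0\<close> at which the curve is at the
  given point, inverts the curve. Such a \<open>t0\<close> exists because the curve is onto.\<close>

lemma curve_local_inverse:
  assumes c: "c \<in> \<A>" and x: "x \<in> cimg c"
  obtains U \<theta> where "open U" "x \<in> U" "U \<subseteq> cimg c"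
    "\<And>y. y \<in> U \<Longrightarrow> (\<theta> has_derivative (\<lambda>v. v $ \<iota> / X c y $ \<iota>)) (at y)"
    "\<And>y. y \<in> U \<Longrightarrow> \<gamma> (\<theta> y) = cinv c y"
proof -
  obtain U \<theta> where U: "open U" "x \<in> U" "U \<subseteq> cimg c" and inj: "inj_on \<theta> U" and "\<theta> x = (0::real)"
    and \<theta>: "\<And>y. y \<in> U \<Longrightarrow> (\<theta> has_derivative (\<lambda>v. v $ \<iota> / X c y $ \<iota>)) (at y)"
    by (rule local_time[OF c x]) blast
  have "cinv c x \<in> range \<gamma>" using curve_surj[OF \<gamma>] cinv_topspace[OF c x] by simp
  then obtain t0 where t0: "\<gamma> t0 = cinv c x" by auto
  have "open {t \<in> UNIV. \<gamma> t \<in> cinv c ` U}"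
    by (rule integral_curve_open[OF \<gamma> open_UNIV openin_cinv_image[OF c U(1,3)]])
  moreover have "t0 \<in> {t \<in> UNIV. \<gamma> t \<in> cinv c ` U}" using t0 U(2) by auto
  ultimately obtain d where d: "d > 0" "ball t0 d \<subseteq> {t \<in> UNIV. \<gamma> t \<in> cinv c ` U}"
    by (meson open_contains_ball)
  \<comment> \<open>On this interval of times the curve stays in the domain of
    \<open>\<theta>\<close>, so \<open>\<theta>\<close> measures elapsed time. The neighbourhood is
    therefore shrunk to the image of the interval, which is open.\<close>
  let ?B = "ball t0 d" and ?V = "cmap c ` \<gamma> ` ball t0 d"
  have in_U: "\<gamma> t \<in> cinv c ` U" if "t \<in> ?B" for t using d(2) that by blast
  have dom: "\<gamma> t \<in> cdom c" "cmap c (\<gamma> t) \<in> U" if "t \<in> ?B" for t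
    using in_U[OF that] U(3) cmap_cinv[OF c] cinv_cdom[OF c] by (auto simp: subset_iff)
  have "open ?V"
    by (rule open_cmap_image[OF c curve_open_map[OF \<gamma>]]) (use dom in auto)
  moreover have "x \<in> ?V"
    using t0 d(1) cmap_cinv[OF c x] by (intro image_eqI[of _ _ "cinv c x"] image_eqI[of _ _ t0]) auto
  moreover have "?V \<subseteq> U" using dom by auto
  moreover have "\<gamma> (\<theta> y + t0) = cinv c y" if "y \<in> ?V" for y
  proof -
    obtain t where t: "t \<in> ?B" "y = cmap c (\<gamma> t)" using \<open>y \<in> ?V\<close> by blast
    have "\<theta> (cmap c (\<gamma> t)) - \<theta> (cmap c (\<gamma> t0)) = t - t0"
      by (rule time_along_curve[where J = ?B, OF integral_curve_subset[OF \<gamma>] _ _ c U(3) \<theta> in_U])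
         (use t(1) d(1) in auto)
    then have "\<theta> y + t0 = t" using t(2) t0 \<open>\<theta> x = 0\<close> cmap_cinv[OF c x] by simp
    then show ?thesis using t dom(1)[OF t(1)] c by simp
  qed
  moreover have "((\<lambda>y. \<theta> y + t0) has_derivative (\<lambda>v. v $ \<iota> / X c y $ \<iota>)) (at y)" if "y \<in> U" for y
    using has_derivative_add[OF \<theta>[OF that] has_derivative_const[of t0]] by simp
  ultimately show ?thesis
    using U(3) by (intro that[of ?V "\<lambda>y. \<theta> y + t0"]) blast+
qed

text \<open>Any time at which the curve is at \<open>p\<close> serves: two of them differ by a
  multiple of \<open>L\<close>, so the angles differ by a multiple of \<open>2 * pi\<close>.\<close>

definition to_circle :: "'a \<Rightarrow> complex" where
  "to_circle p = cis (2 * pi / L * (SOME t. \<gamma> t = p))"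

definition from_circle :: "complex \<Rightarrow> 'a" where
  "from_circle z = \<gamma> (L / (2 * pi) * Arg z)"

lemma to_circle_curve: "to_circle (\<gamma> t) = cis (2 * pi / L * t)"
proof -
  have "\<gamma> (SOME s. \<gamma> s = \<gamma> t) = \<gamma> t" by (rule someI) simp
  then obtain k :: int where "(SOME s. \<gamma> s = \<gamma> t) = t + of_int k * L" using period by blast
  then have "2 * pi / L * (SOME s. \<gamma> s = \<gamma> t) = 2 * pi / L * t + 2 * pi * of_int k"
    using L by (simp add: field_simps)
  then show ?thesis unfolding to_circle_def using cis_eq_cis_iff by blast
qed

text \<open>The jump of \<open>Arg\<close> across its cut corresponds to a full period of the curve.
  Hence in every rotated angle chart the map is the curve after an affine change of time, with no
  cut left.\<close>

lemma from_circle_cis: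
  assumes "norm a = 1"
  shows "from_circle (a * cis u) = \<gamma> (L / (2 * pi) * (u + Arg a))"
proof -
  have "a \<noteq> 0" using assms by auto
  then have "cis (Arg (a * cis u)) = cis (u + Arg a)"
    using assms cis_Arg[of a] cis_Arg[of "a * cis u"]
    by (simp add: sgn_div_norm norm_mult cis_mult[symmetric] mult.commute)
  then obtain k :: int where "Arg (a * cis u) = u + Arg a + 2 * pi * of_int k"
    using cis_eq_cis_iff by blast
  then have "L / (2 * pi) * Arg (a * cis u) = L / (2 * pi) * (u + Arg a) + of_int k * L"
    by (simp add: field_simps)
  then show ?thesis unfolding from_circle_def using period by blast
qed

lemma from_to_circle: "p \<in> topspace T \<Longrightarrow> from_circle (to_circle p) = p"
proof -
  assume "p \<in> topspace T"
  then have "p \<in> range \<gamma>" using curve_surj[OF \<gamma>] by simp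
  then obtain t where "p = \<gamma> t" by auto
  then show ?thesis
    using from_circle_cis[of 1 "2 * pi / L * t"] L by (simp add: to_circle_curve)
qed

lemma to_from_circle: "norm z = 1 \<Longrightarrow> to_circle (from_circle z) = z"
  using L cis_Arg[of z] by (force simp: from_circle_def to_circle_curve sgn_div_norm)

lemma continuous_to_circle_chart:
  assumes c: "c \<in> \<A>"
  shows "continuous_on (cimg c) (\<lambda>x. to_circle (cinv c x))"
proof -
  have "Ck_on 0 (\<lambda>x. to_circle (cinv c x)) (cimg c)"
  proof (rule Ck_on_local)
    fix x assume "x \<in> cimg c"
    then obtain U \<theta> where U: "open U" "x \<in> U" "U \<subseteq> cimg c"
      "\<And>y. y \<in> U \<Longrightarrow> (\<theta> has_derivative (\<lambda>v. v $ \<iota> / X c y $ \<iota>)) (at y)"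
      "\<And>y. y \<in> U \<Longrightarrow> \<gamma> (\<theta> y) = cinv c y"
      by (rule curve_local_inverse[OF c]) blast
    have "continuous_on U \<theta>"
      by (rule has_derivative_continuous_on[OF has_derivative_at_withinI[OF U(4)]])
    then have "continuous_on U (\<lambda>y. cis (2 * pi / L * \<theta> y))" by (intro continuous_intros)
    then have "continuous_on U (\<lambda>y. to_circle (cinv c y))"
      by (rule continuous_on_eq) (metis U(5) to_circle_curve)
    then show "\<exists>U. open U \<and> x \<in> U \<and> Ck_on 0 (\<lambda>x. to_circle (cinv c x)) U" using U(1,2) by auto
  qed
  then show ?thesis by simp
qed

text \<open>Locally the map is \<open>cis\<close> of a multiple of a time function, so in an angle
  chart its derivative is a constant multiple of \<open>1/X\<close>. All orders of smoothness are
  read off from this formula and the smoothness of \<open>X\<close>.\<close>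

lemma smooth_to_circle: "smooth_map T \<A> circle circle_atlas to_circle"
  unfolding smooth_map_def
proof (intro conjI ballI)
  have norm1: "norm (to_circle p) = 1" for p by (simp add: to_circle_def)
  show "continuous_map T circle to_circle"
    by (rule continuous_map_charts) (use continuous_to_circle_chart norm1 in auto)
  fix c d assume c: "c \<in> \<A>" and "d \<in> circle_atlas"
  then obtain a where d: "d = angle_chart a" "norm a = 1" by (auto simp: circle_atlas_def)
  let ?S = "cmap c ` (cdom c \<inter> to_circle -` cdom d)"
  let ?f = "cmap d \<circ> to_circle \<circ> cinv c"
  have S: "?S = cimg c \<inter> (\<lambda>x. to_circle (cinv c x)) -` (- {-a})"
  proof (intro set_eqI iffI)
    fix x assume "x \<in> cimg c \<inter> (\<lambda>x. to_circle (cinv c x)) -` (- {-a})"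
    then show "x \<in> ?S"
      using c norm1 d by (intro image_eqI[of _ _ "cinv c x"]) (auto simp: cdom_angle)
  qed (use c d in \<open>auto simp: cdom_angle\<close>)
  have "open (- {-a})" by (intro open_Compl closed_singleton)
  then have op: "open ?S"
    unfolding S by (rule continuous_open_preimage[OF continuous_to_circle_chart[OF c] open_cimg[OF c]])
  have bl: "bounded_linear (vec :: real \<Rightarrow> real^1)"
    by (intro linear_linear[THEN iffD2] linearI) (auto simp: vec_eq_iff)
  show "smooth_on ?f ?S"
  proof (rule smooth_onI[OF op])
    fix x assume x: "x \<in> ?S"
    then have "x \<in> cimg c" using c by auto
    then obtain U \<theta> where U: "open U" "x \<in> U" "U \<subseteq> cimg c"
      "\<And>y. y \<in> U \<Longrightarrow> (\<theta> has_derivative (\<lambda>v. v $ \<iota> / X c y $ \<iota>)) (at y)"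
      "\<And>y. y \<in> U \<Longrightarrow> \<gamma> (\<theta> y) = cinv c y"
      by (rule curve_local_inverse[OF c]) blast
    have FU: "to_circle (cinv c y) = cis (2 * pi / L * \<theta> y)" if "y \<in> U" for y
      using U(5)[OF that] to_circle_curve by metis
    have "to_circle (cinv c x) \<in> cdom d" using x c by auto
    then have "cis (2 * pi / L * \<theta> x) / a \<notin> \<real>\<^sub>\<le>\<^sub>0"
      using cdom_angleD[OF d(2)] d(1) FU[OF U(2)] by metis
    from Arg_cis_derivative[OF d(2) this]
    have A: "((\<lambda>t. Arg (cis t / a)) has_derivative (\<lambda>h. h)) (at (2 * pi / L * \<theta> x))"
      unfolding has_field_derivative_def by (rule has_derivative_eq_rhs) (simp add: fun_eq_iff)
    have "((\<lambda>y. 2 * pi / L * \<theta> y) has_derivative (\<lambda>v. 2 * pi / L * (v $ \<iota> / X c x $ \<iota>))) (at x)"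
      by (rule has_derivative_mult_right[OF U(4)[OF U(2)]])
    from has_derivative_compose[OF this A]
    have "((\<lambda>y. Arg (cis (2 * pi / L * \<theta> y) / a)) has_derivative (\<lambda>v. 2 * pi / L * (v $ \<iota> / X c x $ \<iota>))) (at x)" .
    from bounded_linear.has_derivative[OF bl this] have "((\<lambda>y. vec (Arg (cis (2 * pi / L * \<theta> y) / a)) :: real^1) has_derivative
        (\<lambda>v. vec (2 * pi / L * (v $ \<iota> / X c x $ \<iota>)))) (at x)" .
    then show "(?f has_derivative (\<lambda>v. vec (2 * pi / L * (v $ \<iota> / X c x $ \<iota>)))) (at x)"
      by (rule has_derivative_transform_within_open[OF _ U(1,2)]) (simp add: d(1) cmap_angle FU)
  next
    fix k v
    have sub: "?S \<subseteq> cimg c" unfolding S by blast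
    have Xk: "Ck_on k (\<lambda>x. X c x $ \<iota>) ?S"
      by (rule Ck_on_subset[OF Ck_on_vec_component[OF open_cimg[OF c] smooth_onD[OF vector_field_smooth[OF X c]]] sub])
    have "Ck_on k (\<lambda>x. (2 * pi / L * v $ \<iota>) / X c x $ \<iota>) ?S"
      by (rule Ck_on_divide[OF op _ Ck_on_const[OF op] Xk]) (use component_nonzero[OF c subsetD[OF sub]] in simp)
    from Ck_on_bounded_linear_compose[OF op bl this]
    show "Ck_on k (\<lambda>x. vec (2 * pi / L * (v $ \<iota> / X c x $ \<iota>)) :: real^1) ?S" by simp
  qed
qed

text \<open>Bootstrapping along the differential equation: the derivative of the curve in a chart is
  a constant times \<open>X\<close> evaluated on the curve, so regularity of order \<open>k\<close>
  of the curve gives order \<open>k + 1\<close>.\<close>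

lemma smooth_from_circle: "smooth_map circle circle_atlas T \<A> from_circle"
  unfolding smooth_map_def
proof (intro conjI ballI)
  have chart: "\<exists>a. d = angle_chart a \<and> norm a = 1" if "d \<in> circle_atlas" for d
    using that by (auto simp: circle_atlas_def)
  define l where "l a x = L / (2 * pi) * (x $ 1 + Arg a)" for a and x :: "real^1"
  have fc: "from_circle (cinv (angle_chart a) x) = \<gamma> (l a x)" if "norm a = 1" "x \<in> cimg (angle_chart a)" for a x
    using from_circle_cis[OF that(1)] cinv_angle[OF that] by (simp add: l_def)
  have lc: "continuous_on A (l a)" for A a unfolding l_def by (intro continuous_intros)
  show cont: "continuous_map circle T from_circle"
  proof (rule smooth_manifold.continuous_map_charts[OF circle_smooth_manifold])
    fix d assume "d \<in> circle_atlas"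
    then obtain a where d: "d = angle_chart a" "norm a = 1" using chart by blast
    have "continuous_map (top_of_set (cimg d)) (top_of_set UNIV) (l a)" using lc by simp
    moreover have "continuous_map (top_of_set UNIV) T \<gamma>" using \<gamma> by (simp add: integral_curve_def)
    ultimately have "continuous_map (top_of_set (cimg d)) T (\<gamma> \<circ> l a)" by (rule continuous_map_compose)
    then show "continuous_map (top_of_set (cimg d)) T (\<lambda>x. from_circle (cinv d x))"
      by (rule continuous_map_eq) (use fc[OF d(2)] d(1) in simp)
  qed
  fix d c assume da: "d \<in> circle_atlas" and c: "c \<in> \<A>"
  obtain a where d: "d = angle_chart a" "norm a = 1" using chart[OF da] by blast
  let ?S = "cmap d ` (cdom d \<inter> from_circle -` cdom c)"
  let ?y = "\<lambda>x. cmap c (\<gamma> (l a x))"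
  note cm = circle_smooth_manifold
  have op: "open ?S"
  proof (rule smooth_manifold.open_cmap_image[OF cm da])
    have "openin circle {z \<in> topspace circle. from_circle z \<in> cdom c}"
      by (rule openin_continuous_map_preimage[OF cont openin_cdom[OF c]])
    moreover have "cdom d \<inter> from_circle -` cdom c = cdom d \<inter> {z \<in> topspace circle. from_circle z \<in> cdom c}"
      using smooth_manifold.cdom_subset[OF cm da] by auto
    ultimately show "openin circle (cdom d \<inter> from_circle -` cdom c)"
      using smooth_manifold.openin_cdom[OF cm da] by auto
  qed auto
  have S: "x \<in> cimg d" "\<gamma> (l a x) \<in> cdom c" if x: "x \<in> ?S" for x
  proof -
    obtain z where z: "z \<in> cdom d" "from_circle z \<in> cdom c" "x = cmap d z" using x by blast
    then show xd: "x \<in> cimg d" by (simp add: cimg_def)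
    have "cinv d x = z" using z smooth_manifold.cinv_cmap[OF cm da] by simp
    then show "\<gamma> (l a x) \<in> cdom c" using z(2) fc[OF d(2)] xd d(1) by metis
  qed
  have yd: "(?y has_derivative (\<lambda>v. (L / (2 * pi) * v $ 1) *\<^sub>R X c (?y x))) (at x)" if "x \<in> ?S" for x
  proof -
    have "((\<lambda>s. cmap c (\<gamma> s)) has_derivative (\<lambda>h. h *\<^sub>R X c (?y x))) (at (l a x))"
      using integral_curve_derivative[OF \<gamma> UNIV_I c S(2)[OF that]] by (simp add: has_vector_derivative_def)
    moreover have "(l a has_derivative (\<lambda>v. L / (2 * pi) * v $ 1)) (at x)"
      unfolding l_def
      by (auto intro!: derivative_eq_intros bounded_linear_imp_has_derivative bounded_linear_vec_nth)
    ultimately show ?thesis using has_derivative_compose by blast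
  qed
  have "Ck_on k ?y ?S" for k
  proof (induction k)
    case 0
    show ?case using has_derivative_continuous_on[OF has_derivative_at_withinI[OF yd]] by simp
  next
    case (Suc k)
    show ?case
    proof (rule Ck_on_SucI[OF op yd])
      fix v :: "real^1"
      have "Ck_on k (\<lambda>x. X c (?y x)) ?S"
        by (rule Ck_on_compose[OF op open_cimg[OF c] _ smooth_onD[OF vector_field_smooth[OF X c]] Suc])
           (use S(2) c in auto)
      then show "Ck_on k (\<lambda>x. (L / (2 * pi) * v $ 1) *\<^sub>R X c (?y x)) ?S"
        by (rule Ck_on_scaleR[OF op Ck_on_const[OF op]])
    qed
  qed
  moreover have "(cmap c \<circ> from_circle \<circ> cinv d) x = ?y x" if "x \<in> ?S" for x
    using fc[OF d(2)] S(1)[OF that] d(1) by simp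
  ultimately show "smooth_on (cmap c \<circ> from_circle \<circ> cinv d) ?S"
    unfolding smooth_on_def using Ck_on_cong[OF op, of "cmap c \<circ> from_circle \<circ> cinv d" ?y] by blast
qed

end

lemma diffeomorphic_circle:
  assumes comp: "compact_space T"
  shows "diffeomorphic T \<A> circle circle_atlas"
proof -
  obtain p where "p \<in> topspace T" using nonempty by blast
  then obtain \<gamma> where \<gamma>: "integral_curve \<gamma> UNIV" by (rule complete_integral_curve[OF comp])
  obtain L where L: "L > 0" "\<And>a b. \<gamma> a = \<gamma> b \<longleftrightarrow> (\<exists>k::int. a = b + of_int k * L)"
    by (rule minimal_period[OF \<gamma> comp]) blast
  note * = \<gamma> L
  show ?thesis unfolding diffeomorphic_def
  proof (intro exI conjI ballI)
    show "smooth_map T \<A> circle circle_atlas (to_circle \<gamma> L)" by (rule smooth_to_circle[OF *])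
    show "smooth_map circle circle_atlas T \<A> (from_circle \<gamma> L)" by (rule smooth_from_circle[OF *])
    show "from_circle \<gamma> L (to_circle \<gamma> L p) = p" if "p \<in> topspace T" for p
      by (rule from_to_circle[OF * that])
    show "to_circle \<gamma> L (from_circle \<gamma> L q) = q" if "q \<in> topspace circle" for q
      by (rule to_from_circle[OF *]) (use that in simp)
  qed
qed

end

section \<open>The unit field of a circle\<close>

context smooth_manifold
begin

context
  fixes F :: "'a \<Rightarrow> complex" and G
  assumes F: "smooth_map T \<A> circle circle_atlas F" and G: "smooth_map circle circle_atlas T \<A> G"
    and GF: "\<And>p. p \<in> topspace T \<Longrightarrow> G (F p) = p"
begin

definition circle_coord :: "complex \<Rightarrow> ('a, 'n) chart \<Rightarrow> real^'n \<Rightarrow> real^1" where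
  "circle_coord a c = cmap (angle_chart a) \<circ> F \<circ> cinv c"

definition circle_coord_dom :: "complex \<Rightarrow> ('a, 'n) chart \<Rightarrow> (real^'n) set" where
  "circle_coord_dom a c = cmap c ` (cdom c \<inter> F -` cdom (angle_chart a))"

lemma F_circle: "p \<in> topspace T \<Longrightarrow> norm (F p) = 1"
  using F by (auto simp: smooth_map_def continuous_map_def)

context
  fixes a c assumes a: "angle_chart a \<in> circle_atlas" "norm a = 1" and c: "c \<in> \<A>"
begin

lemma mem_circle_coord_dom: "x \<in> circle_coord_dom a c \<longleftrightarrow> x \<in> cimg c \<and> F (cinv c x) \<in> cdom (angle_chart a)"
  using c unfolding circle_coord_dom_def by (force simp: image_iff)

lemma open_circle_coord_dom: "open (circle_coord_dom a c)"
  unfolding circle_coord_dom_def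
proof (rule open_cmap_image[OF c])
  have "openin T {p \<in> topspace T. F p \<in> cdom (angle_chart a)}"
    using F smooth_manifold.openin_cdom[OF circle_smooth_manifold a(1)]
    by (auto simp: smooth_map_def continuous_map_def)
  moreover have "cdom c \<inter> F -` cdom (angle_chart a) = cdom c \<inter> {p \<in> topspace T. F p \<in> cdom (angle_chart a)}"
    using cdom_subset[OF c] by auto
  ultimately show "openin T (cdom c \<inter> F -` cdom (angle_chart a))"
    using openin_cdom[OF c] by auto
qed auto

lemma circle_coord_smooth: "smooth_on (circle_coord a c) (circle_coord_dom a c)"
  using F a(1) c by (simp add: smooth_map_def circle_coord_def circle_coord_dom_def)

lemma circle_coord_derivative:
  "x \<in> circle_coord_dom a c \<Longrightarrow>
     (circle_coord a c has_derivative frechet_derivative (circle_coord a c) (at x)) (at x)"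
  by (rule smooth_on_has_derivative[OF circle_coord_smooth])

lemma F_circle_coord:
  assumes "x \<in> circle_coord_dom a c"
  shows "F (cinv c x) = a * cis (circle_coord a c x $ 1)"
  using assms angle_left[OF a(2)] by (simp add: mem_circle_coord_dom circle_coord_def)

text \<open>Differentiating \<open>G (F p) = p\<close> in charts shows that the derivative of the
  coordinate expression of \<open>F\<close> has a left inverse.\<close>

lemma circle_coord_immersion:
  assumes x: "x \<in> circle_coord_dom a c" and v: "frechet_derivative (circle_coord a c) (at x) v = 0"
  shows "v = 0"
proof -
  let ?f = "circle_coord a c" and ?h = "cmap c \<circ> G \<circ> cinv (angle_chart a)"
  have f: "?f y \<in> cmap (angle_chart a) ` (cdom (angle_chart a) \<inter> G -` cdom c)" "?h (?f y) = y"
    if y: "y \<in> circle_coord_dom a c" for y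
  proof -
    have p: "y \<in> cimg c" "F (cinv c y) \<in> cdom (angle_chart a)" using y by (simp_all add: mem_circle_coord_dom)
    have g: "G (F (cinv c y)) = cinv c y" by (rule GF[OF cinv_topspace[OF c p(1)]])
    then show "?f y \<in> cmap (angle_chart a) ` (cdom (angle_chart a) \<inter> G -` cdom c)"
      using p c unfolding circle_coord_def by (auto intro!: imageI)
    show "?h (?f y) = y"
      using p g c smooth_manifold.cinv_cmap[OF circle_smooth_manifold a(1) p(2)]
      by (simp add: circle_coord_def)
  qed
  have "smooth_on ?h (cmap (angle_chart a) ` (cdom (angle_chart a) \<inter> G -` cdom c))"
    using G a(1) c by (simp add: smooth_map_def)
  from smooth_on_has_derivative[OF this f(1)[OF x]]
  have "(?h has_derivative frechet_derivative ?h (at (?f x))) (at (?f x))" .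
  from has_derivative_compose[OF circle_coord_derivative[OF x] this]
  have "((\<lambda>y. ?h (?f y)) has_derivative (\<lambda>v. frechet_derivative ?h (at (?f x)) (frechet_derivative ?f (at x) v))) (at x)" .
  moreover have "((\<lambda>y. ?h (?f y)) has_derivative (\<lambda>v. v)) (at x)"
    by (rule has_derivative_transform_within_open[OF has_derivative_ident open_circle_coord_dom x])
       (simp only: f(2))
  ultimately have eq: "(\<lambda>v. frechet_derivative ?h (at (?f x)) (frechet_derivative ?f (at x) v)) = (\<lambda>v. v)"
    by (rule has_derivative_unique)
  have "linear (frechet_derivative ?h (at (?f x)))"
    by (rule has_derivative_linear) fact
  then show ?thesis using fun_cong[OF eq, of v] v by (simp add: linear_0)
qed

end

lemma circle_coord_at:
  assumes c: "c \<in> \<A>" and x: "x \<in> cimg c"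
  obtains a where "angle_chart a \<in> circle_atlas" "norm a = 1" "x \<in> circle_coord_dom a c"
proof -
  have "F (cinv c x) \<in> topspace circle"
    using F_circle[OF cinv_topspace[OF c x]] by simp
  then obtain d where "d \<in> circle_atlas" "F (cinv c x) \<in> cdom d"
    by (rule smooth_manifold.chart_at[OF circle_smooth_manifold])
  moreover from this(1) have "\<exists>a. d = angle_chart a \<and> norm a = 1" by (auto simp: circle_atlas_def)
  ultimately obtain a where "angle_chart a \<in> circle_atlas" "norm a = 1" "F (cinv c x) \<in> cdom (angle_chart a)"
    by metis
  then show ?thesis using that mem_circle_coord_dom[OF _ _ c] x by blast
qed

text \<open>The derivative of \<open>F\<close> in coordinates is an injective linear map into
  \<open>real^1\<close>; two distinct coordinate directions would give it a kernel.\<close>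

lemma dimension_1: "CARD('n) = 1"
proof -
  obtain p where "p \<in> topspace T" using nonempty by blast
  then obtain c where c: "c \<in> \<A>" "p \<in> cdom c" by (rule chart_at)
  obtain a where a: "angle_chart a \<in> circle_atlas" "norm a = 1" "cmap c p \<in> circle_coord_dom a c"
    by (rule circle_coord_at[OF c(1) cmap_cimg[OF c]])
  let ?D = "frechet_derivative (circle_coord a c) (at (cmap c p))"
  have lin: "linear ?D"
    by (rule has_derivative_linear[OF circle_coord_derivative[OF a(1,2) c(1) a(3)]])
  have "i = j" for i j :: 'n
  proof (rule ccontr)
    assume "i \<noteq> j"
    let ?b = "\<lambda>k. ?D (axis k 1) $ 1"
    \<comment> \<open>This combination is chosen to lie in the kernel. Injectivity makes its
      coefficients vanish, and then a coordinate vector lies in the kernel too.\<close>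
    have "?D (?b j *\<^sub>R axis i 1 - ?b i *\<^sub>R axis j 1) = 0"
      by (simp add: linear_diff[OF lin] linear_scale[OF lin] vec_eq_iff)
    then have z: "?b j *\<^sub>R axis i 1 - ?b i *\<^sub>R axis j (1::real) = 0"
      by (rule circle_coord_immersion[OF a(1,2) c(1) a(3)])
    have "?b j = 0" using arg_cong[OF z, of "\<lambda>v. v $ i"] \<open>i \<noteq> j\<close> by (simp add: axis_def)
    then have "?D (axis j 1) = 0" by (simp add: vec_eq_iff)
    then have "axis j (1::real) = 0" by (rule circle_coord_immersion[OF a(1,2) c(1) a(3)])
    then show False by (simp add: axis_eq_0_iff)
  qed
  then have "(UNIV :: 'n set) = {undefined}" by auto
  from arg_cong[OF this, of card] show ?thesis by simp
qed

text \<open>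
  For \<open>F\<close> with values in the unit circle, \<open>Im (cnj F * dF)\<close> is the pullback of the angular form
  \<open>d\<phi>\<close>; its sign orients the manifold.
\<close>

definition angular :: "('a, 'n) chart \<Rightarrow> real^'n \<Rightarrow> real^'n \<Rightarrow> real" where
  "angular c x v = Im (cnj (F (cinv c x)) * frechet_derivative (\<lambda>y. F (cinv c y)) (at x) v)"

lemma F_chart_derivative:
  assumes a: "angle_chart a \<in> circle_atlas" "norm a = 1" and c: "c \<in> \<A>" and x: "x \<in> circle_coord_dom a c"
  shows "((\<lambda>y. F (cinv c y)) has_derivative
    (\<lambda>v. of_real (frechet_derivative (circle_coord a c) (at x) v $ 1) * (\<i> * F (cinv c x)))) (at x)"
proof -
  let ?t = "circle_coord a c x $ 1" and ?D = "frechet_derivative (circle_coord a c) (at x)"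
  have "((\<lambda>t. a * exp (\<i> * of_real t)) has_vector_derivative \<i> * (a * exp (\<i> * of_real ?t))) (at ?t)"
    by (auto intro!: derivative_eq_intros has_vector_derivative_real_field simp: field_simps)
  then have "((\<lambda>t. a * cis t) has_derivative (\<lambda>h. h *\<^sub>R (\<i> * (a * cis ?t)))) (at ?t)"
    by (simp add: cis_conv_exp has_vector_derivative_def)
  moreover have "((\<lambda>y. circle_coord a c y $ 1) has_derivative (\<lambda>v. ?D v $ 1)) (at x)"
    by (rule bounded_linear.has_derivative[OF bounded_linear_vec_nth circle_coord_derivative[OF a c x]])
  ultimately have "((\<lambda>y. a * cis (circle_coord a c y $ 1)) has_derivative (\<lambda>v. (?D v $ 1) *\<^sub>R (\<i> * (a * cis ?t)))) (at x)"
    using has_derivative_compose by blast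
  then have "((\<lambda>y. F (cinv c y)) has_derivative (\<lambda>v. (?D v $ 1) *\<^sub>R (\<i> * (a * cis ?t)))) (at x)"
    by (rule has_derivative_transform_within_open[OF _ open_circle_coord_dom[OF a c] x])
       (simp add: F_circle_coord[OF a c])
  then show ?thesis by (simp add: F_circle_coord[OF a c x] scaleR_conv_of_real)
qed

text \<open>Writing \<open>F = a * cis t\<close> gives \<open>dF = \<i> * F * dt\<close>, and
  \<open>|F| = 1\<close> reduces \<open>cnj F * dF\<close> to \<open>\<i> * dt\<close>. The
  definition of \<open>angular\<close> does not mention \<open>a\<close>, so the forms obtained from
  the two angle charts agree.\<close>

lemma angular_circle_coord:
  assumes a: "angle_chart a \<in> circle_atlas" "norm a = 1" and c: "c \<in> \<A>" and x: "x \<in> circle_coord_dom a c"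
  shows "angular c x v = frechet_derivative (circle_coord a c) (at x) v $ 1"
proof -
  have "x \<in> cimg c" using x by (simp add: mem_circle_coord_dom[OF a c])
  then have "cnj (F (cinv c x)) * F (cinv c x) = 1"
    using F_circle[OF cinv_topspace[OF c]] complex_norm_square[of "F (cinv c x)"]
    by (simp add: mult.commute)
  moreover have "cnj (F (cinv c x)) * (of_real r * (\<i> * F (cinv c x)))
     = of_real r * \<i> * (cnj (F (cinv c x)) * F (cinv c x))" for r
    by (simp only: mult_ac)
  ultimately have "cnj (F (cinv c x)) * (of_real r * (\<i> * F (cinv c x))) = of_real r * \<i>" for r
    by (simp only: mult_1_right)
  then show ?thesis
    unfolding angular_def has_derivative_imp_frechet[OF F_chart_derivative[OF assms]]
    by (simp only: Im_complex_of_real Re_complex_of_real times_complex.simps imaginary_unit.simps)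
qed

lemma angular_transition:
  assumes c: "c \<in> \<A>" and d: "d \<in> \<A>" and x: "x \<in> overlap c d"
  shows "angular c x v = angular d (transition c d x) (jacobian c d x *v v)"
proof -
  let ?t = "transition c d"
  have td: "?t x \<in> cimg d" using transition_overlap(1)[OF c d x] mem_overlap[OF d c] by blast
  obtain a where a: "angle_chart a \<in> circle_atlas" "norm a = 1" "?t x \<in> circle_coord_dom a d"
    by (rule circle_coord_at[OF d td])
  have "((\<lambda>y. F (cinv d y)) has_derivative frechet_derivative (\<lambda>y. F (cinv d y)) (at (?t x))) (at (?t x))"
    using F_chart_derivative[OF a(1,2) d a(3)] has_derivative_imp_frechet by metis
  from has_derivative_compose[OF transition_derivative[OF c d x] this]
  have "((\<lambda>y. F (cinv c y)) has_derivative
     (\<lambda>v. frechet_derivative (\<lambda>y. F (cinv d y)) (at (?t x)) (jacobian c d x *v v))) (at x)"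
    by (rule has_derivative_transform_within_open[OF _ open_overlap[OF c d] x])
       (simp add: cinv_transition[OF c d])
  from has_derivative_imp_frechet[OF this] show ?thesis
    by (simp add: angular_def cinv_transition[OF c d x])
qed

lemma angular_nonzero:
  assumes c: "c \<in> \<A>" and x: "x \<in> cimg c" and v: "v \<noteq> 0"
  shows "angular c x v \<noteq> 0"
proof
  assume 0: "angular c x v = 0"
  obtain a where a: "angle_chart a \<in> circle_atlas" "norm a = 1" "x \<in> circle_coord_dom a c"
    by (rule circle_coord_at[OF c x])
  have "frechet_derivative (circle_coord a c) (at x) v = 0"
    using 0 by (simp add: angular_circle_coord[OF a(1,2) c a(3)] vec_eq_iff)
  then show False using circle_coord_immersion[OF a(1,2) c a(3)] v by blast
qed

lemma continuous_angular:
  assumes c: "c \<in> \<A>"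
  shows "continuous_on (cimg c) (\<lambda>x. angular c x v)"
proof -
  have "Ck_on 0 (\<lambda>x. angular c x v) (cimg c)"
  proof (rule Ck_on_local)
    fix x assume "x \<in> cimg c"
    then obtain a where a: "angle_chart a \<in> circle_atlas" "norm a = 1" "x \<in> circle_coord_dom a c"
      by (rule circle_coord_at[OF c])
    have "Ck_on 1 (circle_coord a c) (circle_coord_dom a c)"
      by (rule smooth_onD[OF circle_coord_smooth[OF a(1,2) c]])
    then have "continuous_on (circle_coord_dom a c) (\<lambda>x. frechet_derivative (circle_coord a c) (at x) v $ 1)"
      by (auto intro: continuous_intros)
    then have "continuous_on (circle_coord_dom a c) (\<lambda>x. angular c x v)"
      by (rule continuous_on_eq) (simp add: angular_circle_coord[OF a(1,2) c])
    then show "\<exists>U. open U \<and> x \<in> U \<and> Ck_on 0 (\<lambda>x. angular c x v) U"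
      using a(3) open_circle_coord_dom[OF a(1,2) c] by auto
  qed
  then show ?thesis by simp
qed

end

end

section \<open>The unit field of a Riemannian circle\<close>

context riemannian_manifold
begin

context
  fixes F :: "'a \<Rightarrow> complex" and G and \<iota> :: 'n
  assumes F: "smooth_map T \<A> circle circle_atlas F" and G: "smooth_map circle circle_atlas T \<A> G"
    and GF: "\<And>p. p \<in> topspace T \<Longrightarrow> G (F p) = p"
    and dim: "UNIV = {\<iota>}"
begin

text \<open>The square root of the metric component normalises the length; the sign of the pulled
  back angular form selects the same direction in all charts.\<close>

definition unit_speed :: "('a, 'n) chart \<Rightarrow> real^'n \<Rightarrow> real" where
  "unit_speed c x = sgn (angular F c x (axis \<iota> 1)) / sqrt (g c x $ \<iota> $ \<iota>)"

definition unit_field :: "('a, 'n) vfield" where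
  "unit_field c x = unit_speed c x *\<^sub>R axis \<iota> 1"

lemma all_index: "(\<forall>i. P i) \<longleftrightarrow> P \<iota>" for P :: "'n \<Rightarrow> bool"
  using dim by (metis UNIV_I singletonD)

lemma metric_component_pos: "c \<in> \<A> \<Longrightarrow> x \<in> cimg c \<Longrightarrow> g c x $ \<iota> $ \<iota> > 0"
  using metric_pos[of c x "axis \<iota> 1"] by (simp add: axis_eq_0_iff inner_matrix_vector dim)

lemma angular_axis_nonzero: "c \<in> \<A> \<Longrightarrow> x \<in> cimg c \<Longrightarrow> angular F c x (axis \<iota> 1) \<noteq> 0"
  by (rule angular_nonzero[OF F G GF]) (simp_all add: axis_eq_0_iff)

lemma unit_speed_square:
  assumes "c \<in> \<A>" "x \<in> cimg c"
  shows "unit_speed c x * unit_speed c x * g c x $ \<iota> $ \<iota> = 1"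
proof -
  have "(sgn (angular F c x (axis \<iota> 1)))\<^sup>2 = 1"
    using angular_axis_nonzero[OF assms] by (simp add: sgn_if)
  then show ?thesis
    using metric_component_pos[OF assms]
    by (simp add: unit_speed_def field_simps flip: power2_eq_square)
qed

text \<open>The angular form is continuous and has no zero on coordinate vectors, so its sign is
  locally constant and only the metric factor has to be differentiated.\<close>

lemma Ck_on_unit_speed:
  assumes c: "c \<in> \<A>"
  shows "Ck_on k (unit_speed c) (cimg c)"
proof (rule Ck_on_local)
  fix x assume x: "x \<in> cimg c"
  let ?w = "\<lambda>x. angular F c x (axis \<iota> 1)"
  let ?U = "{y \<in> cimg c. ?w y * ?w x > 0}"
  have "continuous_on (cimg c) (\<lambda>y. ?w y * ?w x)"
    by (intro continuous_on_mult continuous_on_const continuous_angular[OF F G GF c])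
  from continuous_open_preimage[OF this open_cimg[OF c], of "{0<..}"]
  have op: "open ?U" by (simp add: Int_def vimage_def)
  have sgn: "sgn (?w y) = sgn (?w x)" if "y \<in> ?U" for y
    using that by (auto simp: zero_less_mult_iff)
  have gk: "Ck_on k (\<lambda>y. g c y $ \<iota> $ \<iota>) ?U"
    by (rule Ck_on_matrix_component[OF op Ck_on_subset[OF smooth_onD[OF metric_smooth[OF c]]]]) auto
  have "Ck_on k (\<lambda>y. sgn (?w x) / sqrt (g c y $ \<iota> $ \<iota>)) ?U"
  proof (rule Ck_on_divide[OF op _ Ck_on_const[OF op] Ck_on_sqrt[OF op _ gk]])
    fix y assume "y \<in> ?U"
    then show "g c y $ \<iota> $ \<iota> > 0" "sqrt (g c y $ \<iota> $ \<iota>) \<noteq> 0" using metric_component_pos[OF c] by force+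
  qed
  then have "Ck_on k (unit_speed c) ?U"
    using Ck_on_cong[OF op, of "unit_speed c" "\<lambda>y. sgn (?w x) / sqrt (g c y $ \<iota> $ \<iota>)" k] sgn
    by (simp add: unit_speed_def)
  moreover have "x \<in> ?U" using x angular_axis_nonzero[OF c x] by (simp add: zero_less_mult_iff) linarith
  ultimately show "\<exists>U. open U \<and> x \<in> U \<and> Ck_on k (unit_speed c) U" using op by blast
qed

text \<open>Let \<open>j\<close> be the scalar Jacobian from \<open>c\<close> to \<open>d\<close>.
  The angular form in \<open>c\<close> is \<open>j\<close> times that in \<open>d\<close>, and the
  square root of the metric component is \<open>|j|\<close> times that in \<open>d\<close>. As
  \<open>sgn j / |j| = 1 / j\<close>, the quotient transforms as the component of a vector
  field.\<close>

lemma smooth_unit_field: "smooth_vector_field \<A> unit_field"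
  unfolding smooth_vector_field_def
proof (intro conjI ballI)
  fix c assume c: "c \<in> \<A>"
  show "smooth_on (unit_field c) (cimg c)"
    unfolding smooth_on_def unit_field_def
    using Ck_on_scaleR[OF open_cimg[OF c] Ck_on_unit_speed[OF c] Ck_on_const[OF open_cimg[OF c]]] by blast
next
  fix c d x assume c: "c \<in> \<A>" and d: "d \<in> \<A>" and "x \<in> cmap c ` (cdom c \<inter> cdom d)"
  then have x: "x \<in> overlap c d" by (simp add: overlap_def)
  let ?j = "jacobian c d x $ \<iota> $ \<iota>" and ?t = "transition c d x"
  have J: "jacobian c d x *v axis \<iota> 1 = ?j *\<^sub>R axis \<iota> 1"
    by (simp add: vec_eq_iff matrix_vector_mult_def dim all_index axis_def)
  have td: "?t \<in> cimg d" using transition_overlap(1)[OF c d x] mem_overlap[OF d c] by blast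
  have j: "?j \<noteq> 0"
  proof
    assume "?j = 0"
    then have "jacobian c d x = 0" by (simp add: vec_eq_iff all_index)
    then have "mat 1 $ \<iota> $ \<iota> = (0::real)"
      using jacobian_inverse[OF c d x] by (metis (no_types) matrix_vector_mult_0 times0_right zero_index)
    then show False by (simp add: mat_def)
  qed
  have gj: "g c x $ \<iota> $ \<iota> = ?j\<^sup>2 * g d ?t $ \<iota> $ \<iota>"
    using metric_transition[OF c d x]
    by (simp add: matrix_matrix_mult_def transpose_def dim power2_eq_square)
  have lin: "linear (frechet_derivative (\<lambda>y. F (cinv d y)) (at ?t))"
  proof -
    obtain a where a: "angle_chart a \<in> circle_atlas" "norm a = 1" "?t \<in> circle_coord_dom F a d"
      by (rule circle_coord_at[OF F G GF d td])
    show ?thesis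
      using has_derivative_linear[OF F_chart_derivative[OF F G GF a(1,2) d a(3)]]
        has_derivative_imp_frechet[OF F_chart_derivative[OF F G GF a(1,2) d a(3)]] by simp
  qed
  have wj: "angular F c x (axis \<iota> 1) = ?j * angular F d ?t (axis \<iota> 1)"
  proof -
    have "angular F c x (axis \<iota> 1) = angular F d ?t (?j *\<^sub>R axis \<iota> 1)"
      by (subst J[symmetric]) (rule angular_transition[OF F G GF c d x])
    also have "\<dots> = ?j * angular F d ?t (axis \<iota> 1)"
      by (simp add: angular_def[OF F G GF] linear_scale[OF lin] algebra_simps)
    finally show ?thesis .
  qed
  have "unit_speed d ?t = ?j * unit_speed c x"
    using j by (simp add: unit_speed_def gj wj sgn_mult real_sqrt_mult) (simp add: sgn_if)
  then show "unit_field d ?t = jacobian c d x *v unit_field c x"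
    by (simp add: unit_field_def matrix_vector_mult_scaleR J)
qed

text \<open>In one dimension the field has a single component \<open>q\<close> and the metric a
  single component \<open>G\<close>, with \<open>q * q * G = 1\<close>. Differentiating this
  relation gives the vanishing of the Lie derivative, and the relation itself identifies the tensor
  square of the dual form with the metric.\<close>

lemma bakry_emery_unit_field:
  assumes c: "c \<in> \<A>" and x: "x \<in> cimg c"
  shows "bakry_emery_ricci m (unit_field c) (g c) x = ricci (g c) x - (1/m) *\<^sub>R g c x"
proof -
  let ?q = "unit_speed c" and ?G = "\<lambda>y. g c y $ \<iota> $ \<iota>"
  have comp: "(\<lambda>y. unit_field c y $ \<iota>) = ?q" by (simp add: unit_field_def)
  have qd: "?q differentiable (at x)" using Ck_on_unit_speed[OF c, of 1] x by simp
  have Gd: "?G differentiable (at x)"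
    using matrix_component_differentiable[OF smooth_on_differentiable[OF metric_smooth[OF c] x]]
    by (auto simp: differentiable_def)
  \<comment> \<open>The bracket is the single component of the Lie derivative; the factor
    \<open>?q x\<close> completes it to the derivative of the constant function
    \<open>?q * ?q * ?G\<close>, and can be cancelled since it is nonzero.\<close>
  have "?q x * (?q x * pd \<iota> ?G x + 2 * pd \<iota> ?q x * ?G x)
      = ?q x * ?q x * pd \<iota> ?G x + (?q x * pd \<iota> ?q x + pd \<iota> ?q x * ?q x) * ?G x"
    by (simp add: algebra_simps)
  also have "\<dots> = pd \<iota> (\<lambda>y. ?q y * ?q y * ?G y) x"
    using qd Gd by (simp add: pd_mult differentiable_mult)
  also have "\<dots> = pd \<iota> (\<lambda>_. 1) x"
    unfolding pd_def
    using frechet_derivative_cong_open[OF open_cimg[OF c] x, of "\<lambda>y. ?q y * ?q y * ?G y" "\<lambda>_. 1"]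
      unit_speed_square[OF c] by simp
  also have "\<dots> = 0" by (simp add: pd_def)
  finally have "?q x * (?q x * pd \<iota> ?G x + 2 * pd \<iota> ?q x * ?G x) = 0" .
  moreover have "?q x \<noteq> 0" using unit_speed_square[OF c x] by auto
  ultimately have "?q x * pd \<iota> ?G x + 2 * pd \<iota> ?q x * ?G x = 0" by simp
  then have "lie_derivative (unit_field c) (g c) x $ \<iota> $ \<iota> = 0"
    by (simp add: lie_derivative_def dim comp) (simp add: unit_field_def algebra_simps)
  then have "lie_derivative (unit_field c) (g c) x = 0" by (simp add: vec_eq_iff all_index)
  moreover have "tensor_square (flat (g c) (unit_field c) x) = g c x"
  proof -
    have "flat (g c) (unit_field c) x $ \<iota> = ?G x * ?q x"
      by (simp add: flat_def unit_field_def matrix_vector_mult_def dim)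
    then show ?thesis
      using unit_speed_square[OF c x] by (simp add: tensor_square_def vec_eq_iff all_index algebra_simps)
  qed
  ultimately show ?thesis by (simp add: bakry_emery_ricci_def)
qed

lemma unit_field_nonzero: "c \<in> \<A> \<Longrightarrow> x \<in> cimg c \<Longrightarrow> unit_field c x \<noteq> 0"
  using unit_speed_square[of c x] by (auto simp: unit_field_def axis_eq_0_iff)

end

end

theorem theorem1p4:
  fixes m :: real
    and T :: "'a topology"
    and \<A> :: "('a, 'n::finite) chart set"
    and g :: "('a, 'n) form2"
  assumes "m \<noteq> 0"
    and "riemannian_manifold T \<A> g"
    and "compact_space T"
    and "einstein \<A> g"
  shows "nontrivially_quasi_einstein \<A> g m \<longleftrightarrow> diffeomorphic T \<A> circle circle_atlas"
proof -
  interpret riemannian_manifold T \<A> g by fact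
  obtain \<rho> where \<rho>: "\<And>c x. c \<in> \<A> \<Longrightarrow> x \<in> cimg c \<Longrightarrow> ricci (g c) x = \<rho> *\<^sub>R g c x"
    using assms(4) by (auto simp: einstein_def)
  have index: "\<exists>\<iota>. (UNIV :: 'n set) = {\<iota>}" if "CARD('n) = 1"
    using that by (metis card_1_singletonE)
  show ?thesis
  proof
    assume "nontrivially_quasi_einstein \<A> g m"
    then obtain X A where X: "smooth_vector_field \<A> X" "\<not> trivial_field \<A> X"
      and A: "\<And>c x. c \<in> \<A> \<Longrightarrow> x \<in> cimg c \<Longrightarrow> bakry_emery_ricci m (X c) (g c) x = A *\<^sub>R g c x"
      by (auto simp: nontrivially_quasi_einstein_def quasi_einstein_def)
    \<comment> \<open>The Einstein condition turns the Ricci term into a multiple of the metric,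
      which moves into the constant on the right.\<close>
    have "(1/2) *\<^sub>R lie_derivative (X c) (g c) x - (1/m) *\<^sub>R tensor_square (flat (g c) (X c) x) = (A - \<rho>) *\<^sub>R g c x"
      if "c \<in> \<A>" "x \<in> cimg c" for c x
      using A[OF that] \<rho>[OF that] by (simp add: bakry_emery_ricci_def algebra_simps)
    note rigid = quasi_einstein_rigidity[OF assms(3,1) X this]
    obtain \<iota> :: 'n where "UNIV = {\<iota>}" using index rigid(1) by blast
    then interpret nonvanishing_field_1 T \<A> X \<iota>
      by unfold_locales (use X(1) rigid(2) in auto)
    show "diffeomorphic T \<A> circle circle_atlas" by (rule diffeomorphic_circle[OF assms(3)])
  next
    assume "diffeomorphic T \<A> circle circle_atlas"
    then obtain F G where FG: "smooth_map T \<A> circle circle_atlas F" "smooth_map circle circle_atlas T \<A> G"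
      "\<And>p. p \<in> topspace T \<Longrightarrow> G (F p) = p"
      unfolding diffeomorphic_def by blast
    obtain \<iota> :: 'n where "UNIV = {\<iota>}" using index dimension_1[OF FG] by blast
    note * = FG this
    have "quasi_einstein \<A> g m (unit_field F \<iota>)"
      unfolding quasi_einstein_def
      using bakry_emery_unit_field[OF *] \<rho>
      by (intro exI[of _ "\<rho> - 1 / m"]) (simp add: scaleR_diff_left)
    moreover have "\<not> trivial_field \<A> (unit_field F \<iota>)"
    proof -
      obtain p where "p \<in> topspace T" using nonempty by blast
      then obtain c where "c \<in> \<A>" "p \<in> cdom c" by (rule chart_at)
      then show ?thesis
        using unit_field_nonzero[OF *] cmap_cimg unfolding trivial_field_def by blast
    qed
    ultimately show "nontrivially_quasi_einstein \<A> g m"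
      unfolding nontrivially_quasi_einstein_def using smooth_unit_field[OF *] by blast
  qed
qed

end
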